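(* Let $\mathbb{X}$ be a semi-abelian category, let $n\ge 0$, and let $X$ be a simplicial object in $\mathbb{X}$ with Moore chain complex $M=N(X)$. Then the normalization functor $N$ maps the short exact sequence of $X$ given by the torsion theory $\mu_{\geq n+1}=(\mathcal{T}_{tr_n},\mathcal{F}_{tr_n})$ in $Simp(\mathbb{X})$ into the short exact sequence of $M$ given by the torsion theory $\mathcal{KER}_{n+1}=(pch(\mathbb{X})_{\geq n+1},\mathcal{MN}_{n+1})$ in $pch(\mathbb{X})$. Moreover, $N$ maps the torsion theory $\mu_{\geq n+1}$ into $\mathcal{KER}_{n+1}$, i.e. $N$ maps the subcategory $\mathcal{T}_{tr_n}$ into $pch(\mathbb{X})_{\geq n+1}$ and $\mathcal{F}_{tr_n}$ into $\mathcal{MN}_{n+1}$.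
   Context: $Simp(\mathbb{X})$ is the category of simplicial objects in $\mathbb{X}$, with faces $d_i$. The Moore normalization is $N(X)_0=X_0$, $N(X)_k=\bigcap_{i=0}^{k-1}\ker(d_i:X_k\to X_{k-1})$ for $k\ge1$, with differential $\delta_k$ induced by $d_k$ (zero in negative degrees). A chain complex ($\mathbb{Z}$-indexed) in $\mathbb{X}$ is proper if for each differential $\delta_i=m_ie_i$ (normal epi/mono factorization) the image $m_i$ is a normal monomorphism; $ch(\mathbb{X})$ and $pch(\mathbb{X})$ denote the categories of chain complexes and of proper chain complexes. For $\mathbb{X}$ semi-abelian, $N$ takes values in $pch(\mathbb{X})$. A short exact sequence in $pch(\mathbb{X})$ is a short exact sequence in $ch(\mathbb{X})$ with proper terms. A torsion theory is a pair $(\mathcal{T},\mathcal{F})$ of full replete subcategories such that every morphism from an object of $\mathcal{T}$ to one of $\mathcal{F}$ is zero and each object $X$ admits a (necessarily unique up to isomorphism) short exact sequence $0\to T_X\to X\to F_X\to 0$ with $T_X\in\mathcal{T}$, $F_X\in\mathcal{F}$, called the short exact sequence of $X$ given by the torsion theory. $tr_n$ is truncation to $n$-truncated simplicial objects, $cosk_n$ its right adjoint, $\eta_X:X\to cosk_ntr_n(X)$ the unit. $\mathcal{T}_{tr_n}$ consists of the simplicial objects with $X_i=0$ for $i\le n$, $\mathcal{F}_{tr_n}$ of those with $\eta_X$ monic; $\mu_{\geq n+1}=(\mathcal{T}_{tr_n},\mathcal{F}_{tr_n})$ is a torsion theory in $Simp(\mathbb{X})$ whose short exact sequence is $0\to\ker(\eta_X)\to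 X\to\eta_X(X)\to0$. $pch(\mathbb{X})_{\geq n}$ is the full subcategory of proper chain complexes with $M_i=0$ for $i<n$, and $\mathcal{MN}_n$ is the full subcategory of proper chain complexes with $\delta_n$ a normal monomorphism and $M_i=0$ for $i>n$. $\mathcal{KER}_n=(pch(\mathbb{X})_{\geq n},\mathcal{MN}_n)$ is a torsion theory in $pch(\mathbb{X})$; the torsion part of $M$ is $\dots\to M_{n+1}\to\ker(\delta_n)\to0\to\dots$ and the torsion-free part is $\dots\to 0\to\delta_n(M_n)\to M_{n-1}\to M_{n-2}\to\dots$. *)

theory Defs
  imports Main "HOL-Library.FuncSet"
begin

section \<open>Categories, functors, adjunctions\<close>

record ('o, 'm) cat =
  Obj :: "'o set"
  Arr :: "'m set"
  Dom :: "'m \<Rightarrow> 'o"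
  Cod :: "'m \<Rightarrow> 'o"
  Id :: "'o \<Rightarrow> 'm"
  Comp :: "'m \<Rightarrow> 'm \<Rightarrow> 'm" (infixl "\<cdot>\<index>" 70)

definition hom :: "('o, 'm, 'z) cat_scheme \<Rightarrow> 'o \<Rightarrow> 'o \<Rightarrow> 'm set" where
  "hom C A B = {f \<in> Arr C. Dom C f = A \<and> Cod C f = B}"

locale category =
  fixes C :: "('o, 'm) cat" (structure)
  assumes Dom_in: "f \<in> Arr C \<Longrightarrow> Dom C f \<in> Obj C"
    and Cod_in: "f \<in> Arr C \<Longrightarrow> Cod C f \<in> Obj C"
    and Id_in: "A \<in> Obj C \<Longrightarrow> Id C A \<in> hom C A A"
    and Comp_in: "f \<in> hom C A B \<Longrightarrow> g \<in> hom C B D \<Longrightarrow> g \<cdot> f \<in> hom C A D"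
    and Id_left: "f \<in> hom C A B \<Longrightarrow> Id C B \<cdot> f = f"
    and Id_right: "f \<in> hom C A B \<Longrightarrow> f \<cdot> Id C A = f"
    and Comp_assoc: "f \<in> hom C A B \<Longrightarrow> g \<in> hom C B D \<Longrightarrow> h \<in> hom C D E
      \<Longrightarrow> (h \<cdot> g) \<cdot> f = h \<cdot> (g \<cdot> f)"

definition op_cat :: "('o, 'm) cat \<Rightarrow> ('o, 'm) cat" where
  "op_cat C = \<lparr>Obj = Obj C, Arr = Arr C, Dom = Cod C, Cod = Dom C, Id = Id C,
     Comp = (\<lambda>g f. f \<cdot>\<^bsub>C\<^esub> g)\<rparr>"

definition full_subcat :: "('o, 'm) cat \<Rightarrow> 'o set \<Rightarrow> ('o, 'm) cat" where
  "full_subcat C S = C\<lparr>Obj := Obj C \<inter> S, Arr := {f \<in> Arr C. Dom C f \<in> S \<and> Cod C f \<in> S}\<rparr>"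

record ('a, 'b, 'o, 'm) funct =
  FOb :: "'a \<Rightarrow> 'o"
  FAr :: "'b \<Rightarrow> 'm"

definition is_functor :: "('a, 'b) cat \<Rightarrow> ('o, 'm) cat \<Rightarrow> ('a, 'b, 'o, 'm) funct \<Rightarrow> bool" where
  "is_functor C D F \<longleftrightarrow>
     (\<forall>A\<in>Obj C. FOb F A \<in> Obj D) \<and>
     (\<forall>A B. \<forall>f\<in>hom C A B. FAr F f \<in> hom D (FOb F A) (FOb F B)) \<and>
     (\<forall>A\<in>Obj C. FAr F (Id C A) = Id D (FOb F A)) \<and>
     (\<forall>f\<in>Arr C. \<forall>g\<in>Arr C. Cod C f = Dom C g \<longrightarrow> FAr F (g \<cdot>\<^bsub>C\<^esub> f) = FAr F g \<cdot>\<^bsub>D\<^esub> FAr F f)"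

definition nat_trans ::
    "('a, 'b) cat \<Rightarrow> ('o, 'm) cat \<Rightarrow> ('a, 'b, 'o, 'm) funct \<Rightarrow> ('a, 'b, 'o, 'm) funct \<Rightarrow> ('a \<Rightarrow> 'm) \<Rightarrow> bool" where
  "nat_trans C D F G \<alpha> \<longleftrightarrow>
     (\<forall>A\<in>Obj C. \<alpha> A \<in> hom D (FOb F A) (FOb G A)) \<and>
     (\<forall>f\<in>Arr C. \<alpha> (Cod C f) \<cdot>\<^bsub>D\<^esub> FAr F f = FAr G f \<cdot>\<^bsub>D\<^esub> \<alpha> (Dom C f))"

definition id_funct :: "('a, 'b, 'a, 'b) funct" where
  "id_funct = \<lparr>FOb = (\<lambda>A. A), FAr = (\<lambda>f. f)\<rparr>"

definition comp_funct ::
    "('a, 'b, 'o, 'm) funct \<Rightarrow> ('c, 'd, 'a, 'b) funct \<Rightarrow> ('c, 'd, 'o, 'm) funct" where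
  "comp_funct G F = \<lparr>FOb = FOb G \<circ> FOb F, FAr = FAr G \<circ> FAr F\<rparr>"

text \<open>\<^term>\<open>F\<close> is left adjoint to \<^term>\<open>G\<close>, with unit \<^term>\<open>\<eta>\<close> and counit \<^term>\<open>\<epsilon>\<close>.\<close>

definition adjunction ::
    "('a, 'b) cat \<Rightarrow> ('o, 'm) cat \<Rightarrow> ('a, 'b, 'o, 'm) funct \<Rightarrow> ('o, 'm, 'a, 'b) funct
      \<Rightarrow> ('a \<Rightarrow> 'b) \<Rightarrow> ('o \<Rightarrow> 'm) \<Rightarrow> bool" where
  "adjunction C D F G \<eta> \<epsilon> \<longleftrightarrow>
     is_functor C D F \<and> is_functor D C G \<and>
     nat_trans C C id_funct (comp_funct G F) \<eta> \<and>
     nat_trans D D (comp_funct F G) id_funct \<epsilon> \<and>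
     (\<forall>A\<in>Obj C. \<epsilon> (FOb F A) \<cdot>\<^bsub>D\<^esub> FAr F (\<eta> A) = Id D (FOb F A)) \<and>
     (\<forall>B\<in>Obj D. FAr G (\<epsilon> B) \<cdot>\<^bsub>C\<^esub> \<eta> (FOb G B) = Id C (FOb G B))"

text \<open>Functors \<open>C \<rightarrow> D\<close> and their transformations as a category. Functions are required to be
  \<^const>\<open>undefined\<close> off their mathematical domain, so that equality of the
  representations is equality of functors and of natural transformations.\<close>

definition funct_cat :: "('a, 'b) cat \<Rightarrow> ('o, 'm) cat
    \<Rightarrow> (('a, 'b, 'o, 'm) funct,
        ('a, 'b, 'o, 'm) funct \<times> ('a, 'b, 'o, 'm) funct \<times> ('a \<Rightarrow> 'm)) cat" where
  "funct_cat C D =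
    (let obs = {F. is_functor C D F \<and> FOb F \<in> extensional (Obj C) \<and> FAr F \<in> extensional (Arr C)}
     in \<lparr>Obj = obs,
         Arr = {(F, G, \<alpha>). F \<in> obs \<and> G \<in> obs \<and> nat_trans C D F G \<alpha> \<and> \<alpha> \<in> extensional (Obj C)},
         Dom = (\<lambda>(F, G, \<alpha>). F),
         Cod = (\<lambda>(F, G, \<alpha>). G),
         Id = (\<lambda>F. (F, F, \<lambda>A\<in>Obj C. Id D (FOb F A))),
         Comp = (\<lambda>(G, H, \<beta>) (F, G', \<alpha>). (F, H, \<lambda>A\<in>Obj C. \<beta> A \<cdot>\<^bsub>D\<^esub> \<alpha> A))\<rparr>)"


section \<open>Limits, colimits, special morphisms\<close>

definition mono :: "('o, 'm) cat \<Rightarrow> 'm \<Rightarrow> bool" where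
  "mono C m \<longleftrightarrow> m \<in> Arr C \<and>
     (\<forall>A. \<forall>f\<in>hom C A (Dom C m). \<forall>g\<in>hom C A (Dom C m). m \<cdot>\<^bsub>C\<^esub> f = m \<cdot>\<^bsub>C\<^esub> g \<longrightarrow> f = g)"

definition iso :: "('o, 'm) cat \<Rightarrow> 'm \<Rightarrow> bool" where
  "iso C f \<longleftrightarrow> f \<in> Arr C \<and>
     (\<exists>g\<in>hom C (Cod C f) (Dom C f). g \<cdot>\<^bsub>C\<^esub> f = Id C (Dom C f) \<and> f \<cdot>\<^bsub>C\<^esub> g = Id C (Cod C f))"

definition zero_obj :: "('o, 'm) cat \<Rightarrow> 'o \<Rightarrow> bool" where
  "zero_obj C Z \<longleftrightarrow> Z \<in> Obj C \<and> (\<forall>A\<in>Obj C. (\<exists>!f. f \<in> hom C A Z) \<and> (\<exists>!f. f \<in> hom C Z A))"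

definition zero_arr :: "('o, 'm) cat \<Rightarrow> 'm \<Rightarrow> bool" where
  "zero_arr C f \<longleftrightarrow> f \<in> Arr C \<and>
     (\<exists>Z. zero_obj C Z \<and> (\<exists>g\<in>hom C (Dom C f) Z. \<exists>h\<in>hom C Z (Cod C f). f = h \<cdot>\<^bsub>C\<^esub> g))"

definition is_kernel :: "('o, 'm) cat \<Rightarrow> 'm \<Rightarrow> 'm \<Rightarrow> bool" where
  "is_kernel C f k \<longleftrightarrow> f \<in> Arr C \<and> k \<in> Arr C \<and> Cod C k = Dom C f \<and> zero_arr C (f \<cdot>\<^bsub>C\<^esub> k) \<and>
     (\<forall>h\<in>Arr C. Cod C h = Dom C f \<and> zero_arr C (f \<cdot>\<^bsub>C\<^esub> h)
        \<longrightarrow> (\<exists>!u. u \<in> hom C (Dom C h) (Dom C k) \<and> k \<cdot>\<^bsub>C\<^esub> u = h))"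

definition is_cokernel :: "('o, 'm) cat \<Rightarrow> 'm \<Rightarrow> 'm \<Rightarrow> bool" where
  "is_cokernel C f q \<longleftrightarrow> f \<in> Arr C \<and> q \<in> Arr C \<and> Dom C q = Cod C f \<and> zero_arr C (q \<cdot>\<^bsub>C\<^esub> f) \<and>
     (\<forall>h\<in>Arr C. Dom C h = Cod C f \<and> zero_arr C (h \<cdot>\<^bsub>C\<^esub> f)
        \<longrightarrow> (\<exists>!u. u \<in> hom C (Cod C q) (Cod C h) \<and> u \<cdot>\<^bsub>C\<^esub> q = h))"

definition normal_mono :: "('o, 'm) cat \<Rightarrow> 'm \<Rightarrow> bool" where
  "normal_mono C m \<longleftrightarrow> (\<exists>f. is_kernel C f m)"

definition normal_epi :: "('o, 'm) cat \<Rightarrow> 'm \<Rightarrow> bool" where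
  "normal_epi C e \<longleftrightarrow> (\<exists>f. is_cokernel C f e)"

text \<open>\<open>0 \<rightarrow> A \<rightarrow>\<^sup>k X \<rightarrow>\<^sup>q B \<rightarrow> 0\<close>\<close>

definition short_exact :: "('o, 'm) cat \<Rightarrow> 'm \<Rightarrow> 'm \<Rightarrow> bool" where
  "short_exact C k q \<longleftrightarrow> is_kernel C q k \<and> is_cokernel C k q"

text \<open>\<^term>\<open>p\<close> and \<^term>\<open>q\<close> are the projections of a pullback of \<^term>\<open>f\<close> and \<^term>\<open>g\<close>:
  \<open>f p = g q\<close>.\<close>

definition is_pullback :: "('o, 'm) cat \<Rightarrow> 'm \<Rightarrow> 'm \<Rightarrow> 'm \<Rightarrow> 'm \<Rightarrow> bool" where
  "is_pullback C f g p q \<longleftrightarrow>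
     f \<in> Arr C \<and> g \<in> Arr C \<and> Cod C f = Cod C g \<and>
     p \<in> Arr C \<and> q \<in> Arr C \<and> Dom C p = Dom C q \<and> Cod C p = Dom C f \<and> Cod C q = Dom C g \<and>
     f \<cdot>\<^bsub>C\<^esub> p = g \<cdot>\<^bsub>C\<^esub> q \<and>
     (\<forall>W. \<forall>a\<in>hom C W (Dom C f). \<forall>b\<in>hom C W (Dom C g). f \<cdot>\<^bsub>C\<^esub> a = g \<cdot>\<^bsub>C\<^esub> b
        \<longrightarrow> (\<exists>!u. u \<in> hom C W (Dom C p) \<and> p \<cdot>\<^bsub>C\<^esub> u = a \<and> q \<cdot>\<^bsub>C\<^esub> u = b))"

definition is_coequalizer :: "('o, 'm) cat \<Rightarrow> 'm \<Rightarrow> 'm \<Rightarrow> 'm \<Rightarrow> bool" where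
  "is_coequalizer C f g q \<longleftrightarrow>
     f \<in> Arr C \<and> g \<in> Arr C \<and> Dom C f = Dom C g \<and> Cod C f = Cod C g \<and>
     q \<in> Arr C \<and> Dom C q = Cod C f \<and> q \<cdot>\<^bsub>C\<^esub> f = q \<cdot>\<^bsub>C\<^esub> g \<and>
     (\<forall>h\<in>Arr C. Dom C h = Cod C f \<and> h \<cdot>\<^bsub>C\<^esub> f = h \<cdot>\<^bsub>C\<^esub> g
        \<longrightarrow> (\<exists>!u. u \<in> hom C (Cod C q) (Cod C h) \<and> u \<cdot>\<^bsub>C\<^esub> q = h))"

definition regular_epi :: "('o, 'm) cat \<Rightarrow> 'm \<Rightarrow> bool" where
  "regular_epi C e \<longleftrightarrow> (\<exists>f g. is_coequalizer C f g e)"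

definition is_coproduct :: "('o, 'm) cat \<Rightarrow> 'o \<Rightarrow> 'o \<Rightarrow> 'm \<Rightarrow> 'm \<Rightarrow> bool" where
  "is_coproduct C A B i j \<longleftrightarrow>
     i \<in> Arr C \<and> j \<in> Arr C \<and> Dom C i = A \<and> Dom C j = B \<and> Cod C i = Cod C j \<and>
     (\<forall>W. \<forall>a\<in>hom C A W. \<forall>b\<in>hom C B W.
        \<exists>!u. u \<in> hom C (Cod C i) W \<and> u \<cdot>\<^bsub>C\<^esub> i = a \<and> u \<cdot>\<^bsub>C\<^esub> j = b)"

text \<open>\<^term>\<open>m\<close> represents the intersection of the subobjects of \<^term>\<open>A\<close> represented by the
  monomorphisms in \<^term>\<open>S\<close>.\<close>

definition is_intersection :: "('o, 'm) cat \<Rightarrow> 'o \<Rightarrow> 'm set \<Rightarrow> 'm \<Rightarrow> bool" where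
  "is_intersection C A S m \<longleftrightarrow> m \<in> Arr C \<and> Cod C m = A \<and>
     (\<forall>s\<in>S. \<exists>u\<in>hom C (Dom C m) (Dom C s). m = s \<cdot>\<^bsub>C\<^esub> u) \<and>
     (\<forall>h\<in>Arr C. Cod C h = A \<and> (\<forall>s\<in>S. \<exists>u\<in>hom C (Dom C h) (Dom C s). h = s \<cdot>\<^bsub>C\<^esub> u)
        \<longrightarrow> (\<exists>!v. v \<in> hom C (Dom C h) (Dom C m) \<and> m \<cdot>\<^bsub>C\<^esub> v = h))"


section \<open>Semi-abelian categories\<close>

definition pointed :: "('o, 'm) cat \<Rightarrow> bool" where
  "pointed C \<longleftrightarrow> (\<exists>Z. zero_obj C Z)"

definition has_terminal :: "('o, 'm) cat \<Rightarrow> bool" where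
  "has_terminal C \<longleftrightarrow> (\<exists>T\<in>Obj C. \<forall>A\<in>Obj C. \<exists>!f. f \<in> hom C A T)"

definition has_pullbacks :: "('o, 'm) cat \<Rightarrow> bool" where
  "has_pullbacks C \<longleftrightarrow>
     (\<forall>f\<in>Arr C. \<forall>g\<in>Arr C. Cod C f = Cod C g \<longrightarrow> (\<exists>p q. is_pullback C f g p q))"

definition has_binary_coproducts :: "('o, 'm) cat \<Rightarrow> bool" where
  "has_binary_coproducts C \<longleftrightarrow> (\<forall>A\<in>Obj C. \<forall>B\<in>Obj C. \<exists>i j. is_coproduct C A B i j)"

definition finitely_complete :: "('o, 'm) cat \<Rightarrow> bool" where
  "finitely_complete C \<longleftrightarrow> has_terminal C \<and> has_pullbacks C"

definition regular :: "('o, 'm) cat \<Rightarrow> bool" where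
  "regular C \<longleftrightarrow> finitely_complete C \<and>
     (\<forall>f p q. is_pullback C f f p q \<longrightarrow> (\<exists>e. is_coequalizer C p q e)) \<and>
     (\<forall>f e p q. regular_epi C e \<and> is_pullback C f e p q \<longrightarrow> regular_epi C p)"

definition equivalence_relation :: "('o, 'm) cat \<Rightarrow> 'm \<Rightarrow> 'm \<Rightarrow> bool" where
  "equivalence_relation C r\<^sub>1 r\<^sub>2 \<longleftrightarrow>
     r\<^sub>1 \<in> Arr C \<and> r\<^sub>2 \<in> Arr C \<and> Dom C r\<^sub>1 = Dom C r\<^sub>2 \<and> Cod C r\<^sub>1 = Cod C r\<^sub>2 \<and>
     (\<forall>W. \<forall>u\<in>hom C W (Dom C r\<^sub>1). \<forall>v\<in>hom C W (Dom C r\<^sub>1).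
        r\<^sub>1 \<cdot>\<^bsub>C\<^esub> u = r\<^sub>1 \<cdot>\<^bsub>C\<^esub> v \<and> r\<^sub>2 \<cdot>\<^bsub>C\<^esub> u = r\<^sub>2 \<cdot>\<^bsub>C\<^esub> v \<longrightarrow> u = v) \<and>
     (\<exists>d\<in>hom C (Cod C r\<^sub>1) (Dom C r\<^sub>1).
        r\<^sub>1 \<cdot>\<^bsub>C\<^esub> d = Id C (Cod C r\<^sub>1) \<and> r\<^sub>2 \<cdot>\<^bsub>C\<^esub> d = Id C (Cod C r\<^sub>1)) \<and>
     (\<exists>s\<in>hom C (Dom C r\<^sub>1) (Dom C r\<^sub>1). r\<^sub>1 \<cdot>\<^bsub>C\<^esub> s = r\<^sub>2 \<and> r\<^sub>2 \<cdot>\<^bsub>C\<^esub> s = r\<^sub>1) \<and>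
     (\<forall>p\<^sub>1 p\<^sub>2. is_pullback C r\<^sub>2 r\<^sub>1 p\<^sub>1 p\<^sub>2 \<longrightarrow>
        (\<exists>t\<in>hom C (Dom C p\<^sub>1) (Dom C r\<^sub>1). r\<^sub>1 \<cdot>\<^bsub>C\<^esub> t = r\<^sub>1 \<cdot>\<^bsub>C\<^esub> p\<^sub>1 \<and> r\<^sub>2 \<cdot>\<^bsub>C\<^esub> t = r\<^sub>2 \<cdot>\<^bsub>C\<^esub> p\<^sub>2))"

definition barr_exact :: "('o, 'm) cat \<Rightarrow> bool" where
  "barr_exact C \<longleftrightarrow> regular C \<and>
     (\<forall>r\<^sub>1 r\<^sub>2. equivalence_relation C r\<^sub>1 r\<^sub>2 \<longrightarrow> (\<exists>f. is_pullback C f f r\<^sub>1 r\<^sub>2))"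

text \<open>A point over \<open>B\<close> is a split epimorphism \<^term>\<open>p\<close> with codomain \<open>B\<close> and a chosen
  section \<^term>\<open>s\<close>.\<close>

definition is_point :: "('o, 'm) cat \<Rightarrow> 'm \<Rightarrow> 'm \<Rightarrow> bool" where
  "is_point C p s \<longleftrightarrow> p \<in> Arr C \<and> s \<in> hom C (Cod C p) (Dom C p) \<and> p \<cdot>\<^bsub>C\<^esub> s = Id C (Cod C p)"

text \<open>Bourn protomodularity: for every \<open>e : E \<rightarrow> B\<close>, pulling back along \<^term>\<open>e\<close> is a functor from
  points over \<open>B\<close> to points over \<open>E\<close> that reflects isomorphisms. Here \<^term>\<open>f\<close> is a morphism of
  points from \<open>(p, s)\<close> to \<open>(p', s')\<close> and \<^term>\<open>g\<close> is its pullback; the sections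
  of the pulled-back points need no mention, because a morphism of points is invertible as soon as
  its underlying morphism is.\<close>

definition protomodular :: "('o, 'm) cat \<Rightarrow> bool" where
  "protomodular C \<longleftrightarrow>
     (\<forall>e p s p' s' f a b a' b' g.
        is_point C p s \<and> is_point C p' s' \<and> Cod C p = Cod C p' \<and>
        f \<in> hom C (Dom C p) (Dom C p') \<and> p' \<cdot>\<^bsub>C\<^esub> f = p \<and> f \<cdot>\<^bsub>C\<^esub> s = s' \<and>
        is_pullback C e p a b \<and> is_pullback C e p' a' b' \<and>
        g \<in> hom C (Dom C a) (Dom C a') \<and> a' \<cdot>\<^bsub>C\<^esub> g = a \<and> b' \<cdot>\<^bsub>C\<^esub> g = f \<cdot>\<^bsub>C\<^esub> b \<and> iso C g
        \<longrightarrow> iso C f)"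

definition semi_abelian :: "('o, 'm) cat \<Rightarrow> bool" where
  "semi_abelian C \<longleftrightarrow> category C \<and> pointed C \<and> barr_exact C \<and> protomodular C \<and>
     has_binary_coproducts C"


section \<open>Simplicial objects\<close>

type_synonym simplex_arr = "nat \<times> nat \<times> (nat \<Rightarrow> nat)"

text \<open>The object \<open>n\<close> of the simplex category is the ordinal \<open>[n] = {0, \<dots>, n}\<close>.\<close>

definition simplex_cat :: "(nat, simplex_arr) cat" where
  "simplex_cat =
    \<lparr>Obj = UNIV,
     Arr = {(m, n, \<theta>). \<theta> \<in> {..m} \<rightarrow>\<^sub>E {..n} \<and> mono_on {..m} \<theta>},
     Dom = (\<lambda>(m, n, \<theta>). m),
     Cod = (\<lambda>(m, n, \<theta>). n),
     Id = (\<lambda>n. (n, n, \<lambda>i\<in>{..n}. i)),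
     Comp = (\<lambda>(n, p, \<phi>) (m, n', \<theta>). (m, p, \<lambda>i\<in>{..m}. \<phi> (\<theta> i)))\<rparr>"

type_synonym ('o, 'm) simp = "(nat, simplex_arr, 'o, 'm) funct"
type_synonym ('o, 'm) simp_arr = "('o, 'm) simp \<times> ('o, 'm) simp \<times> (nat \<Rightarrow> 'm)"

definition Simp :: "('o, 'm) cat \<Rightarrow> (('o, 'm) simp, ('o, 'm) simp_arr) cat" where
  "Simp C = funct_cat (op_cat simplex_cat) C"

definition simplex_cat_upto :: "nat \<Rightarrow> (nat, simplex_arr) cat" where
  "simplex_cat_upto n = full_subcat simplex_cat {..n}"

definition Simp_upto :: "nat \<Rightarrow> ('o, 'm) cat \<Rightarrow> (('o, 'm) simp, ('o, 'm) simp_arr) cat" where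
  "Simp_upto n C = funct_cat (op_cat (simplex_cat_upto n)) C"

definition tr_ob :: "nat \<Rightarrow> ('o, 'm) simp \<Rightarrow> ('o, 'm) simp" where
  "tr_ob n X = \<lparr>FOb = restrict (FOb X) {..n}, FAr = restrict (FAr X) (Arr (simplex_cat_upto n))\<rparr>"

definition tr :: "nat \<Rightarrow> (('o, 'm) simp, ('o, 'm) simp_arr, ('o, 'm) simp, ('o, 'm) simp_arr) funct" where
  "tr n = \<lparr>FOb = tr_ob n, FAr = (\<lambda>(X, Y, \<alpha>). (tr_ob n X, tr_ob n Y, restrict \<alpha> {..n}))\<rparr>"

text \<open>The injection \<open>[k - 1] \<rightarrow> [k]\<close> omitting \<open>i\<close>, and the face \<open>d\<^sub>i : X\<^sub>k \<rightarrow> X\<^sub>k\<^sub>-\<^sub>1\<close>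
  (for \<open>k \<ge> 1\<close> and \<open>i \<le> k\<close>).\<close>

definition coface :: "nat \<Rightarrow> nat \<Rightarrow> simplex_arr" where
  "coface k i = (k - 1, k, \<lambda>j\<in>{..k - 1}. if j < i then j else Suc j)"

definition face :: "('o, 'm) simp \<Rightarrow> nat \<Rightarrow> nat \<Rightarrow> 'm" where
  "face X k i = FAr X (coface k i)"


section \<open>Chain complexes\<close>

record ('o, 'm) cpx =
  Term :: "int \<Rightarrow> 'o"
  Diff :: "int \<Rightarrow> 'm"

type_synonym ('o, 'm) cpx_arr = "('o, 'm) cpx \<times> ('o, 'm) cpx \<times> (int \<Rightarrow> 'm)"

definition is_cpx :: "('o, 'm) cat \<Rightarrow> ('o, 'm) cpx \<Rightarrow> bool" where
  "is_cpx C M \<longleftrightarrow>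
     (\<forall>i. Term M i \<in> Obj C \<and> Diff M i \<in> hom C (Term M i) (Term M (i - 1))) \<and>
     (\<forall>i. zero_arr C (Diff M i \<cdot>\<^bsub>C\<^esub> Diff M (i + 1)))"

definition ch :: "('o, 'm) cat \<Rightarrow> (('o, 'm) cpx, ('o, 'm) cpx_arr) cat" where
  "ch C =
    \<lparr>Obj = {M. is_cpx C M},
     Arr = {(M, M', f). is_cpx C M \<and> is_cpx C M' \<and>
              (\<forall>i. f i \<in> hom C (Term M i) (Term M' i)) \<and>
              (\<forall>i. Diff M' i \<cdot>\<^bsub>C\<^esub> f i = f (i - 1) \<cdot>\<^bsub>C\<^esub> Diff M i)},
     Dom = (\<lambda>(M, M', f). M),
     Cod = (\<lambda>(M, M', f). M'),
     Id = (\<lambda>M. (M, M, \<lambda>i. Id C (Term M i))),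
     Comp = (\<lambda>(M', M'', g) (M, N, f). (M, M'', \<lambda>i. g i \<cdot>\<^bsub>C\<^esub> f i))\<rparr>"

definition proper :: "('o, 'm) cat \<Rightarrow> ('o, 'm) cpx \<Rightarrow> bool" where
  "proper C M \<longleftrightarrow> is_cpx C M \<and>
     (\<forall>i. \<exists>m e. normal_epi C e \<and> mono C m \<and> Cod C e = Dom C m \<and> Diff M i = m \<cdot>\<^bsub>C\<^esub> e \<and>
        normal_mono C m)"

definition pch :: "('o, 'm) cat \<Rightarrow> (('o, 'm) cpx, ('o, 'm) cpx_arr) cat" where
  "pch C = full_subcat (ch C) {M. proper C M}"

definition pch_short_exact :: "('o, 'm) cat \<Rightarrow> ('o, 'm) cpx_arr \<Rightarrow> ('o, 'm) cpx_arr \<Rightarrow> bool" where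
  "pch_short_exact C k q \<longleftrightarrow> short_exact (ch C) k q \<and> k \<in> Arr (pch C) \<and> q \<in> Arr (pch C)"


section \<open>Moore normalization\<close>

definition some_zero :: "('o, 'm) cat \<Rightarrow> 'o" where
  "some_zero C = (SOME Z. zero_obj C Z)"

definition zero_between :: "('o, 'm) cat \<Rightarrow> 'o \<Rightarrow> 'o \<Rightarrow> 'm" where
  "zero_between C A B = (THE f. f \<in> hom C A B \<and> zero_arr C f)"

text \<open>A chosen monomorphism representing the subobject \<open>N(X)\<^sub>k\<close> of \<open>X\<^sub>k\<close>.\<close>

definition moore_incl :: "('o, 'm) cat \<Rightarrow> ('o, 'm) simp \<Rightarrow> nat \<Rightarrow> 'm" where
  "moore_incl C X k =
    (if k = 0 then Id C (FOb X 0)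
     else (SOME m. \<exists>\<kappa>. (\<forall>i<k. is_kernel C (face X k i) (\<kappa> i)) \<and>
                       is_intersection C (FOb X k) (\<kappa> ` {..<k}) m))"

definition moore_diff :: "('o, 'm) cat \<Rightarrow> ('o, 'm) simp \<Rightarrow> nat \<Rightarrow> 'm" where
  "moore_diff C X k =
    (THE f. f \<in> hom C (Dom C (moore_incl C X k)) (Dom C (moore_incl C X (k - 1))) \<and>
            moore_incl C X (k - 1) \<cdot>\<^bsub>C\<^esub> f = face X k k \<cdot>\<^bsub>C\<^esub> moore_incl C X k)"

definition moore_term :: "('o, 'm) cat \<Rightarrow> ('o, 'm) simp \<Rightarrow> int \<Rightarrow> 'o" where
  "moore_term C X i = (if i < 0 then some_zero C else Dom C (moore_incl C X (nat i)))"

definition moore_ob :: "('o, 'm) cat \<Rightarrow> ('o, 'm) simp \<Rightarrow> ('o, 'm) cpx" where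
  "moore_ob C X =
    \<lparr>Term = moore_term C X,
     Diff = (\<lambda>i. if i \<le> 0 then zero_between C (moore_term C X i) (moore_term C X (i - 1))
                 else moore_diff C X (nat i))\<rparr>"

definition moore_arr :: "('o, 'm) cat \<Rightarrow> ('o, 'm) simp_arr \<Rightarrow> ('o, 'm) cpx_arr" where
  "moore_arr C = (\<lambda>(X, Y, \<alpha>). (moore_ob C X, moore_ob C Y,
     \<lambda>i. if i < 0 then zero_between C (some_zero C) (some_zero C)
         else (THE g. g \<in> hom C (moore_term C X i) (moore_term C Y i) \<and>
                 moore_incl C Y (nat i) \<cdot>\<^bsub>C\<^esub> g = \<alpha> (nat i) \<cdot>\<^bsub>C\<^esub> moore_incl C X (nat i))))"

definition Moore :: "('o, 'm) cat
    \<Rightarrow> (('o, 'm) simp, ('o, 'm) simp_arr, ('o, 'm) cpx, ('o, 'm) cpx_arr) funct" where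
  "Moore C = \<lparr>FOb = moore_ob C, FAr = moore_arr C\<rparr>"


section \<open>Torsion theories\<close>

text \<open>A torsion theory is represented by the pair \<open>(T, F)\<close> of object classes of its two full replete
  subcategories of \<^term>\<open>D\<close>; the predicate \<^term>\<open>E\<close> says which pairs of composable arrows of
  \<^term>\<open>D\<close> are short exact sequences.\<close>

text \<open>\<open>0 \<rightarrow> T\<^sub>X \<rightarrow>\<^sup>k X \<rightarrow>\<^sup>q F\<^sub>X \<rightarrow> 0\<close> is the short exact sequence of \<open>X\<close> given by \<open>(T, F)\<close>,
  which is unique only up to isomorphism.\<close>

definition ses_given_by ::
    "('o, 'm) cat \<Rightarrow> ('m \<Rightarrow> 'm \<Rightarrow> bool) \<Rightarrow> 'o set \<times> 'o set \<Rightarrow> 'o \<Rightarrow> 'm \<Rightarrow> 'm \<Rightarrow> bool" where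
  "ses_given_by D E = (\<lambda>(T, F) X k q. E k q \<and> Dom D k \<in> T \<and> Cod D k = X \<and> Cod D q \<in> F)"

definition T_tr :: "('o, 'm) cat \<Rightarrow> nat \<Rightarrow> ('o, 'm) simp set" where
  "T_tr C n = {X \<in> Obj (Simp C). \<forall>i\<le>n. zero_obj C (FOb X i)}"

text \<open>Here \<^term>\<open>\<eta>\<close> is the unit of the adjunction between \<open>tr\<^sub>n\<close> and \<open>cosk\<^sub>n\<close>.\<close>

definition F_tr ::
    "('o, 'm) cat \<Rightarrow> (('o, 'm) simp \<Rightarrow> ('o, 'm) simp_arr) \<Rightarrow> ('o, 'm) simp set" where
  "F_tr C \<eta> = {X \<in> Obj (Simp C). mono (Simp C) (\<eta> X)}"

definition mu_geq_Suc :: "('o, 'm) cat \<Rightarrow> nat \<Rightarrow> (('o, 'm) simp \<Rightarrow> ('o, 'm) simp_arr)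
    \<Rightarrow> ('o, 'm) simp set \<times> ('o, 'm) simp set" where
  "mu_geq_Suc C n \<eta> = (T_tr C n, F_tr C \<eta>)"

definition pch_geq :: "('o, 'm) cat \<Rightarrow> int \<Rightarrow> ('o, 'm) cpx set" where
  "pch_geq C n = {M \<in> Obj (pch C). \<forall>i<n. zero_obj C (Term M i)}"

definition MN :: "('o, 'm) cat \<Rightarrow> int \<Rightarrow> ('o, 'm) cpx set" where
  "MN C n = {M \<in> Obj (pch C). normal_mono C (Diff M n) \<and> (\<forall>i>n. zero_obj C (Term M i))}"

definition KER :: "('o, 'm) cat \<Rightarrow> int \<Rightarrow> ('o, 'm) cpx set \<times> ('o, 'm) cpx set" where
  "KER C n = (pch_geq C n, MN C n)"

end

theory Submission
  imports Defs
begin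

text \<open>The differential \<open>N(X)\<^sub>k \<rightarrow> X\<^sub>k\<^sub>-\<^sub>1\<close> restricts a split epimorphism to a normal subobject, and in a
  semi-abelian category direct images of normal subobjects along regular epimorphisms are normal; so
  \<open>N(X)\<close> is proper. If \<open>\<eta>\<^sub>F\<close> is monic, the simplicial subobject of \<open>F\<close> on which all operators to
  degrees \<open>\<le> n\<close> vanish is zero, because its inclusion and the zero map have equal \<open>n\<close>-truncations. It
  contains \<open>N(F)\<^sub>j\<close> for \<open>j > n + 1\<close> and the kernel of \<open>\<delta>\<^sub>n\<^sub>+\<^sub>1\<close>; with properness this gives
  \<open>N(F) \<in> \<M>\<N>\<^sub>n\<^sub>+\<^sub>1\<close>. Finally, in a short exact sequence \<open>T \<rightarrow> X \<rightarrow>\<^sup>q F\<close> as in the theorem, \<open>q\<close> is a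
  pointwise regular epimorphism, monic in degrees \<open>\<le> n\<close>, so \<open>N(q)\<^sub>j\<close> is a pullback of \<open>q\<^sub>j\<close> for
  \<open>j \<le> n + 1\<close>, and \<open>N(F)\<^sub>j = 0\<close> beyond.\<close>

section \<open>Arrows of a category\<close>

text \<open>Exactness in Simp is a universal property among simplicial objects, whereas N is
  computed degree by degree; pointwise kernels and images are therefore assembled into subfunctors
  and compared with the given arrows. \<open>cosk\<close> is arbitrary data known only through the
  adjunction, so monicity of the unit can act only through naturality: \<open>\<eta>\<close> after
  an arrow depends on that arrow only through its truncation. On the quotient side the obstacle is
  to lift an element of N(F) along q while keeping its faces zero; where q is monic one degree lower
  this is automatic, and this shift by one carries the argument up to degree n + 1, the last one in
  which N(F) can be nonzero. Likewise n + 2 vanishing faces kill an element of F, one more than the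
  size of [n]: in degree n + 1 the Moore object supplies n + 1 of them and the kernel of the
  differential the last. Protomodularity enters in one form: a subobject that contains the section
  of a point and everything lying over some fixed arrow into the base is the whole object. Proofs
  run on generalized elements, arrows W -> A, with \<open>factors\<close> as membership.\<close>

context category
begin

lemma hom_iff [simp]: "f \<in> hom C A B \<longleftrightarrow> f \<in> Arr C \<and> Dom C f = A \<and> Cod C f = B"
  by (auto simp: hom_def)

declare Dom_in [simp] Cod_in [simp]

lemma comp_arr [simp]:
  assumes "f \<in> Arr C" "g \<in> Arr C" "Cod C f = Dom C g"
  shows "g \<cdot> f \<in> Arr C" "Dom C (g \<cdot> f) = Dom C f" "Cod C (g \<cdot> f) = Cod C g"
  using Comp_in[of f "Dom C f" "Cod C f" g "Cod C g"] assms by auto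

lemma id_arr [simp]:
  assumes "A \<in> Obj C"
  shows "Id C A \<in> Arr C" "Dom C (Id C A) = A" "Cod C (Id C A) = A"
  using Id_in[OF assms] by auto

lemma comp_id_left [simp]: "f \<in> Arr C \<Longrightarrow> Cod C f = B \<Longrightarrow> Id C B \<cdot> f = f"
  using Id_left[of f "Dom C f" B] by auto

lemma comp_id_right [simp]: "f \<in> Arr C \<Longrightarrow> Dom C f = A \<Longrightarrow> f \<cdot> Id C A = f"
  using Id_right[of f A "Cod C f"] by auto

lemma comp_assoc [simp]:
  assumes "f \<in> Arr C" "g \<in> Arr C" "h \<in> Arr C" "Cod C f = Dom C g" "Cod C g = Dom C h"
  shows "(h \<cdot> g) \<cdot> f = h \<cdot> (g \<cdot> f)"
  using Comp_assoc[of f "Dom C f" "Dom C g" g "Dom C h" h "Cod C h"] assms by auto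

text \<open>Simplification nests composites to the right, so an equation between two-arrow
  composites no longer matches inside \<open>g \<cdot> (f \<cdot> x)\<close>. This form applies it
  at the head of such a composite; the primed variant does so when one side is a single
  arrow.\<close>

lemma comp_assoc_eq:
  assumes "g \<cdot> f = g' \<cdot> f'" "f \<in> Arr C" "g \<in> Arr C" "f' \<in> Arr C" "g' \<in> Arr C"
    "Cod C f = Dom C g" "Cod C f' = Dom C g'"
    "x \<in> Arr C" "Cod C x = Dom C f"
  shows "g \<cdot> (f \<cdot> x) = g' \<cdot> (f' \<cdot> x)"
proof -
  have d: "Dom C f' = Dom C f"
    using assms comp_arr(2)[of f g] comp_arr(2)[of f' g'] by metis
  have "g \<cdot> (f \<cdot> x) = (g \<cdot> f) \<cdot> x" using assms(2-) by simp
  also have "\<dots> = (g' \<cdot> f') \<cdot> x" by (simp only: assms(1))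
  also have "\<dots> = g' \<cdot> (f' \<cdot> x)" using assms d by simp
  finally show ?thesis .
qed

lemma comp_assoc_eq':
  assumes "g \<cdot> f = h" "f \<in> Arr C" "g \<in> Arr C" "Cod C f = Dom C g"
    "x \<in> Arr C" "Cod C x = Dom C f"
  shows "g \<cdot> (f \<cdot> x) = h \<cdot> x"
  using assms by (metis comp_assoc)

lemma mono_arr: "mono C m \<Longrightarrow> m \<in> Arr C"
  by (simp add: mono_def)

lemma monoI:
  assumes "m \<in> hom C A B"
    and "\<And>W a b. \<lbrakk>a \<in> hom C W A; b \<in> hom C W A; m \<cdot> a = m \<cdot> b\<rbrakk> \<Longrightarrow> a = b"
  shows "mono C m"
  using assms unfolding mono_def by auto

lemma mono_cancel:
  assumes "mono C m" "m \<cdot> a = m \<cdot> b" "a \<in> Arr C" "b \<in> Arr C"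
    "Cod C a = Dom C m" "Cod C b = Dom C m"
  shows "a = b"
proof -
  have "Dom C a = Dom C b"
    using assms mono_arr comp_arr(2)[of a m] comp_arr(2)[of b m] by metis
  then show ?thesis using assms unfolding mono_def by auto
qed

lemma iso_inverse:
  assumes "iso C f" "f \<in> hom C A B"
  obtains g where "g \<in> hom C B A" "g \<cdot> f = Id C A" "f \<cdot> g = Id C B"
  using assms unfolding iso_def by auto

lemma isoI:
  assumes "f \<in> hom C A B" "g \<in> hom C B A" "g \<cdot> f = Id C A" "f \<cdot> g = Id C B"
  shows "iso C f"
  using assms unfolding iso_def by auto

text \<open>For monic \<open>m\<close> this is membership of the generalized element
  \<open>h\<close> in the subobject \<open>m\<close>, the relation on which the elementwise
  arguments run.\<close>

definition factors :: "'m \<Rightarrow> 'm \<Rightarrow> bool" where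
  "factors h m \<longleftrightarrow> (\<exists>u\<in>hom C (Dom C h) (Dom C m). m \<cdot> u = h)"

lemma factorsI: "u \<in> Arr C \<Longrightarrow> Dom C u = Dom C h \<Longrightarrow> Cod C u = Dom C m \<Longrightarrow> m \<cdot> u = h \<Longrightarrow> factors h m"
  unfolding factors_def by auto

lemma factorsE:
  assumes "factors h m"
  obtains u where "u \<in> hom C (Dom C h) (Dom C m)" "m \<cdot> u = h"
  using assms unfolding factors_def by auto

lemma factors_lift:
  assumes "factors h m" "h \<in> hom C W A" "m \<in> hom C M A"
  shows "\<exists>u. u \<in> hom C W M \<and> m \<cdot> u = h"
proof -
  have "Dom C h = W" "Dom C m = M" using assms by simp_all
  then show ?thesis using assms(1) unfolding factors_def by blast
qed

lemma mono_split_epi_iso: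
  assumes m: "mono C m" and s: "s \<in> Arr C" "m \<cdot> s = Id C (Cod C m)"
    "Dom C s = Cod C m" "Cod C s = Dom C m"
  shows "iso C m"
proof -
  have ma: "m \<in> Arr C" using m by (rule mono_arr)
  have "m \<cdot> (s \<cdot> m) = m \<cdot> Id C (Dom C m)"
    using ma s by (simp add: comp_assoc_eq'[OF s(2)])
  then have "s \<cdot> m = Id C (Dom C m)"
    by (rule mono_cancel[OF m]) (use ma s in simp_all)
  then show ?thesis using ma s by (intro isoI[of m "Dom C m" "Cod C m" s]) auto
qed

section \<open>Pullbacks in terms of generalized elements\<close>

lemma pullbackI:
  assumes "f \<in> hom C A D" "g \<in> hom C B D" "p \<in> hom C P A" "q \<in> hom C P B" "f \<cdot> p = g \<cdot> q"
    and "\<And>W a b. \<lbrakk>a \<in> hom C W A; b \<in> hom C W B; f \<cdot> a = g \<cdot> b\<rbrakk> \<Longrightarrow> \<exists>u\<in>hom C W P. p \<cdot> u = a \<and> q \<cdot> u = b"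
    and "\<And>W u v. \<lbrakk>u \<in> hom C W P; v \<in> hom C W P; p \<cdot> u = p \<cdot> v; q \<cdot> u = q \<cdot> v\<rbrakk> \<Longrightarrow> u = v"
  shows "is_pullback C f g p q"
proof -
  have "\<exists>!u. u \<in> hom C W P \<and> p \<cdot> u = a \<and> q \<cdot> u = b"
    if ab: "a \<in> hom C W A" "b \<in> hom C W B" "f \<cdot> a = g \<cdot> b" for W a b
  proof -
    obtain u where u: "u \<in> hom C W P" "p \<cdot> u = a" "q \<cdot> u = b"
      using assms(6)[OF ab] by blast
    show ?thesis
      by (rule ex1I[of _ u]) (use u assms(7) in blast)+
  qed
  then show ?thesis
    using assms(1-5) unfolding is_pullback_def hom_def by simp
qed

lemma pullback_lift:
  assumes pb: "is_pullback C f g p q" and t: "p \<in> hom C P A" "q \<in> hom C P B"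
    and ab: "a \<in> hom C W A" "b \<in> hom C W B" "f \<cdot> a = g \<cdot> b"
  shows "\<exists>u. u \<in> hom C W P \<and> p \<cdot> u = a \<and> q \<cdot> u = b"
proof -
  have "Dom C f = A" "Dom C g = B" "Dom C p = P"
    using pb t unfolding is_pullback_def by auto
  then show ?thesis
    using pb ab unfolding is_pullback_def by blast
qed

lemma pullback_cancel:
  assumes pb: "is_pullback C f g p q" and t: "p \<in> hom C P A" "q \<in> hom C P B"
    and uv: "u \<in> hom C W P" "v \<in> hom C W P" "p \<cdot> u = p \<cdot> v" "q \<cdot> u = q \<cdot> v"
  shows "u = v"
proof -
  have 1: "f \<in> Arr C" "g \<in> Arr C" "p \<in> Arr C" "q \<in> Arr C" "Dom C p = P" "Dom C q = P" "Cod C p = Dom C f"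
     "Cod C q = Dom C g" "f \<cdot> p = g \<cdot> q"
    using pb t unfolding is_pullback_def by auto
  have "f \<cdot> (p \<cdot> v) = g \<cdot> (q \<cdot> v)"
    by (rule comp_assoc_eq) (use 1 uv(1,2) in simp_all)
  moreover have "p \<cdot> v \<in> hom C W (Dom C f)" "q \<cdot> v \<in> hom C W (Dom C g)"
    using 1 uv(1,2) by simp_all
  ultimately have "\<exists>!w. w \<in> hom C W P \<and> p \<cdot> w = p \<cdot> v \<and> q \<cdot> w = q \<cdot> v"
    using pb 1(5) unfolding is_pullback_def by blast
  then show ?thesis using uv by blast
qed

section \<open>Regular epimorphisms: cancellation, descent and diagonal lifting\<close>

lemma regular_epi_arr: "regular_epi C e \<Longrightarrow> e \<in> Arr C"
  unfolding regular_epi_def is_coequalizer_def by auto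

lemma coequalizerI:
  assumes "f \<in> hom C R A" "g \<in> hom C R A" "q \<in> hom C A B" "q \<cdot> f = q \<cdot> g"
    and "\<And>h D. \<lbrakk>h \<in> hom C A D; h \<cdot> f = h \<cdot> g\<rbrakk> \<Longrightarrow> \<exists>u\<in>hom C B D. u \<cdot> q = h"
    and "\<And>u v D. \<lbrakk>u \<in> hom C B D; v \<in> hom C B D; u \<cdot> q = v \<cdot> q\<rbrakk> \<Longrightarrow> u = v"
  shows "is_coequalizer C f g q"
proof -
  have "\<exists>!u. u \<in> hom C B D \<and> u \<cdot> q = h" if h: "h \<in> hom C A D" "h \<cdot> f = h \<cdot> g" for h D
  proof -
    obtain u where u: "u \<in> hom C B D" "u \<cdot> q = h"
      using assms(5)[OF h] by blast
    show ?thesis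
      by (rule ex1I[of _ u]) (use u assms(6) in blast)+
  qed
  then show ?thesis
    using assms(1-4) unfolding is_coequalizer_def by (simp cong: conj_cong)
qed

lemma coequalizer_descend:
  assumes "is_coequalizer C f g q" "q \<in> hom C A B" "h \<in> hom C A D" "h \<cdot> f = h \<cdot> g"
  shows "\<exists>u. u \<in> hom C B D \<and> u \<cdot> q = h"
proof -
  have "h \<in> Arr C" "Dom C h = Cod C f" "Cod C h = D" "Cod C q = B"
    using assms(1-3) unfolding is_coequalizer_def by auto
  then show ?thesis using assms(1,4) unfolding is_coequalizer_def by blast
qed

lemma coequalizer_cancel:
  assumes co: "is_coequalizer C f g e" and uv: "u \<cdot> e = v \<cdot> e"
    "u \<in> Arr C" "v \<in> Arr C" "Dom C u = Cod C e" "Dom C v = Cod C e"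
  shows "u = v"
proof -
  have 1: "f \<in> Arr C" "g \<in> Arr C" "e \<in> Arr C" "Dom C e = Cod C f" "Cod C g = Cod C f"
      "Dom C g = Dom C f" "e \<cdot> f = e \<cdot> g"
    using co unfolding is_coequalizer_def by auto
  have cod: "Cod C u = Cod C v"
    using uv 1 comp_arr(3)[of e u] comp_arr(3)[of e v] by metis
  have "(v \<cdot> e) \<cdot> f = (v \<cdot> e) \<cdot> g" using 1 uv(2-) by simp
  moreover have "v \<cdot> e \<in> Arr C" "Dom C (v \<cdot> e) = Cod C f" "Cod C (v \<cdot> e) = Cod C v"
    using 1 uv(2-) by simp_all
  ultimately have "\<exists>!w. w \<in> hom C (Cod C e) (Cod C v) \<and> w \<cdot> e = v \<cdot> e"
    using co unfolding is_coequalizer_def by metis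
  then show ?thesis using uv cod by auto
qed

lemma regular_epi_cancel:
  assumes "regular_epi C e" "u \<cdot> e = v \<cdot> e"
    "u \<in> Arr C" "v \<in> Arr C" "Dom C u = Cod C e" "Dom C v = Cod C e"
  shows "u = v"
  using assms coequalizer_cancel unfolding regular_epi_def by blast

text \<open>The pair coequalized by \<open>e\<close> is itself among the pairs tested by
  \<open>coll\<close>, so the elementwise hypothesis suffices.\<close>

lemma regular_epi_descend:
  assumes re: "regular_epi C e" and e: "e \<in> hom C A B" and h: "h \<in> hom C A D"
    and coll: "\<And>W x y. \<lbrakk>x \<in> hom C W A; y \<in> hom C W A; e \<cdot> x = e \<cdot> y\<rbrakk> \<Longrightarrow> h \<cdot> x = h \<cdot> y"
  shows "\<exists>u. u \<in> hom C B D \<and> u \<cdot> e = h"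
proof -
  obtain f g where fg: "is_coequalizer C f g e"
    using re unfolding regular_epi_def by blast
  have "f \<in> hom C (Dom C f) A" "g \<in> hom C (Dom C f) A" "e \<cdot> f = e \<cdot> g"
    using fg e unfolding is_coequalizer_def by auto
  then have "h \<cdot> f = h \<cdot> g" by (rule coll)
  then show ?thesis using coequalizer_descend[OF fg e h] by blast
qed

text \<open>Orthogonality of regular epimorphisms and monomorphisms: cancelling \<open>m\<close>
  makes \<open>a\<close> identify whatever \<open>e\<close> identifies, and cancelling
  \<open>e\<close> then gives the second triangle.\<close>

lemma regular_epi_lift:
  assumes re: "regular_epi C e" "e \<in> hom C A B" and m: "mono C m" "m \<in> hom C M D"
    and ab: "a \<in> hom C A M" "b \<in> hom C B D" "m \<cdot> a = b \<cdot> e"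
  shows "\<exists>d. d \<in> hom C B M \<and> d \<cdot> e = a \<and> m \<cdot> d = b"
proof -
  have "a \<cdot> x = a \<cdot> y" if xy: "x \<in> hom C W A" "y \<in> hom C W A" "e \<cdot> x = e \<cdot> y" for W x y
  proof (rule mono_cancel[OF m(1)])
    have "m \<cdot> (a \<cdot> x) = b \<cdot> (e \<cdot> x)" by (rule comp_assoc_eq[OF ab(3)]) (use ab(1,2) m re xy(1) in simp_all)
    moreover have "m \<cdot> (a \<cdot> y) = b \<cdot> (e \<cdot> y)" by (rule comp_assoc_eq[OF ab(3)]) (use ab(1,2) m re xy(2) in simp_all)
    ultimately show "m \<cdot> (a \<cdot> x) = m \<cdot> (a \<cdot> y)" using xy(3) by simp
  qed (use ab(1) m xy(1,2) in simp_all)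
  then obtain d where d: "d \<in> hom C B M" "d \<cdot> e = a"
    using regular_epi_descend[OF re ab(1)] by blast
  have "m \<cdot> d = b"
    by (rule regular_epi_cancel[OF re(1)]) (use ab m d re(2) in simp_all)
  then show ?thesis using d by blast
qed

text \<open>Diagonal lifting in the square with the identity opposite to \<open>a\<close> yields a
  section of \<open>m\<close>.\<close>

lemma regular_epi_iso:
  assumes "regular_epi C e" "mono C m" "factors e m" "Cod C m = Cod C e"
  shows "iso C m"
proof -
  obtain a where a: "a \<in> hom C (Dom C e) (Dom C m)" "m \<cdot> a = Id C (Cod C e) \<cdot> e"
    using assms(3) regular_epi_arr[OF assms(1)] by (auto elim: factorsE)
  have ar: "e \<in> Arr C" "m \<in> Arr C" using assms by (auto intro: regular_epi_arr mono_arr)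
  then have h: "e \<in> hom C (Dom C e) (Cod C e)" "m \<in> hom C (Dom C m) (Cod C e)"
      "Id C (Cod C e) \<in> hom C (Cod C e) (Cod C e)"
    using assms(4) by simp_all
  obtain d where "d \<in> hom C (Cod C e) (Dom C m)" "m \<cdot> d = Id C (Cod C e)"
    using regular_epi_lift[OF assms(1) h(1) assms(2) h(2) a(1) h(3) a(2)] by blast
  then show ?thesis using assms(2,4) by (intro mono_split_epi_iso[of m d]) simp_all
qed

lemma regular_epi_comp_iso:
  assumes e: "regular_epi C e" and i: "iso C i" "Dom C i = Cod C e"
  shows "regular_epi C (i \<cdot> e)"
proof -
  obtain f g where fg: "is_coequalizer C f g e"
    using e unfolding regular_epi_def by blast
  have 1: "f \<in> Arr C" "g \<in> Arr C" "e \<in> Arr C" "Dom C e = Cod C f" "Cod C g = Cod C f"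
      "Dom C g = Dom C f" "e \<cdot> f = e \<cdot> g"
    using fg unfolding is_coequalizer_def by auto
  have ia: "i \<in> Arr C" using i unfolding iso_def by auto
  obtain j where j: "j \<in> hom C (Cod C i) (Dom C i)" "j \<cdot> i = Id C (Dom C i)" "i \<cdot> j = Id C (Cod C i)"
    using i unfolding iso_def by auto
  have "is_coequalizer C f g (i \<cdot> e)"
  proof (rule coequalizerI[of _ "Dom C f" "Cod C f"])
    fix h D assume h: "h \<in> hom C (Cod C f) D" "h \<cdot> f = h \<cdot> g"
    obtain u where "u \<in> hom C (Cod C e) D" "u \<cdot> e = h"
      using fg h 1 unfolding is_coequalizer_def by (metis hom_iff)
    then show "\<exists>u\<in>hom C (Cod C i) D. u \<cdot> (i \<cdot> e) = h"
      using ia i j 1 by (intro bexI[of _ "u \<cdot> j"]) (simp_all add: comp_assoc_eq'[OF j(2)])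
  next
    fix u v D assume uv: "u \<in> hom C (Cod C i) D" "v \<in> hom C (Cod C i) D" "u \<cdot> (i \<cdot> e) = v \<cdot> (i \<cdot> e)"
    then have "u \<cdot> i = v \<cdot> i"
      using coequalizer_cancel[OF fg, of "u \<cdot> i" "v \<cdot> i"] ia i 1 by simp
    then have "(u \<cdot> i) \<cdot> j = (v \<cdot> i) \<cdot> j" by simp
    then show "u = v" using uv j ia by simp
  qed (use 1 ia i in auto)
  then show ?thesis unfolding regular_epi_def by blast
qed

lemma split_epi_regular:
  assumes "f \<in> hom C A B" "s \<in> hom C B A" "f \<cdot> s = Id C B"
  shows "regular_epi C f"
proof -
  have [simp]: "A \<in> Obj C" "B \<in> Obj C" using assms by auto
  \<comment> \<open>The idempotent \<open>s \<cdot> f\<close> and the identity form a pair whose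
    coequalizer is the split epimorphism.\<close>
  have "is_coequalizer C (s \<cdot> f) (Id C A) f"
  proof (rule coequalizerI[of _ A A _ _ B])
    show "f \<cdot> (s \<cdot> f) = f \<cdot> Id C A"
      using assms by (simp add: comp_assoc_eq'[OF assms(3)])
  next
    fix h D assume "h \<in> hom C A D" "h \<cdot> (s \<cdot> f) = h \<cdot> Id C A"
    then show "\<exists>u\<in>hom C B D. u \<cdot> f = h"
      using assms by (intro bexI[of _ "h \<cdot> s"]) auto
  next
    fix u v D assume uv: "u \<in> hom C B D" "v \<in> hom C B D" "u \<cdot> f = v \<cdot> f"
    then have "u \<cdot> (f \<cdot> s) = v \<cdot> (f \<cdot> s)"
      using assms by (intro comp_assoc_eq) auto
    then show "u = v" using uv assms by simp
  qed (use assms in auto)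
  then show ?thesis unfolding regular_epi_def by blast
qed

end

section \<open>Zero arrows, kernels and cokernels\<close>

locale pointed_category = category +
  assumes pointed: "pointed C"
begin

abbreviation zr where "zr \<equiv> zero_between C"

lemma zero_obj_Obj: "zero_obj C Z \<Longrightarrow> Z \<in> Obj C"
  by (simp add: zero_obj_def)

lemma zero_obj_to: "zero_obj C Z \<Longrightarrow> A \<in> Obj C \<Longrightarrow> \<exists>f. f \<in> hom C A Z"
  unfolding zero_obj_def by (meson ex1_implies_ex)

lemma zero_obj_from: "zero_obj C Z \<Longrightarrow> A \<in> Obj C \<Longrightarrow> \<exists>f. f \<in> hom C Z A"
  unfolding zero_obj_def by (meson ex1_implies_ex)

lemma zero_obj_to_unique: "zero_obj C Z \<Longrightarrow> f \<in> hom C A Z \<Longrightarrow> g \<in> hom C A Z \<Longrightarrow> f = g"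
  unfolding zero_obj_def by (metis Dom_in hom_iff)

lemma zero_obj_from_unique: "zero_obj C Z \<Longrightarrow> f \<in> hom C Z A \<Longrightarrow> g \<in> hom C Z A \<Longrightarrow> f = g"
  unfolding zero_obj_def by (metis Cod_in hom_iff)

lemma zero_arrI: "zero_obj C Z \<Longrightarrow> g \<in> hom C A Z \<Longrightarrow> h \<in> hom C Z B \<Longrightarrow> zero_arr C (h \<cdot> g)"
  unfolding zero_arr_def by (intro conjI exI[of _ Z] bexI[of _ g] bexI[of _ h]) auto

text \<open>The two arrows may pass through different zero objects; the arrow \<open>e\<close>
  between these objects identifies the factorizations. This is what makes
  \<open>zero_between\<close> well defined.\<close>

lemma zero_arr_unique:
  assumes "zero_arr C f" "zero_arr C g" "Dom C f = Dom C g" "Cod C f = Cod C g"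
  shows "f = g"
proof -
  obtain Z a b where Z: "zero_obj C Z" "a \<in> hom C (Dom C f) Z" "b \<in> hom C Z (Cod C f)" "f = b \<cdot> a"
    using assms(1) unfolding zero_arr_def by blast
  obtain Y c d where Y: "zero_obj C Y" "c \<in> hom C (Dom C g) Y" "d \<in> hom C Y (Cod C g)" "g = d \<cdot> c"
    using assms(2) unfolding zero_arr_def by blast
  obtain e where e: "e \<in> hom C Z Y" using zero_obj_to[OF Y(1)] zero_obj_Obj[OF Z(1)] by blast
  have "e \<cdot> a \<in> hom C (Dom C g) Y" using e Z(2,3) assms(3) by simp
  then have 1: "e \<cdot> a = c"
    using zero_obj_to_unique[OF Y(1)] Y(2) by blast
  have "d \<cdot> e \<in> hom C Z (Cod C f)" using e Y(2,3) assms(4) by simp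
  then have 2: "d \<cdot> e = b"
    using zero_obj_from_unique[OF Z(1)] Z(3) by blast
  have "(d \<cdot> e) \<cdot> a = d \<cdot> (e \<cdot> a)" using e Z(2,3) Y(2,3) by simp
  then show ?thesis unfolding 1 2 Z(4)[symmetric] Y(4)[symmetric] .
qed

lemma zero_arr_ex:
  assumes "A \<in> Obj C" "B \<in> Obj C"
  shows "\<exists>f. f \<in> hom C A B \<and> zero_arr C f"
proof -
  obtain Z where Z: "zero_obj C Z" using pointed unfolding pointed_def by blast
  obtain a b where "a \<in> hom C A Z" "b \<in> hom C Z B"
    using zero_obj_to[OF Z assms(1)] zero_obj_from[OF Z assms(2)] by blast
  then have "b \<cdot> a \<in> hom C A B" "zero_arr C (b \<cdot> a)"
    using zero_arrI[OF Z] by auto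
  then show ?thesis by blast
qed

lemma zr_zero_arr:
  assumes "A \<in> Obj C" "B \<in> Obj C"
  shows "zr A B \<in> hom C A B" "zero_arr C (zr A B)"
proof -
  have "\<exists>!f. f \<in> hom C A B \<and> zero_arr C f"
    using zero_arr_ex[OF assms] zero_arr_unique by (metis hom_iff)
  from theI'[OF this] show "zr A B \<in> hom C A B" "zero_arr C (zr A B)"
    unfolding zero_between_def by auto
qed

lemma zr_arr [simp]:
  assumes "A \<in> Obj C" "B \<in> Obj C"
  shows "zr A B \<in> Arr C" "Dom C (zr A B) = A" "Cod C (zr A B) = B"
  using zr_zero_arr[OF assms] by auto

lemma zero_arr_eq_zr:
  assumes "f \<in> Arr C" "Dom C f = A" "Cod C f = B"
  shows "zero_arr C f \<longleftrightarrow> f = zr A B"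
proof -
  have "A \<in> Obj C" "B \<in> Obj C" using assms by auto
  note z = zr_arr[OF this] zr_zero_arr(2)[OF this]
  show ?thesis
    using zero_arr_unique[of f "zr A B"] z assms by metis
qed

lemma zr_comp_right [simp]:
  assumes f: "f \<in> Arr C" "Cod C f = A" "B \<in> Obj C"
  shows "zr A B \<cdot> f = zr (Dom C f) B"
proof -
  have A: "A \<in> Obj C" using f by auto
  obtain Z a b where Z: "zero_obj C Z" "a \<in> hom C A Z" "b \<in> hom C Z B" "zr A B = b \<cdot> a"
    using zr_zero_arr(2)[OF A \<open>B \<in> Obj C\<close>] A f unfolding zero_arr_def by auto
  have "a \<cdot> f \<in> hom C (Dom C f) Z" "(b \<cdot> a) \<cdot> f = b \<cdot> (a \<cdot> f)" using Z(2,3) f by auto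
  then have "zero_arr C (zr A B \<cdot> f)"
    using zero_arrI[OF Z(1)] Z(3,4) by simp
  then show ?thesis using f A by (auto simp: zero_arr_eq_zr)
qed

lemma zr_comp_left [simp]:
  assumes f: "f \<in> Arr C" "Dom C f = B" "A \<in> Obj C"
  shows "f \<cdot> zr A B = zr A (Cod C f)"
proof -
  have B: "B \<in> Obj C" using f by auto
  obtain Z a b where Z: "zero_obj C Z" "a \<in> hom C A Z" "b \<in> hom C Z B" "zr A B = b \<cdot> a"
    using zr_zero_arr(2)[OF \<open>A \<in> Obj C\<close> B] B f unfolding zero_arr_def by auto
  have "f \<cdot> b \<in> hom C Z (Cod C f)" "f \<cdot> (b \<cdot> a) = (f \<cdot> b) \<cdot> a" using Z(2,3) f by auto
  then have "zero_arr C (f \<cdot> zr A B)"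
    using zero_arrI[OF Z(1) Z(2), of "f \<cdot> b"] Z(4) by simp
  then show ?thesis using f B by (auto simp: zero_arr_eq_zr)
qed

text \<open>Turns a universal property into an equation between arrows, which can then be obtained
  by cancelling a monomorphism.\<close>

lemma zero_obj_iff: "zero_obj C Z \<longleftrightarrow> Z \<in> Obj C \<and> Id C Z = zr Z Z"
proof
  assume "zero_obj C Z"
  then show "Z \<in> Obj C \<and> Id C Z = zr Z Z"
    using zero_obj_Obj zero_obj_to_unique by (metis Id_in zr_zero_arr(1))
next
  assume Z: "Z \<in> Obj C \<and> Id C Z = zr Z Z"
  have "f = zr A Z" if "f \<in> hom C A Z" for f A
    using that Z comp_id_left[of f Z] by auto
  moreover have "f = zr Z A" if "f \<in> hom C Z A" for f A
    using that Z comp_id_right[of f Z] by auto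
  ultimately show "zero_obj C Z"
    unfolding zero_obj_def using Z zr_zero_arr(1) by blast
qed

lemma to_zero_obj: "zero_obj C Z \<Longrightarrow> f \<in> hom C A Z \<Longrightarrow> f = zr A Z"
  using comp_id_left[of f Z] by (auto simp: zero_obj_iff)

lemma from_zero_obj: "zero_obj C Z \<Longrightarrow> f \<in> hom C Z A \<Longrightarrow> f = zr Z A"
  using comp_id_right[of f Z] by (auto simp: zero_obj_iff)

lemma some_zero: "zero_obj C (some_zero C)"
  using pointed unfolding some_zero_def pointed_def by (rule someI_ex)

lemma some_zero_Obj [simp]: "some_zero C \<in> Obj C"
  using some_zero by (simp add: zero_obj_iff)

lemma zero_mono_zero_obj:
  assumes "mono C m" "m \<in> hom C A B" "m = zr A B"
  shows "zero_obj C A"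
proof -
  have [simp]: "A \<in> Obj C" "B \<in> Obj C" using assms(2) by auto
  have "m \<cdot> Id C A = m \<cdot> zr A A" using assms(2,3) by auto
  then have "Id C A = zr A A"
    by (rule mono_cancel[OF assms(1)]) (use assms(2) in simp_all)
  then show ?thesis by (simp add: zero_obj_iff)
qed

lemma kernelI:
  assumes "f \<in> hom C A B" "k \<in> hom C K A" "f \<cdot> k = zr K B" "mono C k"
    and "\<And>W h. \<lbrakk>h \<in> hom C W A; f \<cdot> h = zr W B\<rbrakk> \<Longrightarrow> factors h k"
  shows "is_kernel C f k"
proof -
  have "\<exists>!u. u \<in> hom C (Dom C h) (Dom C k) \<and> k \<cdot> u = h"
    if h: "h \<in> Arr C" "Cod C h = Dom C f" "zero_arr C (f \<cdot> h)" for h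
  proof -
    have "factors h k" using assms(1) assms(5)[of h "Dom C h"] h by (auto simp: zero_arr_eq_zr)
    then obtain u where u: "u \<in> hom C (Dom C h) (Dom C k)" "k \<cdot> u = h"
      by (rule factorsE)
    show ?thesis
      by (rule ex1I[of _ u]) (use u mono_cancel[OF assms(4)] assms(2) in auto)
  qed
  moreover have "zero_arr C (f \<cdot> k)"
    unfolding assms(3) by (rule zr_zero_arr) (use assms(1,2) in auto)
  ultimately show ?thesis using assms(1,2) unfolding is_kernel_def hom_def by simp
qed

lemma kernel_arr:
  assumes "is_kernel C f k"
  shows "f \<in> Arr C" "k \<in> Arr C" "Cod C k = Dom C f" "f \<cdot> k = zr (Dom C k) (Cod C f)"
  using assms zero_arr_eq_zr[of "f \<cdot> k"] unfolding is_kernel_def by auto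

lemma kernel_mono:
  assumes k: "is_kernel C f k"
  shows "mono C k"
proof (rule monoI)
  note ar = kernel_arr[OF k]
  show "k \<in> hom C (Dom C k) (Cod C k)" using ar by simp
  fix W a b
  assume ab: "a \<in> hom C W (Dom C k)" "b \<in> hom C W (Dom C k)" "k \<cdot> a = k \<cdot> b"
  have "f \<cdot> (k \<cdot> b) = zr W (Cod C f)"
    using ab ar comp_assoc_eq'[OF ar(4), of b] by auto
  then have "zero_arr C (f \<cdot> (k \<cdot> b))" using ab ar by (auto simp: zero_arr_eq_zr)
  then have "\<exists>!u. u \<in> hom C W (Dom C k) \<and> k \<cdot> u = k \<cdot> b"
    using k ab ar unfolding is_kernel_def
    by (metis comp_arr(1) comp_arr(2) comp_arr(3) hom_iff)
  then show "a = b" using ab by blast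
qed

lemma kernel_lift:
  assumes k: "is_kernel C f k" "f \<in> hom C A B" "k \<in> hom C K A" and h: "h \<in> hom C W A" "f \<cdot> h = zr W B"
  shows "\<exists>u. u \<in> hom C W K \<and> k \<cdot> u = h"
proof -
  have "A \<in> Obj C" "B \<in> Obj C" "W \<in> Obj C" using k(2) h(1) by auto
  then have "zero_arr C (f \<cdot> h)" using h(2) zr_zero_arr(2)[of W B] by simp
  moreover have "h \<in> Arr C" "Cod C h = Dom C f" "Dom C h = W" "Dom C k = K" using k h by simp_all
  ultimately show ?thesis
    using k(1) unfolding is_kernel_def by blast
qed

lemma cokernelI:
  assumes "f \<in> hom C A B" "q \<in> hom C B Q" "q \<cdot> f = zr A Q"
    and "\<And>D h. \<lbrakk>h \<in> hom C B D; h \<cdot> f = zr A D\<rbrakk> \<Longrightarrow> \<exists>u\<in>hom C Q D. u \<cdot> q = h"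
    and "\<And>D u v. \<lbrakk>u \<in> hom C Q D; v \<in> hom C Q D; u \<cdot> q = v \<cdot> q\<rbrakk> \<Longrightarrow> u = v"
  shows "is_cokernel C f q"
proof -
  have "\<exists>!u. u \<in> hom C (Cod C q) (Cod C h) \<and> u \<cdot> q = h"
    if h: "h \<in> Arr C" "Dom C h = Cod C f" "zero_arr C (h \<cdot> f)" for h
  proof -
    obtain u where u: "u \<in> hom C Q (Cod C h)" "u \<cdot> q = h"
      using assms(1) assms(4)[of h "Cod C h"] h by (auto simp: zero_arr_eq_zr)
    show ?thesis
      by (rule ex1I[of _ u]) (use u assms(2,5) in auto)
  qed
  moreover have "zero_arr C (q \<cdot> f)"
    unfolding assms(3) by (rule zr_zero_arr) (use assms(1,2) in auto)
  ultimately show ?thesis using assms(1,2) unfolding is_cokernel_def hom_def by simp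
qed

lemma cokernel_arr:
  assumes "is_cokernel C f q"
  shows "f \<in> Arr C" "q \<in> Arr C" "Dom C q = Cod C f" "q \<cdot> f = zr (Dom C f) (Cod C q)"
  using assms zero_arr_eq_zr[of "q \<cdot> f"] unfolding is_cokernel_def by auto

text \<open>Through this, descent and cancellation for coequalizers carry over to cokernels, and
  normal epimorphisms are regular.\<close>

lemma cokernel_coequalizer:
  assumes q: "is_cokernel C f q"
  shows "is_coequalizer C f (zr (Dom C f) (Cod C f)) q"
  using q cokernel_arr[OF q] unfolding is_cokernel_def is_coequalizer_def
  by (simp add: zero_arr_eq_zr)

lemma normal_epi_regular: "normal_epi C e \<Longrightarrow> regular_epi C e"
  unfolding normal_epi_def regular_epi_def using cokernel_coequalizer by blast

lemma cokernel_descend: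
  assumes q: "is_cokernel C f q" "f \<in> hom C A B" "q \<in> hom C B Q" and h: "h \<in> hom C B D" "h \<cdot> f = zr A D"
  shows "\<exists>u. u \<in> hom C Q D \<and> u \<cdot> q = h"
proof -
  have "A \<in> Obj C" "D \<in> Obj C" using q(2) h(1) by auto
  then have "h \<cdot> f = h \<cdot> zr A B" using h q(2) by auto
  then show ?thesis
    using coequalizer_descend[OF cokernel_coequalizer[OF q(1)] q(3) h(1)] q(2) by simp
qed

lemma cokernel_cancel:
  assumes "is_cokernel C f q" "u \<cdot> q = v \<cdot> q"
    "u \<in> Arr C" "v \<in> Arr C" "Dom C u = Cod C q" "Dom C v = Cod C q"
  shows "u = v"
  using assms coequalizer_cancel[OF cokernel_coequalizer] by blast

end

section \<open>Regular and semi-abelian categories\<close>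

context category
begin

lemma pullback_mono:
  assumes pb: "is_pullback C f m p q" and m: "mono C m"
  shows "mono C p"
proof (rule monoI)
  have ar: "f \<in> Arr C" "m \<in> Arr C" "p \<in> Arr C" "q \<in> Arr C" "Dom C q = Dom C p"
     "Cod C p = Dom C f" "Cod C q = Dom C m" "Cod C f = Cod C m" "f \<cdot> p = m \<cdot> q"
    using pb unfolding is_pullback_def by auto
  show "p \<in> hom C (Dom C p) (Cod C p)" using ar by simp
  fix W a b
  assume ab: "a \<in> hom C W (Dom C p)" "b \<in> hom C W (Dom C p)" "p \<cdot> a = p \<cdot> b"
  have "m \<cdot> (q \<cdot> a) = f \<cdot> (p \<cdot> a)" by (rule comp_assoc_eq) (use ar ab in simp_all)
  moreover have "m \<cdot> (q \<cdot> b) = f \<cdot> (p \<cdot> b)" by (rule comp_assoc_eq) (use ar ab in simp_all)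
  ultimately have "m \<cdot> (q \<cdot> a) = m \<cdot> (q \<cdot> b)" using ab(3) by simp
  then have "q \<cdot> a = q \<cdot> b"
    by (rule mono_cancel[OF m]) (use ar ab in simp_all)
  then show "a = b"
    by - (rule pullback_cancel[OF pb _ _ ab(1,2,3)], use ar in simp_all)
qed

end

section \<open>Products and equalizers from pullbacks and a terminal object\<close>

locale finitely_complete_category = category +
  assumes finitely_complete: "finitely_complete C"
begin

lemma pullback_ex:
  assumes "f \<in> hom C A D" "g \<in> hom C B D"
  obtains P p q where "p \<in> hom C P A" "q \<in> hom C P B" "f \<cdot> p = g \<cdot> q" "is_pullback C f g p q"
proof -
  have "has_pullbacks C" using finitely_complete by (simp add: finitely_complete_def)
  moreover have "f \<in> Arr C" "g \<in> Arr C" "Cod C f = Cod C g" using assms by simp_all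
  ultimately obtain p q where pb: "is_pullback C f g p q"
    unfolding has_pullbacks_def by blast
  show ?thesis
    by (rule that[OF _ _ _ pb, of "Dom C p"]) (use pb assms in \<open>simp_all add: is_pullback_def\<close>)
qed

lemma product_ex:
  assumes "A \<in> Obj C" "B \<in> Obj C"
  obtains P p q where "p \<in> hom C P A" "q \<in> hom C P B"
    "\<And>W a b. \<lbrakk>a \<in> hom C W A; b \<in> hom C W B\<rbrakk> \<Longrightarrow> \<exists>u\<in>hom C W P. p \<cdot> u = a \<and> q \<cdot> u = b"
    "\<And>W u v. \<lbrakk>u \<in> hom C W P; v \<in> hom C W P; p \<cdot> u = p \<cdot> v; q \<cdot> u = q \<cdot> v\<rbrakk> \<Longrightarrow> u = v"
proof -
  obtain T where T: "T \<in> Obj C" "\<forall>A\<in>Obj C. \<exists>!f. f \<in> hom C A T"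
    using finitely_complete unfolding finitely_complete_def has_terminal_def by blast
  obtain f g where f: "f \<in> hom C A T" and g: "g \<in> hom C B T" using T assms by blast
  obtain P p q where pq: "p \<in> hom C P A" "q \<in> hom C P B" "is_pullback C f g p q"
    by (rule pullback_ex[OF f g])
  show ?thesis
  proof (rule that[OF pq(1,2)])
    fix W a b assume ab: "a \<in> hom C W A" "b \<in> hom C W B"
    have "f \<cdot> a \<in> hom C W T" "g \<cdot> b \<in> hom C W T" using f g ab by simp_all
    moreover have "W \<in> Obj C" using ab by auto
    ultimately have "f \<cdot> a = g \<cdot> b" using T by blast
    then show "\<exists>u\<in>hom C W P. p \<cdot> u = a \<and> q \<cdot> u = b"
      using pullback_lift[OF pq(3,1,2) ab] by blast
  next
    fix W u v assume uv: "u \<in> hom C W P" "v \<in> hom C W P" "p \<cdot> u = p \<cdot> v" "q \<cdot> u = q \<cdot> v"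
    show "u = v" by (rule pullback_cancel[OF pq(3,1,2) uv])
  qed
qed

text \<open>The graphs of \<open>a\<close> and \<open>b\<close> in the product of \<open>R\<close>
  and \<open>D\<close> are intersected; composing with the first projection shows that the two legs
  of this pullback coincide.\<close>

lemma equalizer_ex:
  assumes a: "a \<in> hom C R D" and b: "b \<in> hom C R D"
  obtains E m where "m \<in> hom C E R" "mono C m" "a \<cdot> m = b \<cdot> m"
    "\<And>W x. \<lbrakk>x \<in> hom C W R; a \<cdot> x = b \<cdot> x\<rbrakk> \<Longrightarrow> factors x m"
proof -
  have ob: "R \<in> Obj C" "D \<in> Obj C" using a by auto
  obtain P p q where P: "p \<in> hom C P R" "q \<in> hom C P D"
    and lift: "\<And>W a b. \<lbrakk>a \<in> hom C W R; b \<in> hom C W D\<rbrakk> \<Longrightarrow> \<exists>u\<in>hom C W P. p \<cdot> u = a \<and> q \<cdot> u = b"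
    and canc: "\<And>W u v. \<lbrakk>u \<in> hom C W P; v \<in> hom C W P; p \<cdot> u = p \<cdot> v; q \<cdot> u = q \<cdot> v\<rbrakk> \<Longrightarrow> u = v"
    using product_ex[OF ob] by metis
  obtain u where u: "u \<in> hom C R P" "p \<cdot> u = Id C R" "q \<cdot> u = a"
    using lift[of "Id C R" R a] a ob by auto
  obtain v where v: "v \<in> hom C R P" "p \<cdot> v = Id C R" "q \<cdot> v = b"
    using lift[of "Id C R" R b] b ob by auto
  obtain E m n where m: "m \<in> hom C E R" "n \<in> hom C E R" "u \<cdot> m = v \<cdot> n" and pb: "is_pullback C u v m n"
    by (rule pullback_ex[OF u(1) v(1)])
  note [simp] = comp_assoc_eq'[OF u(2)] comp_assoc_eq'[OF v(2)] comp_assoc_eq'[OF u(3)] comp_assoc_eq'[OF v(3)]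
  have "m = p \<cdot> (u \<cdot> m)" "n = p \<cdot> (v \<cdot> n)" using m(1,2) u(1) v(1) P by simp_all
  then have n: "n = m" using m(3) by simp
  have "a \<cdot> m = q \<cdot> (u \<cdot> m)" "b \<cdot> m = q \<cdot> (v \<cdot> m)" using m(1) u(1) v(1) P by simp_all
  then have eq: "a \<cdot> m = b \<cdot> m" using m(3) n by simp
  have "mono C v"
  proof (rule monoI[OF v(1)])
    fix W x y assume xy: "x \<in> hom C W R" "y \<in> hom C W R" "v \<cdot> x = v \<cdot> y"
    have "x = p \<cdot> (v \<cdot> x)" "y = p \<cdot> (v \<cdot> y)" using xy(1,2) v(1) P by simp_all
    then show "x = y" using xy(3) by simp
  qed
  then have "mono C m" by (rule pullback_mono[OF pb])
  moreover have "factors x m" if x: "x \<in> hom C W R" "a \<cdot> x = b \<cdot> x" for W x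
  proof -
    have "u \<cdot> x = v \<cdot> x"
      by (rule canc[of _ W]) (use x u v P in simp_all)
    then obtain y where "y \<in> hom C W E" "m \<cdot> y = x"
      using pullback_lift[OF pb m(1,2) x(1) x(1)] by blast
    then show ?thesis using x(1) m(1) by (intro factorsI[of y]) simp_all
  qed
  ultimately show ?thesis using that m eq by blast
qed

end

section \<open>Regular categories: covers and image factorization\<close>

locale regular_category = category +
  assumes regular: "regular C"

sublocale regular_category \<subseteq> finitely_complete_category
  using regular by unfold_locales (simp add: regular_def)

context regular_category
begin

lemma regular_epi_pullback:
  assumes "is_pullback C f e p q" "regular_epi C e"
  shows "regular_epi C p"
  using assms regular unfolding regular_def by blast

text \<open>Generalized elements of the codomain lift after a change of stage along a regular
  epimorphism \<open>w\<close>, and such a \<open>w\<close> can be cancelled at the end of an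
  argument.\<close>

lemma regular_epi_cover:
  assumes "regular_epi C e" "e \<in> hom C A B" "x \<in> hom C W B"
  obtains V w y where "w \<in> hom C V W" "y \<in> hom C V A" "regular_epi C w" "e \<cdot> y = x \<cdot> w"
proof -
  obtain V w y where "w \<in> hom C V W" "y \<in> hom C V A" "x \<cdot> w = e \<cdot> y" "is_pullback C x e w y"
    by (rule pullback_ex[OF assms(3,2)])
  then show ?thesis using that regular_epi_pullback assms(1) by metis
qed

text \<open>\<open>e\<close> is the coequalizer of the kernel pair of \<open>f\<close>. That
  \<open>m\<close> is monic is checked on elements, after lifting them to \<open>A\<close> along
  covers.\<close>

lemma image_factorization:
  assumes f: "f \<in> hom C A B"
  obtains I m e where "e \<in> hom C A I" "m \<in> hom C I B" "regular_epi C e" "mono C m" "f = m \<cdot> e"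
proof -
  obtain R p q where R: "p \<in> hom C R A" "q \<in> hom C R A" "f \<cdot> p = f \<cdot> q" "is_pullback C f f p q"
    by (rule pullback_ex[OF f f])
  obtain e where co: "is_coequalizer C p q e"
    using regular R(4) unfolding regular_def by blast
  have e: "e \<in> hom C A (Cod C e)" "e \<cdot> p = e \<cdot> q"
    using co R unfolding is_coequalizer_def by auto
  obtain m where m: "m \<in> hom C (Cod C e) B" "m \<cdot> e = f"
    using coequalizer_descend[OF co e(1) f R(3)] by blast
  have re: "regular_epi C e" using co unfolding regular_epi_def by blast
  have "mono C m"
  proof (rule monoI[OF m(1)])
    fix W x y
    assume xy: "x \<in> hom C W (Cod C e)" "y \<in> hom C W (Cod C e)" "m \<cdot> x = m \<cdot> y"
    obtain V w a where a: "w \<in> hom C V W" "a \<in> hom C V A" "regular_epi C w" "e \<cdot> a = x \<cdot> w"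
      by (rule regular_epi_cover[OF re e(1) xy(1)])
    \<comment> \<open>The two elements are lifted one after the other, so that
      \<open>w \<cdot> u\<close> is a common stage; the two covers are cancelled separately at the
      end.\<close>
    have yw: "y \<cdot> w \<in> hom C V (Cod C e)" using xy a by simp
    obtain U u b where b: "u \<in> hom C U V" "b \<in> hom C U A" "regular_epi C u" "e \<cdot> b = (y \<cdot> w) \<cdot> u"
      by (rule regular_epi_cover[OF re e(1) yw])
    note [simp] = comp_assoc_eq'[OF a(4)]
    have fm: "m \<cdot> (e \<cdot> z) = f \<cdot> z" if "z \<in> Arr C" "Cod C z = A" for z
      by (rule comp_assoc_eq'[OF m(2)]) (use m e that in simp_all)
    have mx: "m \<cdot> (x \<cdot> z) = m \<cdot> (y \<cdot> z)" if "z \<in> Arr C" "Cod C z = W" for z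
      by (rule comp_assoc_eq[OF xy(3)]) (use m xy that in simp_all)
    have "f \<cdot> (a \<cdot> u) = m \<cdot> (e \<cdot> (a \<cdot> u))" using a b by (simp add: fm)
    also have "\<dots> = m \<cdot> (x \<cdot> (w \<cdot> u))" using a b xy e by simp
    also have "\<dots> = m \<cdot> (y \<cdot> (w \<cdot> u))" using a b by (simp add: mx)
    also have "\<dots> = m \<cdot> (e \<cdot> b)" using a b xy by simp
    also have "\<dots> = f \<cdot> b" using b(2) by (intro fm) simp_all
    finally have eq: "f \<cdot> (a \<cdot> u) = f \<cdot> b" .
    have au: "a \<cdot> u \<in> hom C U A" using a b by simp
    \<comment> \<open>Equal values under \<open>f\<close> place the two lifts in the kernel pair,
      which \<open>e\<close> coequalizes.\<close>
    obtain r where r: "r \<in> hom C U R" "p \<cdot> r = a \<cdot> u" "q \<cdot> r = b"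
      using pullback_lift[OF R(4,1,2) au b(2) eq] by blast
    have "e \<cdot> (p \<cdot> r) = e \<cdot> (q \<cdot> r)" by (rule comp_assoc_eq) (use e R r in simp_all)
    then have "(x \<cdot> w) \<cdot> u = (y \<cdot> w) \<cdot> u"
      using r a b xy e by simp
    then have "x \<cdot> w = y \<cdot> w"
      by (rule regular_epi_cancel[OF b(3)]) (use xy a b in simp_all)
    then show "x = y"
      by (rule regular_epi_cancel[OF a(3)]) (use xy a b in simp_all)
  qed
  then show ?thesis using that[OF e(1) m(1) re] m(2) by simp
qed

end

section \<open>Kernels and the consequences of protomodularity\<close>

locale semi_abelian_category =
  fixes C :: "('o, 'm) cat" (structure)
  assumes semi_abelian: "semi_abelian C"

sublocale semi_abelian_category \<subseteq> pointed_category
  using semi_abelian by (simp add: semi_abelian_def pointed_category_def pointed_category_axioms_def)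

sublocale semi_abelian_category \<subseteq> regular_category
  using semi_abelian by unfold_locales (simp add: semi_abelian_def barr_exact_def)

context semi_abelian_category
begin

lemma kernel_ex:
  assumes f: "f \<in> hom C A B"
  obtains K k where "k \<in> hom C K A" "is_kernel C f k"
proof -
  let ?Z = "some_zero C"
  have B: "B \<in> Obj C" using f by auto
  have z: "zr ?Z B \<in> hom C ?Z B" using B by simp
  obtain K k t where k: "k \<in> hom C K A" "t \<in> hom C K ?Z" "f \<cdot> k = zr ?Z B \<cdot> t"
    and pb: "is_pullback C f (zr ?Z B) k t"
    by (rule pullback_ex[OF f z])
  have "mono C (zr ?Z B)"
  proof (rule monoI[OF z])
    fix W a b assume "a \<in> hom C W ?Z" "b \<in> hom C W ?Z"
    then show "a = b" using to_zero_obj[OF some_zero] by metis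
  qed
  then have "mono C k" by (rule pullback_mono[OF pb])
  moreover have "factors h k" if h: "h \<in> hom C W A" "f \<cdot> h = zr W B" for W h
  proof -
    have W: "W \<in> Obj C" using h by auto
    have "f \<cdot> h = zr ?Z B \<cdot> zr W ?Z" using h W B by simp
    moreover have "zr W ?Z \<in> hom C W ?Z" using W by simp
    ultimately obtain u where "u \<in> hom C W K" "k \<cdot> u = h"
      using pullback_lift[OF pb k(1,2) h(1)] by blast
    then show ?thesis using h(1) k(1) by (intro factorsI[of u]) simp_all
  qed
  ultimately have "is_kernel C f k"
    using k f B by (intro kernelI[of f A B k K]) simp_all
  then show ?thesis using that k by blast
qed

text \<open>Protomodularity, restated without pullback diagrams.\<close>

lemma point_extremal:
  assumes ps: "is_point C p s" and m: "mono C m" "Cod C m = Dom C p" and sm: "factors s m"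
    and e: "e \<in> Arr C" "Cod C e = Cod C p"
    and em: "\<And>W w x. \<lbrakk>w \<in> hom C W (Dom C p); x \<in> hom C W (Dom C e); p \<cdot> w = e \<cdot> x\<rbrakk> \<Longrightarrow> factors w m"
  shows "iso C m"
proof -
  have pr: "p \<in> hom C (Dom C p) (Cod C p)" "s \<in> hom C (Cod C p) (Dom C p)" "p \<cdot> s = Id C (Cod C p)"
    using ps by (simp_all add: is_point_def)
  have mr: "m \<in> Arr C" using m by (simp add: mono_arr)
  obtain s' where s': "s' \<in> hom C (Cod C p) (Dom C m)" "m \<cdot> s' = s"
    using factors_lift[OF sm pr(2)] m(2) mr by auto
  have e': "e \<in> hom C (Dom C e) (Cod C p)" using e by simp
  obtain P a b where P: "a \<in> hom C P (Dom C e)" "b \<in> hom C P (Dom C p)" "e \<cdot> a = p \<cdot> b"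
    and pb: "is_pullback C e p a b"
    by (rule pullback_ex[OF e' pr(1)])
  have "factors b m" by (rule em[of b P a]) (use P in simp_all)
  then obtain b' where b': "b' \<in> hom C P (Dom C m)" "m \<cdot> b' = b"
    using factors_lift[OF _ P(2)] m(2) mr by auto
  note red = comp_assoc_eq'[OF b'(2)]
  \<comment> \<open>By \<open>em\<close> the projection \<open>b\<close> lands in \<open>m\<close>,
    so the pullback of \<open>p\<close> along \<open>e\<close> is at the same time the pullback of
    \<open>p \<cdot> m\<close>. Between these two pullbacks \<open>m\<close> induces the identity,
    and protomodularity reflects its invertibility.\<close>
  have "is_pullback C e (p \<cdot> m) a b'"
  proof (rule pullbackI[of e "Dom C e" "Cod C p" "p \<cdot> m" "Dom C m" a P b'])
    show "e \<cdot> a = p \<cdot> m \<cdot> b'" using P b' pr m mr by simp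
  next
    fix W x y
    assume xy: "x \<in> hom C W (Dom C e)" "y \<in> hom C W (Dom C m)" "e \<cdot> x = p \<cdot> m \<cdot> y"
    have "e \<cdot> x = p \<cdot> (m \<cdot> y)" using xy m mr pr by simp
    moreover have "m \<cdot> y \<in> hom C W (Dom C p)" using xy(2) m mr by simp
    ultimately obtain u where u: "u \<in> hom C W P" "a \<cdot> u = x" "b \<cdot> u = m \<cdot> y"
      using pullback_lift[OF pb P(1,2) xy(1)] by blast
    have "m \<cdot> (b' \<cdot> u) = m \<cdot> y" using red[of u] u b' mr by simp
    then have "b' \<cdot> u = y" by (rule mono_cancel[OF m(1)]) (use u b' xy in simp_all)
    then show "\<exists>u\<in>hom C W P. a \<cdot> u = x \<and> b' \<cdot> u = y" using u by blast
  next
    fix W u v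
    assume uv: "u \<in> hom C W P" "v \<in> hom C W P" "a \<cdot> u = a \<cdot> v" "b' \<cdot> u = b' \<cdot> v"
    have "b \<cdot> u = m \<cdot> (b' \<cdot> u)" "b \<cdot> v = m \<cdot> (b' \<cdot> v)" using red[of u] red[of v] uv(1,2) b'(1) mr by simp_all
    then have "b \<cdot> u = b \<cdot> v" using uv(4) by simp
    show "u = v" by (rule pullback_cancel[OF pb P(1,2) uv(1,2,3) \<open>b \<cdot> u = b \<cdot> v\<close>])
  qed (use e P b' pr m mr in simp_all)
  moreover have "is_point C (p \<cdot> m) s'"
    using pr m mr s' by (simp add: is_point_def)
  moreover have "iso C (Id C P)" "Id C P \<in> hom C P P" "a \<cdot> Id C P = a" "b \<cdot> Id C P = b"
    using P Dom_in[of a] by (simp_all add: isoI[of _ P P "Id C P"])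
  moreover have "protomodular C" using semi_abelian by (simp add: semi_abelian_def)
  moreover have "m \<in> hom C (Dom C (p \<cdot> m)) (Dom C p)" "Cod C (p \<cdot> m) = Cod C p"
    "Id C P \<in> hom C (Dom C a) (Dom C a)" "b \<cdot> Id C P = m \<cdot> b'"
    using pr m mr P b' Dom_in[of a] by simp_all
  ultimately show ?thesis
    using ps pb s'(2) unfolding protomodular_def by blast
qed

text \<open>The case of \<open>point_extremal\<close> in which \<open>e\<close> starts at a zero
  object: the elements lying over it are those of the kernel of \<open>p\<close>. So the section and
  the kernel of a point together lie in no proper subobject.\<close>

lemma split_extension_extremal:
  assumes ps: "is_point C p s" and m: "mono C m" "Cod C m = Dom C p" and sm: "factors s m"
    and km: "\<And>W w. \<lbrakk>w \<in> hom C W (Dom C p); p \<cdot> w = zr W (Cod C p)\<rbrakk> \<Longrightarrow> factors w m"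
  shows "iso C m"
proof (rule point_extremal[OF ps m sm])
  have B: "Cod C p \<in> Obj C" using ps by (simp add: is_point_def)
  then show "zr (some_zero C) (Cod C p) \<in> Arr C" "Cod C (zr (some_zero C) (Cod C p)) = Cod C p"
    by simp_all
  fix W w x
  assume "w \<in> hom C W (Dom C p)" "x \<in> hom C W (Dom C (zr (some_zero C) (Cod C p)))"
    "p \<cdot> w = zr (some_zero C) (Cod C p) \<cdot> x"
  then show "factors w m" using B by (intro km[of w W]) simp_all
qed

text \<open>In the kernel pair of \<open>f\<close>, an element killed by \<open>p\<close> is sent by
  \<open>q\<close> into the kernel of \<open>f\<close>, so it is zero. The diagonal \<open>d\<close>
  therefore contains the kernel of its retraction \<open>p\<close>; it is invertible, and the two
  projections coincide.\<close>

lemma trivial_kernel_mono: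
  assumes f: "f \<in> hom C A B"
    and ker: "\<And>W w. \<lbrakk>w \<in> hom C W A; f \<cdot> w = zr W B\<rbrakk> \<Longrightarrow> w = zr W A"
  shows "mono C f"
proof -
  have ob: "A \<in> Obj C" "B \<in> Obj C" using f by auto
  obtain R p q where R: "p \<in> hom C R A" "q \<in> hom C R A" "f \<cdot> p = f \<cdot> q" and pb: "is_pullback C f f p q"
    by (rule pullback_ex[OF f f])
  obtain d where d: "d \<in> hom C A R" "p \<cdot> d = Id C A" "q \<cdot> d = Id C A"
    using pullback_lift[OF pb R(1,2) Id_in[OF ob(1)] Id_in[OF ob(1)]] by blast
  have pt: "is_point C p d" using R d by (simp add: is_point_def)
  have md: "mono C d"
  proof (rule monoI[OF d(1)])
    fix W x y assume xy: "x \<in> hom C W A" "y \<in> hom C W A" "d \<cdot> x = d \<cdot> y"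
    have "x = p \<cdot> (d \<cdot> x)" "y = p \<cdot> (d \<cdot> y)"
      using xy(1,2) d(1) R(1) by (simp_all add: comp_assoc_eq'[OF d(2)])
    then show "x = y" using xy(3) by simp
  qed
  have "iso C d"
  proof (rule split_extension_extremal[OF pt md])
    show "factors d d" using d ob by (intro factorsI[of "Id C A"]) simp_all
    fix W w
    assume w: "w \<in> hom C W (Dom C p)" "p \<cdot> w = zr W (Cod C p)"
    then have W: "W \<in> Obj C" by auto
    have "f \<cdot> (q \<cdot> w) = f \<cdot> (p \<cdot> w)" by (rule comp_assoc_eq) (use f R w in simp_all)
    then have qw: "q \<cdot> w = zr W A" using w R f W ob by (intro ker[of "q \<cdot> w" W]) simp_all
    have "R \<in> Obj C" using d by auto
    then have "w = zr W R"
      by - (rule pullback_cancel[OF pb R(1,2)], use w qw R W in simp_all)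
    then show "factors w d" using w d W ob by (intro factorsI[of "zr W A"]) simp_all
  qed (use d R in simp)
  then obtain g where g: "g \<in> hom C R A" "d \<cdot> g = Id C R"
    using iso_inverse[OF _ d(1)] by metis
  have "p \<cdot> (d \<cdot> g) = g" "q \<cdot> (d \<cdot> g) = g"
    using comp_assoc_eq'[OF d(2), of g] comp_assoc_eq'[OF d(3), of g] g(1) d(1) R(1,2) by simp_all
  then have pq: "p = q" using g(2) R by simp
  show ?thesis
  proof (rule monoI[OF f])
    fix W x y assume "x \<in> hom C W A" "y \<in> hom C W A" "f \<cdot> x = f \<cdot> y"
    then show "x = y" using pullback_lift[OF pb R(1,2)] pq by blast
  qed
qed

text \<open>The short five lemma for a subobject \<open>m\<close> of the domain of an extension \<open>p\<close>.\<close>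

lemma extension_extremal:
  assumes m: "mono C m" "m \<in> hom C U A" and p: "p \<in> hom C A B" and c: "c \<in> hom C X U"
    and re: "regular_epi C (p \<cdot> (m \<cdot> c))"
    and km: "\<And>W w. \<lbrakk>w \<in> hom C W A; p \<cdot> w = zr W B\<rbrakk> \<Longrightarrow> factors w m"
  shows "iso C m"
proof -
  let ?r = "p \<cdot> (m \<cdot> c)"
  have r: "?r \<in> hom C X B" using m p c by simp
  have ob: "A \<in> Obj C" "B \<in> Obj C" "X \<in> Obj C" using p c by auto
  \<comment> \<open>Pulling \<open>p\<close> back along \<open>?r\<close> turns it into a split
    epimorphism \<open>x\<close>, with a section induced by \<open>m \<cdot> c\<close>. The inverse
    image \<open>w\<close> of \<open>m\<close> under \<open>v\<close> contains this section and the
    kernel of \<open>x\<close>, so it is everything and \<open>v\<close> factors through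
    \<open>m\<close>.\<close>
  obtain V v x where V: "v \<in> hom C V A" "x \<in> hom C V X" "p \<cdot> v = ?r \<cdot> x" and pb: "is_pullback C p ?r v x"
    by (rule pullback_ex[OF p r])
  have rv: "regular_epi C v" by (rule regular_epi_pullback[OF pb re])
  obtain s where s: "s \<in> hom C X V" "v \<cdot> s = m \<cdot> c" "x \<cdot> s = Id C X"
  proof -
    have "m \<cdot> c \<in> hom C X A" "Id C X \<in> hom C X X" "p \<cdot> (m \<cdot> c) = ?r \<cdot> Id C X"
      using m c p ob by simp_all
    then show ?thesis using pullback_lift[OF pb V(1,2)] that by blast
  qed
  obtain W w u where W: "w \<in> hom C W V" "u \<in> hom C W U" "v \<cdot> w = m \<cdot> u" and pb2: "is_pullback C v m w u"
    by (rule pullback_ex[OF V(1) m(2)])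
  have mw: "mono C w" by (rule pullback_mono[OF pb2 m(1)])
  have "iso C w"
  proof (rule split_extension_extremal[OF _ mw])
    show "is_point C x s" using V s by (simp add: is_point_def)
    show "factors s w"
      using pullback_lift[OF pb2 W(1,2) s(1) c s(2)] s(1) W(1) by (auto intro: factorsI)
    fix Y y
    assume y: "y \<in> hom C Y (Dom C x)" "x \<cdot> y = zr Y (Cod C x)"
    then have Y: "Y \<in> Obj C" by auto
    have "p \<cdot> (v \<cdot> y) = ?r \<cdot> (x \<cdot> y)" by (rule comp_assoc_eq) (use p r V y in simp_all)
    also have "\<dots> = zr Y B" using y V Y r ob by (simp del: comp_assoc)
    finally have "factors (v \<cdot> y) m" using y V by (intro km[of _ Y]) simp_all
    moreover have y': "y \<in> hom C Y V" and "v \<cdot> y \<in> hom C Y A" using y V by simp_all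
    ultimately obtain z where z: "z \<in> hom C Y U" "v \<cdot> y = m \<cdot> z"
      using factors_lift[OF _ _ m(2)] by metis
    show "factors y w"
      using pullback_lift[OF pb2 W(1,2) y' z] y' W(1) by (auto intro: factorsI)
  qed (use W V in simp)
  then obtain g where g: "g \<in> hom C V W" "w \<cdot> g = Id C V"
    using iso_inverse[OF _ W(1)] by metis
  have "m \<cdot> (u \<cdot> g) = v \<cdot> (w \<cdot> g)" by (rule comp_assoc_eq) (use W V m g in simp_all)
  then have "factors v m" using g V W m by (intro factorsI[of "u \<cdot> g"]) simp_all
  then show ?thesis
    using V m by (intro regular_epi_iso[OF rv m(1)]) simp_all
qed

text \<open>An arrow \<open>h\<close> that kills the kernel agrees on both projections of the kernel
  pair of \<open>e\<close>: the equalizer of \<open>h \<cdot> p\<close> and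
  \<open>h \<cdot> q\<close> contains the diagonal, and also the kernel of \<open>p\<close>, which
  \<open>q\<close> carries into the kernel of \<open>e\<close>.\<close>

lemma regular_epi_cokernel:
  assumes e: "regular_epi C e" and k: "is_kernel C e k"
  shows "is_cokernel C k e"
proof -
  define A B K where "A = Dom C e" and "B = Cod C e" and "K = Dom C k"
  have ar: "e \<in> hom C A B" "k \<in> hom C K A" "e \<cdot> k = zr K B"
    using kernel_arr[OF k] by (simp_all add: A_def B_def K_def)
  have ob: "A \<in> Obj C" "B \<in> Obj C" "K \<in> Obj C" using ar by auto
  show ?thesis
  proof (rule cokernelI[OF ar(2,1,3)])
    fix D h assume h: "h \<in> hom C A D" "h \<cdot> k = zr K D"
    obtain R p q where R: "p \<in> hom C R A" "q \<in> hom C R A" "e \<cdot> p = e \<cdot> q" and pb: "is_pullback C e e p q"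
      by (rule pullback_ex[OF ar(1) ar(1)])
    obtain d where d: "d \<in> hom C A R" "p \<cdot> d = Id C A" "q \<cdot> d = Id C A"
      using pullback_lift[OF pb R(1,2) Id_in[OF ob(1)] Id_in[OF ob(1)]] by blast
    have hpq: "h \<cdot> p \<in> hom C R D" "h \<cdot> q \<in> hom C R D" using h R by simp_all
    obtain E m where m: "m \<in> hom C E R" "mono C m" "h \<cdot> p \<cdot> m = h \<cdot> q \<cdot> m"
      and fm: "\<And>W x. \<lbrakk>x \<in> hom C W R; h \<cdot> p \<cdot> x = h \<cdot> q \<cdot> x\<rbrakk> \<Longrightarrow> factors x m"
      using equalizer_ex[OF hpq] by metis
    have "iso C m"
    proof (rule split_extension_extremal[OF _ m(2)])
      show "is_point C p d" using R d by (simp add: is_point_def)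
      show "factors d m" by (rule fm[of _ A]) (use d h R in simp_all)
      fix W w assume w: "w \<in> hom C W (Dom C p)" "p \<cdot> w = zr W (Cod C p)"
      then have W: "W \<in> Obj C" by auto
      have "e \<cdot> (q \<cdot> w) = e \<cdot> (p \<cdot> w)" by (rule comp_assoc_eq) (use ar R w in simp_all)
      then have "e \<cdot> (q \<cdot> w) = zr W B" "q \<cdot> w \<in> hom C W A" using w R ar W ob by simp_all
      then obtain u where u: "u \<in> hom C W K" "k \<cdot> u = q \<cdot> w"
        using kernel_lift[OF k ar(1,2)] by blast
      have "h \<cdot> (q \<cdot> w) = h \<cdot> (k \<cdot> u)" using u by simp
      also have "\<dots> = zr W D" using comp_assoc_eq'[OF h(2), of u] u(1) h(1) ar(1,2) ob W Cod_in[of h] by auto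
      finally show "factors w m" using w R h W ob by (intro fm[of _ W]) simp_all
    qed (use m R in simp)
    then obtain g where g: "g \<in> hom C R E" "m \<cdot> g = Id C R"
      using iso_inverse[OF _ m(1)] by metis
    have "(h \<cdot> p) \<cdot> (m \<cdot> g) = (h \<cdot> q) \<cdot> (m \<cdot> g)" by (rule comp_assoc_eq[OF m(3)]) (use hpq m g in simp_all)
    then have hp: "h \<cdot> p = h \<cdot> q" using g hpq R h by simp
    have "h \<cdot> x = h \<cdot> y" if xy: "x \<in> hom C W A" "y \<in> hom C W A" "e \<cdot> x = e \<cdot> y" for W x y
    proof -
      obtain r where r: "r \<in> hom C W R" "p \<cdot> r = x" "q \<cdot> r = y"
        using pullback_lift[OF pb R(1,2) xy] by blast
      have "h \<cdot> (p \<cdot> r) = h \<cdot> (q \<cdot> r)" by (rule comp_assoc_eq[OF hp]) (use h R r in simp_all)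
      then show ?thesis using r by simp
    qed
    then show "\<exists>u\<in>hom C B D. u \<cdot> e = h"
      using regular_epi_descend[OF e ar(1) h(1)] by blast
  next
    fix D u v assume "u \<in> hom C B D" "v \<in> hom C B D" "u \<cdot> e = v \<cdot> e"
    then show "u = v" using regular_epi_cancel[OF e, of u v] ar by simp
  qed
qed

lemma regular_epi_normal:
  assumes "regular_epi C e"
  shows "normal_epi C e"
proof -
  have "e \<in> hom C (Dom C e) (Cod C e)" using regular_epi_arr[OF assms] by simp
  then obtain K k where "is_kernel C e k" by (rule kernel_ex)
  then show ?thesis unfolding normal_epi_def using regular_epi_cokernel[OF assms] by blast
qed

end

section \<open>Direct images of normal monomorphisms\<close>

context semi_abelian_category
begin

text \<open>The Mal'cev property. \<open>P\<close> is the object of chains (\<alpha>, \<beta>,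
  \<gamma>) linked as in the hypotheses, and \<open>U\<close> its subobject of chains that have a
  completion \<tau> in \<open>S\<close>. Chains with a repeated entry have an evident completion,
  and protomodularity makes \<open>U\<close> all of \<open>P\<close>.\<close>

lemma difunctional:
  assumes s: "s1 \<in> hom C S B" "s2 \<in> hom C S B"
    and joint: "\<And>W u v. \<lbrakk>u \<in> hom C W S; v \<in> hom C W S; s1 \<cdot> u = s1 \<cdot> v; s2 \<cdot> u = s2 \<cdot> v\<rbrakk> \<Longrightarrow> u = v"
    and abc: "\<alpha> \<in> hom C W S" "\<beta> \<in> hom C W S" "\<gamma> \<in> hom C W S"
    and ab: "s2 \<cdot> \<alpha> = s2 \<cdot> \<beta>" and bc: "s1 \<cdot> \<beta> = s1 \<cdot> \<gamma>"
  shows "\<exists>\<tau>. \<tau> \<in> hom C W S \<and> s1 \<cdot> \<tau> = s1 \<cdot> \<alpha> \<and> s2 \<cdot> \<tau> = s2 \<cdot> \<gamma>"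
proof -
  have ob: "S \<in> Obj C" "B \<in> Obj C" using s by auto
  obtain G g1 g2 where G: "g1 \<in> hom C G S" "g2 \<in> hom C G S" "s2 \<cdot> g1 = s2 \<cdot> g2"
    and Gpb: "is_pullback C s2 s2 g1 g2"
    by (rule pullback_ex[OF s(2) s(2)])
  obtain H h1 h2 where H: "h1 \<in> hom C H S" "h2 \<in> hom C H S" "s1 \<cdot> h1 = s1 \<cdot> h2"
    and Hpb: "is_pullback C s1 s1 h1 h2"
    by (rule pullback_ex[OF s(1) s(1)])
  obtain P a b where P: "a \<in> hom C P G" "b \<in> hom C P H" "g2 \<cdot> a = h1 \<cdot> b"
    and Ppb: "is_pullback C g2 h1 a b"
    by (rule pullback_ex[OF G(2) H(1)])
  obtain d where d: "d \<in> hom C S G" "g1 \<cdot> d = Id C S" "g2 \<cdot> d = Id C S"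
    using pullback_lift[OF Gpb G(1,2) Id_in[OF ob(1)] Id_in[OF ob(1)]] by blast
  obtain c where c: "c \<in> hom C S H" "h1 \<cdot> c = Id C S" "h2 \<cdot> c = Id C S"
    using pullback_lift[OF Hpb H(1,2) Id_in[OF ob(1)] Id_in[OF ob(1)]] by blast
  note dr = comp_assoc_eq'[OF d(2)] comp_assoc_eq'[OF d(3)]
  note cr = comp_assoc_eq'[OF c(2)] comp_assoc_eq'[OF c(3)]
  have Hob: "H \<in> Obj C" using P by auto
  have dh: "d \<cdot> h1 \<in> hom C H G" "g2 \<cdot> (d \<cdot> h1) = h1 \<cdot> Id C H"
    using d H G Hob by (simp_all add: dr)
  \<comment> \<open>The section of \<open>b\<close> repeats an entry: (\<beta>, \<gamma>) goes to
    (\<beta>, \<beta>, \<gamma>).\<close>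
  obtain \<sigma> where \<sigma>: "\<sigma> \<in> hom C H P" "a \<cdot> \<sigma> = d \<cdot> h1" "b \<cdot> \<sigma> = Id C H"
    using pullback_lift[OF Ppb P(1,2) dh(1) Id_in[OF Hob] dh(2)] by blast
  obtain BB p q where BB: "p \<in> hom C BB B" "q \<in> hom C BB B"
    and lift: "\<And>W a b. \<lbrakk>a \<in> hom C W B; b \<in> hom C W B\<rbrakk> \<Longrightarrow> \<exists>u\<in>hom C W BB. p \<cdot> u = a \<and> q \<cdot> u = b"
    and canc: "\<And>W u v. \<lbrakk>u \<in> hom C W BB; v \<in> hom C W BB; p \<cdot> u = p \<cdot> v; q \<cdot> u = q \<cdot> v\<rbrakk> \<Longrightarrow> u = v"
    using product_ex[OF ob(2) ob(2)] by metis
  obtain s where ss: "s \<in> hom C S BB" "p \<cdot> s = s1" "q \<cdot> s = s2"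
    using lift[OF s] by blast
  have "s1 \<cdot> (g1 \<cdot> a) \<in> hom C P B" "s2 \<cdot> (h2 \<cdot> b) \<in> hom C P B" using s G H P by simp_all
  then obtain t where t: "t \<in> hom C P BB" "p \<cdot> t = s1 \<cdot> (g1 \<cdot> a)" "q \<cdot> t = s2 \<cdot> (h2 \<cdot> b)"
    using lift by blast
  have sr: "p \<cdot> (s \<cdot> z) = s1 \<cdot> z" "q \<cdot> (s \<cdot> z) = s2 \<cdot> z" if "z \<in> Arr C" "Cod C z = S" for z
    using comp_assoc_eq'[OF ss(2), of z] comp_assoc_eq'[OF ss(3), of z] that ss(1) BB by simp_all
  have tr: "p \<cdot> (t \<cdot> z) = s1 \<cdot> (g1 \<cdot> (a \<cdot> z))" "q \<cdot> (t \<cdot> z) = s2 \<cdot> (h2 \<cdot> (b \<cdot> z))"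
    if "z \<in> Arr C" "Cod C z = P" for z
    using comp_assoc_eq'[OF t(2), of z] comp_assoc_eq'[OF t(3), of z] that t(1) BB s G H P by simp_all
  obtain U m n where U: "m \<in> hom C U P" "n \<in> hom C U S" "t \<cdot> m = s \<cdot> n"
    and Upb: "is_pullback C t s m n"
    by (rule pullback_ex[OF t(1) ss(1)])
  have "mono C s"
  proof (rule monoI[OF ss(1)])
    fix V x y assume xy: "x \<in> hom C V S" "y \<in> hom C V S" "s \<cdot> x = s \<cdot> y"
    have "s1 \<cdot> x = s1 \<cdot> y" "s2 \<cdot> x = s2 \<cdot> y"
      using sr[of x] sr[of y] xy(1,2) unfolding xy(3) by simp_all
    then show "x = y" by (rule joint[OF xy(1,2)])
  qed
  then have mm: "mono C m" by (rule pullback_mono[OF Upb])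
  have fac: "factors w m"
    if w: "w \<in> hom C V P" and z: "z \<in> hom C V S" "s1 \<cdot> z = s1 \<cdot> (g1 \<cdot> (a \<cdot> w))" "s2 \<cdot> z = s2 \<cdot> (h2 \<cdot> (b \<cdot> w))"
    for V w z
  proof -
    have "t \<cdot> w = s \<cdot> z"
      by (rule canc[of _ V]) (use w z t(1) ss(1) in \<open>simp_all add: tr sr\<close>)
    then show ?thesis
      using pullback_lift[OF Upb U(1,2) w z(1)] w U(1) by (auto intro: factorsI)
  qed
  have "iso C m"
  proof (rule point_extremal[OF _ mm])
    show "is_point C b \<sigma>" using P \<sigma> by (simp add: is_point_def)
    show "c \<in> Arr C" "Cod C c = Cod C b" using c P by simp_all
    \<comment> \<open>A chain (\<beta>, \<beta>, \<gamma>) is completed by \<gamma>, hence the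
      witness \<open>h2\<close>.\<close>
    have "s1 \<cdot> h2 = s1 \<cdot> (g1 \<cdot> (a \<cdot> \<sigma>))"
      using \<sigma>(2) H(1) d(1) G(1) by (simp add: dr H(3))
    moreover have "s2 \<cdot> h2 = s2 \<cdot> (h2 \<cdot> (b \<cdot> \<sigma>))" using \<sigma>(3) H by simp
    ultimately show "factors \<sigma> m" by (rule fac[OF \<sigma>(1) H(2)])
    \<comment> \<open>Over the diagonal \<open>c\<close>, where \<beta> = \<gamma>, the completion
      is \<alpha>, that is \<open>g1 \<cdot> (a \<cdot> w)\<close>.\<close>
    fix V w x
    assume "w \<in> hom C V (Dom C b)" "x \<in> hom C V (Dom C c)" and bw: "b \<cdot> w = c \<cdot> x"
    then have w: "w \<in> hom C V P" and x: "x \<in> hom C V S" using P c by simp_all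
    have "g2 \<cdot> (a \<cdot> w) = h1 \<cdot> (b \<cdot> w)" by (rule comp_assoc_eq[OF P(3)]) (use P G H w in simp_all)
    also have "\<dots> = x" unfolding bw using x c H(1) by (simp add: cr)
    finally have gx: "g2 \<cdot> (a \<cdot> w) = x" .
    have "h2 \<cdot> (b \<cdot> w) = x" unfolding bw using x c H(2) by (simp add: cr)
    moreover have "s2 \<cdot> (g1 \<cdot> (a \<cdot> w)) = s2 \<cdot> (g2 \<cdot> (a \<cdot> w))"
      by (rule comp_assoc_eq[OF G(3)]) (use s G P w in simp_all)
    ultimately have eq: "s2 \<cdot> (g1 \<cdot> (a \<cdot> w)) = s2 \<cdot> (h2 \<cdot> (b \<cdot> w))" using gx by simp
    show "factors w m"
      by (rule fac[OF w _ refl eq]) (use G P w in simp)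
  qed (use U P in simp)
  then obtain g where g: "g \<in> hom C P U" "m \<cdot> g = Id C P"
    using iso_inverse[OF _ U(1)] by metis
  obtain u where u: "u \<in> hom C W G" "g1 \<cdot> u = \<alpha>" "g2 \<cdot> u = \<beta>"
    using pullback_lift[OF Gpb G(1,2) abc(1,2) ab] by blast
  obtain v where v: "v \<in> hom C W H" "h1 \<cdot> v = \<beta>" "h2 \<cdot> v = \<gamma>"
    using pullback_lift[OF Hpb H(1,2) abc(2,3) bc] by blast
  obtain w where w: "w \<in> hom C W P" "a \<cdot> w = u" "b \<cdot> w = v"
    using pullback_lift[OF Ppb P(1,2) u(1) v(1)] u v by metis
  have "s \<cdot> (n \<cdot> (g \<cdot> w)) = t \<cdot> (m \<cdot> (g \<cdot> w))"
    by (rule comp_assoc_eq[OF U(3)[symmetric]]) (use ss t U g w in simp_all)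
  also have "\<dots> = t \<cdot> w" using comp_assoc_eq'[OF g(2), of w] g(1) U(1) w(1) by simp
  finally have eq: "s \<cdot> (n \<cdot> (g \<cdot> w)) = t \<cdot> w" .
  have ngw: "n \<cdot> (g \<cdot> w) \<in> hom C W S" using U g w by simp
  have "s1 \<cdot> (n \<cdot> (g \<cdot> w)) = p \<cdot> (t \<cdot> w)" "s2 \<cdot> (n \<cdot> (g \<cdot> w)) = q \<cdot> (t \<cdot> w)"
    using sr[of "n \<cdot> (g \<cdot> w)"] ngw eq by simp_all
  then have "s1 \<cdot> (n \<cdot> (g \<cdot> w)) = s1 \<cdot> \<alpha>" "s2 \<cdot> (n \<cdot> (g \<cdot> w)) = s2 \<cdot> \<gamma>"
    using tr[of w] w u v by simp_all
  then show ?thesis using ngw by blast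
qed

text \<open>Both remaining axioms are completions of chains. Symmetry completes
  (\<open>d \<cdot> s2\<close>, identity, \<open>d \<cdot> s1\<close>); transitivity completes two
  linked elements with the diagonal at their common endpoint placed between them.\<close>

lemma reflexive_equivalence_relation:
  assumes s: "s1 \<in> hom C S B" "s2 \<in> hom C S B"
    and joint: "\<And>W u v. \<lbrakk>u \<in> hom C W S; v \<in> hom C W S; s1 \<cdot> u = s1 \<cdot> v; s2 \<cdot> u = s2 \<cdot> v\<rbrakk> \<Longrightarrow> u = v"
    and d: "d \<in> hom C B S" "s1 \<cdot> d = Id C B" "s2 \<cdot> d = Id C B"
  shows "equivalence_relation C s1 s2"
proof -
  have ob: "S \<in> Obj C" "B \<in> Obj C" using s by auto
  have dr: "s1 \<cdot> (d \<cdot> x) = x" "s2 \<cdot> (d \<cdot> x) = x" if "x \<in> Arr C" "Cod C x = B" for x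
    using comp_assoc_eq'[OF d(2), of x] comp_assoc_eq'[OF d(3), of x] that d(1) s by simp_all
  have "\<exists>\<tau>. \<tau> \<in> hom C S S \<and> s1 \<cdot> \<tau> = s1 \<cdot> (d \<cdot> s2) \<and> s2 \<cdot> \<tau> = s2 \<cdot> (d \<cdot> s1)"
    by (rule difunctional[OF s joint, where \<beta> = "Id C S"]) (use s d(1) ob in \<open>simp_all add: dr\<close>)
  then have sym: "\<exists>\<tau>\<in>hom C S S. s1 \<cdot> \<tau> = s2 \<and> s2 \<cdot> \<tau> = s1"
    using s by (auto simp: dr)
  have trans: "\<exists>t\<in>hom C (Dom C p1) S. s1 \<cdot> t = s1 \<cdot> p1 \<and> s2 \<cdot> t = s2 \<cdot> p2"
    if pb: "is_pullback C s2 s1 p1 p2" for p1 p2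
  proof -
    have p: "p1 \<in> hom C (Dom C p1) S" "p2 \<in> hom C (Dom C p1) S" "s2 \<cdot> p1 = s1 \<cdot> p2"
      using pb s unfolding is_pullback_def by auto
    have m: "d \<cdot> (s2 \<cdot> p1) \<in> hom C (Dom C p1) S" using d(1) s p(1) by simp
    have "s2 \<cdot> p1 = s2 \<cdot> (d \<cdot> (s2 \<cdot> p1))" "s1 \<cdot> (d \<cdot> (s2 \<cdot> p1)) = s1 \<cdot> p2"
      using dr[of "s2 \<cdot> p1"] p s by simp_all
    then have "\<exists>\<tau>. \<tau> \<in> hom C (Dom C p1) S \<and> s1 \<cdot> \<tau> = s1 \<cdot> p1 \<and> s2 \<cdot> \<tau> = s2 \<cdot> p2"
      using difunctional[OF s _ p(1) m p(2)] joint by blast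
    then show ?thesis by blast
  qed
  have "\<exists>d\<in>hom C B S. s1 \<cdot> d = Id C B \<and> s2 \<cdot> d = Id C B" using d by blast
  moreover have "Dom C s1 = S" "Dom C s2 = S" "Cod C s1 = B" "Cod C s2 = B" "s1 \<in> Arr C" "s2 \<in> Arr C"
    using s by simp_all
  ultimately show ?thesis
    unfolding equivalence_relation_def using sym trans joint by (simp del: hom_iff)
qed

text \<open>The direct image \<open>S\<close> of the kernel pair \<open>R\<close> of \<open>q\<close> is a reflexive relation, hence a kernel pair,
  and its normalization is the direct image of \<open>k\<close> because the comparison map from \<open>R\<close> to the
  pullback of \<open>S\<close> along \<open>f\<close> is a regular epimorphism.\<close>

lemma normal_mono_direct_image:
  assumes k: "is_kernel C q k" "k \<in> hom C K A" and f: "f \<in> hom C A B" "regular_epi C f"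
  obtains L e m where "e \<in> hom C K L" "m \<in> hom C L B" "regular_epi C e" "normal_mono C m" "f \<cdot> k = m \<cdot> e"
proof -
  have q: "q \<in> hom C A (Cod C q)" "q \<cdot> k = zr K (Cod C q)" using kernel_arr[OF k(1)] k(2) by simp_all
  have ob: "A \<in> Obj C" "B \<in> Obj C" "K \<in> Obj C" "Cod C q \<in> Obj C" using f(1) k(2) q(1) by auto
  obtain R r1 r2 where R: "r1 \<in> hom C R A" "r2 \<in> hom C R A" "q \<cdot> r1 = q \<cdot> r2"
    and Rpb: "is_pullback C q q r1 r2"
    by (rule pullback_ex[OF q(1) q(1)])
  obtain \<delta> where \<delta>: "\<delta> \<in> hom C A R" "r1 \<cdot> \<delta> = Id C A" "r2 \<cdot> \<delta> = Id C A"
    using pullback_lift[OF Rpb R(1,2) Id_in[OF ob(1)] Id_in[OF ob(1)]] by blast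
  have \<delta>r: "r1 \<cdot> (\<delta> \<cdot> x) = x" "r2 \<cdot> (\<delta> \<cdot> x) = x" if "x \<in> Arr C" "Cod C x = A" for x
    using comp_assoc_eq'[OF \<delta>(2), of x] comp_assoc_eq'[OF \<delta>(3), of x] that \<delta>(1) R(1,2) by simp_all
  obtain BB p1 p2 where BB: "p1 \<in> hom C BB B" "p2 \<in> hom C BB B"
    and lift: "\<And>W a b. \<lbrakk>a \<in> hom C W B; b \<in> hom C W B\<rbrakk> \<Longrightarrow> \<exists>u\<in>hom C W BB. p1 \<cdot> u = a \<and> p2 \<cdot> u = b"
    and canc: "\<And>W u v. \<lbrakk>u \<in> hom C W BB; v \<in> hom C W BB; p1 \<cdot> u = p1 \<cdot> v; p2 \<cdot> u = p2 \<cdot> v\<rbrakk> \<Longrightarrow> u = v"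
    using product_ex[OF ob(2) ob(2)] by metis
  have "f \<cdot> r1 \<in> hom C R B" "f \<cdot> r2 \<in> hom C R B" using f R by simp_all
  then obtain h where h: "h \<in> hom C R BB" "p1 \<cdot> h = f \<cdot> r1" "p2 \<cdot> h = f \<cdot> r2"
    using lift by blast
  obtain S s \<rho> where \<rho>: "\<rho> \<in> hom C R S" "s \<in> hom C S BB" "regular_epi C \<rho>" "mono C s" "h = s \<cdot> \<rho>"
    by (rule image_factorization[OF h(1)])
  define s1 s2 where "s1 = p1 \<cdot> s" and "s2 = p2 \<cdot> s"
  have s: "s1 \<in> hom C S B" "s2 \<in> hom C S B" "s1 \<cdot> \<rho> = f \<cdot> r1" "s2 \<cdot> \<rho> = f \<cdot> r2"
    using h(2,3) \<rho>(1,2,5) BB by (simp_all add: s1_def s2_def)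
  have s\<rho>: "s1 \<cdot> (\<rho> \<cdot> x) = f \<cdot> (r1 \<cdot> x)" "s2 \<cdot> (\<rho> \<cdot> x) = f \<cdot> (r2 \<cdot> x)" if "x \<in> Arr C" "Cod C x = R" for x
    by (rule comp_assoc_eq; use s \<rho>(1) f(1) R(1,2) that in simp)+
  have joint: "u = v" if uv: "u \<in> hom C W S" "v \<in> hom C W S" "s1 \<cdot> u = s1 \<cdot> v" "s2 \<cdot> u = s2 \<cdot> v" for W u v
  proof (rule mono_cancel[OF \<rho>(4)])
    show "s \<cdot> u = s \<cdot> v"
      by (rule canc[of _ W]) (use uv \<rho>(2) BB in \<open>simp_all add: s1_def s2_def\<close>)
  qed (use uv(1,2) \<rho>(2) in simp_all)
  have f\<delta>: "s1 \<cdot> (\<rho> \<cdot> (\<delta> \<cdot> x)) = f \<cdot> x" "s2 \<cdot> (\<rho> \<cdot> (\<delta> \<cdot> x)) = f \<cdot> x" if "x \<in> Arr C" "Cod C x = A" for x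
    using that \<delta>(1) by (simp_all add: s\<rho> \<delta>r)
  have \<rho>\<delta>: "\<rho> \<cdot> \<delta> \<in> hom C A S" using \<rho>(1) \<delta>(1) by simp
  \<comment> \<open>The diagonal \<delta> of \<open>R\<close> descends along \<open>f\<close> to a
    diagonal \<open>d\<close> of \<open>S\<close>, because an element of \<open>S\<close> with two
    equal entries \<open>f \<cdot> x\<close> is determined by that entry.\<close>
  have "\<rho> \<cdot> \<delta> \<cdot> x = \<rho> \<cdot> \<delta> \<cdot> y" if xy: "x \<in> hom C W A" "y \<in> hom C W A" "f \<cdot> x = f \<cdot> y" for W x y
    by (rule joint[of _ W]) (use xy \<rho>(1) \<delta>(1) in \<open>simp_all add: f\<delta>\<close>)
  then obtain d where d: "d \<in> hom C B S" "d \<cdot> f = \<rho> \<cdot> \<delta>"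
    using regular_epi_descend[OF f(2,1) \<rho>\<delta>] by blast
  have sdf: "s1 \<cdot> (d \<cdot> f) = f" "s2 \<cdot> (d \<cdot> f) = f"
    unfolding d(2) using f\<delta>[of "Id C A"] \<rho>(1) \<delta>(1) f(1) ob by simp_all
  have sd1: "s1 \<cdot> d = Id C B"
    by (rule regular_epi_cancel[OF f(2)]) (use s(1) d(1) f(1) ob sdf in simp_all)
  have sd2: "s2 \<cdot> d = Id C B"
    by (rule regular_epi_cancel[OF f(2)]) (use s(2) d(1) f(1) ob sdf in simp_all)
  have "equivalence_relation C s1 s2"
    by (rule reflexive_equivalence_relation[OF s(1,2) joint d(1) sd1 sd2])
  moreover have "barr_exact C" using semi_abelian by (simp add: semi_abelian_def)
  ultimately obtain p where Spb: "is_pullback C p p s1 s2"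
    unfolding barr_exact_def by blast
  have p: "p \<in> hom C B (Cod C p)" "p \<cdot> s1 = p \<cdot> s2"
    using Spb s(1) unfolding is_pullback_def by auto
  obtain L j where j: "j \<in> hom C L S" "is_kernel C s2 j" by (rule kernel_ex[OF s(2)])
  have s2j: "s2 \<cdot> j = zr L B" using kernel_arr[OF j(2)] j(1) s(2) by simp
  have L: "L \<in> Obj C" "S \<in> Obj C" "R \<in> Obj C" "Cod C p \<in> Obj C" using j(1) R(1) p(1) by auto
  \<comment> \<open>A kernel is recovered from a kernel pair by setting the second entry to zero and
    taking the first.\<close>
  define m where "m = s1 \<cdot> j"
  have m: "m \<in> hom C L B" using s(1) j(1) by (simp add: m_def)
  have "is_kernel C p m"
  proof (rule kernelI[OF p(1) m])
    have "p \<cdot> (s1 \<cdot> j) = p \<cdot> (s2 \<cdot> j)" by (rule comp_assoc_eq[OF p(2)]) (use p s j in simp_all)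
    then show "p \<cdot> m = zr L (Cod C p)" using s2j p(1) L by (simp add: m_def)
    show "mono C m"
    proof (rule monoI[OF m])
      fix W x y assume xy: "x \<in> hom C W L" "y \<in> hom C W L" "m \<cdot> x = m \<cdot> y"
      have "j \<cdot> x = j \<cdot> y"
        by (rule joint[of _ W])
          (use xy j(1) s(1,2) ob in \<open>simp_all add: m_def comp_assoc_eq'[OF s2j]\<close>)
      then show "x = y"
        by (rule mono_cancel[OF kernel_mono[OF j(2)]]) (use xy(1,2) j(1) in simp_all)
    qed
    fix W x assume x: "x \<in> hom C W B" "p \<cdot> x = zr W (Cod C p)"
    then have W: "W \<in> Obj C" by auto
    have z: "zr W B \<in> hom C W B" using W ob by simp
    have "p \<cdot> x = p \<cdot> zr W B" using x p(1) W by simp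
    then obtain u where u: "u \<in> hom C W S" "s1 \<cdot> u = x" "s2 \<cdot> u = zr W B"
      using pullback_lift[OF Spb s(1,2) x(1) z] by blast
    obtain v where v: "v \<in> hom C W L" "j \<cdot> v = u"
      using kernel_lift[OF j(2) s(2) j(1) u(1,3)] by blast
    show "factors x m"
      by (rule factorsI[of v]) (use v u(2) x(1) m s(1) j(1) in \<open>simp_all add: m_def\<close>)
  qed
  then have nm: "normal_mono C m" unfolding normal_mono_def by blast
  have zKA: "zr K A \<in> hom C K A" "q \<cdot> k = q \<cdot> zr K A" using ob q by simp_all
  obtain \<kappa> where \<kappa>: "\<kappa> \<in> hom C K R" "r1 \<cdot> \<kappa> = k" "r2 \<cdot> \<kappa> = zr K A"
    using pullback_lift[OF Rpb R(1,2) k(2) zKA] by blast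
  have "s2 \<cdot> (\<rho> \<cdot> \<kappa>) = zr K B" using \<kappa> f(1) ob by (simp add: s\<rho>)
  moreover have "\<rho> \<cdot> \<kappa> \<in> hom C K S" using \<rho>(1) \<kappa>(1) by simp
  ultimately obtain e where e: "e \<in> hom C K L" "j \<cdot> e = \<rho> \<cdot> \<kappa>"
    using kernel_lift[OF j(2) s(2) j(1)] by blast
  have fk: "f \<cdot> k = m \<cdot> e"
    using e \<kappa> s(1) j(1) by (simp add: m_def s\<rho>)
  obtain P \<pi>1 \<pi>2 where P: "\<pi>1 \<in> hom C P A" "\<pi>2 \<in> hom C P S" "f \<cdot> \<pi>1 = s2 \<cdot> \<pi>2"
    and Ppb: "is_pullback C f s2 \<pi>1 \<pi>2"
    by (rule pullback_ex[OF f(1) s(2)])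
  obtain c where c: "c \<in> hom C R P" "\<pi>1 \<cdot> c = r2" "\<pi>2 \<cdot> c = \<rho>"
    using pullback_lift[OF Ppb P(1,2) R(2) \<rho>(1) s(4)[symmetric]] by blast
  have cr: "\<pi>1 \<cdot> (c \<cdot> x) = r2 \<cdot> x" "\<pi>2 \<cdot> (c \<cdot> x) = \<rho> \<cdot> x" if "x \<in> Arr C" "Cod C x = R" for x
    using comp_assoc_eq'[OF c(2), of x] comp_assoc_eq'[OF c(3), of x] that c(1) P(1,2) by simp_all
  obtain T t c' where c': "c' \<in> hom C R T" "t \<in> hom C T P" "regular_epi C c'" "mono C t" "c = t \<cdot> c'"
    by (rule image_factorization[OF c(1)])
  \<comment> \<open>Elements of the kernel of \<open>\<pi>2\<close> have the form (a, 0) with a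
    killed by \<open>f\<close>; they are the images under \<open>c\<close> of the diagonal pairs (a,
    a), so they lie in the image of \<open>c\<close>.\<close>
  have "iso C t"
  proof (rule extension_extremal[OF c'(4,2) P(2) c'(1)])
    show "regular_epi C (\<pi>2 \<cdot> (t \<cdot> c'))" using c(3) \<rho>(3) c'(5) by simp
    fix W w assume w: "w \<in> hom C W P" "\<pi>2 \<cdot> w = zr W S"
    then have W: "W \<in> Obj C" by auto
    have "f \<cdot> (\<pi>1 \<cdot> w) = s2 \<cdot> (\<pi>2 \<cdot> w)" by (rule comp_assoc_eq[OF P(3)]) (use P f s w in simp_all)
    then have fw: "f \<cdot> (\<pi>1 \<cdot> w) = zr W B" using w(2) s(2) W by simp
    have "\<rho> \<cdot> (\<delta> \<cdot> (\<pi>1 \<cdot> w)) = d \<cdot> (f \<cdot> (\<pi>1 \<cdot> w))"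
      by (rule comp_assoc_eq[OF d(2)[symmetric]]) (use \<rho>(1) \<delta>(1) d(1) f(1) P(1) w(1) in simp_all)
    also have "\<dots> = zr W S" unfolding fw using d(1) W by simp
    finally have \<rho>w: "\<rho> \<cdot> (\<delta> \<cdot> (\<pi>1 \<cdot> w)) = \<pi>2 \<cdot> w" using w(2) by simp
    have "c \<cdot> (\<delta> \<cdot> (\<pi>1 \<cdot> w)) = w"
      by (rule pullback_cancel[OF Ppb P(1,2), of _ W])
        (use c(1) \<delta>(1) P(1) w(1) \<rho>w in \<open>simp_all add: cr \<delta>r\<close>)
    then show "factors w t"
      using c' \<delta>(1) P(1) w(1) by (intro factorsI[of "c' \<cdot> (\<delta> \<cdot> (\<pi>1 \<cdot> w))"]) simp_all
  qed
  then have cre: "regular_epi C c"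
    unfolding c'(5) using c' by (intro regular_epi_comp_iso) simp_all
  have zj: "zr L A \<in> hom C L A" "f \<cdot> zr L A = s2 \<cdot> j" using L ob f(1) s2j by simp_all
  obtain i where i: "i \<in> hom C L P" "\<pi>1 \<cdot> i = zr L A" "\<pi>2 \<cdot> i = j"
    using pullback_lift[OF Ppb P(1,2) zj(1) j(1) zj(2)] by blast
  have ir: "\<pi>1 \<cdot> (i \<cdot> x) = zr (Dom C x) A" "\<pi>2 \<cdot> (i \<cdot> x) = j \<cdot> x" if "x \<in> Arr C" "Cod C x = L" for x
    using comp_assoc_eq'[OF i(2), of x] comp_assoc_eq'[OF i(3), of x] that i(1) P(1,2) ob by simp_all
  \<comment> \<open>Elements of \<open>R\<close> with second entry zero are those of
    \<open>K\<close>, and elements of \<open>P\<close> with first entry zero are those of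
    \<open>L\<close>; so \<open>e\<close> is the restriction of \<open>c\<close> to these fibres and
    inherits regularity.\<close>
  have "is_pullback C i c e \<kappa>"
  proof (rule pullbackI[OF i(1) c(1) e(1) \<kappa>(1)])
    show "i \<cdot> e = c \<cdot> \<kappa>"
      by (rule pullback_cancel[OF Ppb P(1,2), of _ K])
        (use i(1) c(1) e \<kappa> in \<open>simp_all add: cr ir\<close>)
  next
    fix W y x assume yx: "y \<in> hom C W L" "x \<in> hom C W R" "i \<cdot> y = c \<cdot> x"
    then have W: "W \<in> Obj C" by auto
    have "r2 \<cdot> x = \<pi>1 \<cdot> (i \<cdot> y)" "\<rho> \<cdot> x = \<pi>2 \<cdot> (i \<cdot> y)" using yx by (simp_all add: cr)
    then have x: "r2 \<cdot> x = zr W A" "\<rho> \<cdot> x = j \<cdot> y" using yx(1) by (simp_all add: ir)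
    have "q \<cdot> (r1 \<cdot> x) = q \<cdot> (r2 \<cdot> x)" by (rule comp_assoc_eq[OF R(3)]) (use q R yx in simp_all)
    then have "q \<cdot> (r1 \<cdot> x) = zr W (Cod C q)" unfolding x(1) using q(1) W by simp
    moreover have "r1 \<cdot> x \<in> hom C W A" using R yx by simp
    ultimately obtain u where u: "u \<in> hom C W K" "k \<cdot> u = r1 \<cdot> x"
      using kernel_lift[OF k(1) q(1) k(2)] by blast
    have \<kappa>u: "\<kappa> \<cdot> u = x"
      by (rule pullback_cancel[OF Rpb R(1,2), of _ W])
        (use \<kappa>(1) u yx(2) x(1) R(1,2) ob in \<open>simp_all add: comp_assoc_eq'[OF \<kappa>(2)] comp_assoc_eq'[OF \<kappa>(3)]\<close>)
    have "j \<cdot> (e \<cdot> u) = \<rho> \<cdot> (\<kappa> \<cdot> u)" by (rule comp_assoc_eq[OF e(2)]) (use e(1) j(1) \<rho>(1) \<kappa>(1) u(1) in simp_all)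
    then have "j \<cdot> (e \<cdot> u) = j \<cdot> y" using x(2) \<kappa>u by simp
    then have "e \<cdot> u = y"
      by (rule mono_cancel[OF kernel_mono[OF j(2)]]) (use e(1) u(1) yx(1) j(1) in simp_all)
    then show "\<exists>u\<in>hom C W K. e \<cdot> u = y \<and> \<kappa> \<cdot> u = x" using u(1) \<kappa>u by blast
  next
    fix W u v assume uv: "u \<in> hom C W K" "v \<in> hom C W K" "\<kappa> \<cdot> u = \<kappa> \<cdot> v"
    have "k \<cdot> u = r1 \<cdot> (\<kappa> \<cdot> u)" "k \<cdot> v = r1 \<cdot> (\<kappa> \<cdot> v)"
      using comp_assoc_eq'[OF \<kappa>(2), of u] comp_assoc_eq'[OF \<kappa>(2), of v] uv(1,2) \<kappa>(1) R(1) by simp_all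
    then have "k \<cdot> u = k \<cdot> v" using uv(3) by simp
    then show "u = v"
      by (rule mono_cancel[OF kernel_mono[OF k(1)]]) (use uv(1,2) k(2) in simp_all)
  qed
  then have "regular_epi C e" using regular_epi_pullback cre by blast
  then show ?thesis using that[OF e(1) m _ nm fk] by blast
qed

text \<open>Kernels of pairings turn finite intersections of kernels into kernels.\<close>

lemma finite_joint_arrow:
  assumes "finite S" "A \<in> Obj C" "\<And>s. s \<in> S \<Longrightarrow> s \<in> Arr C \<and> Dom C s = A"
  shows "\<exists>f B. f \<in> hom C A B \<and>
    (\<forall>W. \<forall>h\<in>hom C W A. f \<cdot> h = zr W B \<longleftrightarrow> (\<forall>s\<in>S. s \<cdot> h = zr W (Cod C s)))"
  using assms(1,3)
proof (induction S rule: finite_induct)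
  case empty
  \<comment> \<open>The empty family imposes no condition, which is what a zero arrow
    expresses.\<close>
  have "zr A A \<cdot> h = zr W A" if "h \<in> hom C W A" for h W
    using that assms(2) by simp
  then show ?case using assms(2) by (intro exI[of _ "zr A A"] exI[of _ A]) simp
next
  case (insert s S)
  have s: "s \<in> hom C A (Cod C s)" using insert.prems by simp
  then have ob: "Cod C s \<in> Obj C" by auto
  obtain f B where f: "f \<in> hom C A B"
    and fS: "\<And>W h. h \<in> hom C W A \<Longrightarrow> f \<cdot> h = zr W B \<longleftrightarrow> (\<forall>s\<in>S. s \<cdot> h = zr W (Cod C s))"
    using insert.IH insert.prems by blast
  have B: "B \<in> Obj C" using f by auto
  obtain P p q where P: "p \<in> hom C P (Cod C s)" "q \<in> hom C P B"
    and lift: "\<And>W a b. \<lbrakk>a \<in> hom C W (Cod C s); b \<in> hom C W B\<rbrakk> \<Longrightarrow> \<exists>u\<in>hom C W P. p \<cdot> u = a \<and> q \<cdot> u = b"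
    and canc: "\<And>W u v. \<lbrakk>u \<in> hom C W P; v \<in> hom C W P; p \<cdot> u = p \<cdot> v; q \<cdot> u = q \<cdot> v\<rbrakk> \<Longrightarrow> u = v"
    using product_ex[OF ob B] by metis
  obtain g where g: "g \<in> hom C A P" "p \<cdot> g = s" "q \<cdot> g = f" using lift[OF s f] by blast
  have Pob: "P \<in> Obj C" using g by auto
  have "g \<cdot> h = zr W P \<longleftrightarrow> (\<forall>t\<in>insert s S. t \<cdot> h = zr W (Cod C t))" if h: "h \<in> hom C W A" for W h
  proof -
    have W: "W \<in> Obj C" using h by auto
    have eq: "p \<cdot> (g \<cdot> h) = s \<cdot> h" "q \<cdot> (g \<cdot> h) = f \<cdot> h"
      using comp_assoc_eq'[OF g(2), of h] comp_assoc_eq'[OF g(3), of h] h g(1) P by simp_all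
    have z: "p \<cdot> zr W P = zr W (Cod C s)" "q \<cdot> zr W P = zr W B" using P W by simp_all
    have "g \<cdot> h = zr W P \<longleftrightarrow> s \<cdot> h = zr W (Cod C s) \<and> f \<cdot> h = zr W B"
    proof
      assume "g \<cdot> h = zr W P"
      then show "s \<cdot> h = zr W (Cod C s) \<and> f \<cdot> h = zr W B" using eq z by simp
    next
      assume "s \<cdot> h = zr W (Cod C s) \<and> f \<cdot> h = zr W B"
      then show "g \<cdot> h = zr W P"
        by (intro canc[of "g \<cdot> h" W "zr W P"]) (use eq z h g(1) W Pob in simp_all)
    qed
    then show ?thesis using fS[OF h] by blast
  qed
  then show ?case using g(1) by blast
qed

lemma finite_joint_kernel:
  assumes "finite S" "A \<in> Obj C" "\<And>s. s \<in> S \<Longrightarrow> s \<in> Arr C \<and> Dom C s = A"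
  obtains K m where "m \<in> hom C K A" "normal_mono C m" "\<And>s. s \<in> S \<Longrightarrow> s \<cdot> m = zr K (Cod C s)"
    "\<And>W h. \<lbrakk>h \<in> hom C W A; \<And>s. s \<in> S \<Longrightarrow> s \<cdot> h = zr W (Cod C s)\<rbrakk> \<Longrightarrow> factors h m"
proof -
  obtain f B where f: "f \<in> hom C A B"
    and fS: "\<And>W h. h \<in> hom C W A \<Longrightarrow> f \<cdot> h = zr W B \<longleftrightarrow> (\<forall>s\<in>S. s \<cdot> h = zr W (Cod C s))"
    using finite_joint_arrow[OF assms] by blast
  obtain K m where m: "m \<in> hom C K A" "is_kernel C f m" by (rule kernel_ex[OF f])
  show ?thesis
  proof (rule that[OF m(1)])
    show "normal_mono C m" using m(2) unfolding normal_mono_def by blast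
    have "f \<cdot> m = zr K B" using kernel_arr[OF m(2)] m(1) f by simp
    then show "s \<cdot> m = zr K (Cod C s)" if "s \<in> S" for s using fS[OF m(1)] that by blast
    fix W h assume h: "h \<in> hom C W A" and "\<And>s. s \<in> S \<Longrightarrow> s \<cdot> h = zr W (Cod C s)"
    then have "f \<cdot> h = zr W B" using fS by blast
    then show "factors h m"
      using kernel_lift[OF m(2) f m(1) h] h m(1) by (auto intro: factorsI)
  qed
qed

end

section \<open>Functor categories\<close>

lemma op_cat_simps [simp]:
  "Obj (op_cat C) = Obj C" "Arr (op_cat C) = Arr C" "Dom (op_cat C) = Cod C" "Cod (op_cat C) = Dom C"
  "Id (op_cat C) = Id C" "Comp (op_cat C) = (\<lambda>g f. f \<cdot>\<^bsub>C\<^esub> g)"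
  by (simp_all add: op_cat_def)

lemma category_op_cat:
  assumes "category C"
  shows "category (op_cat C)"
proof -
  interpret category C by fact
  show ?thesis by unfold_locales (auto simp: hom_def)
qed

lemma funct_cat_Obj:
  "F \<in> Obj (funct_cat D C) \<longleftrightarrow>
    is_functor D C F \<and> FOb F \<in> extensional (Obj D) \<and> FAr F \<in> extensional (Arr D)"
  by (simp add: funct_cat_def Let_def)

lemma funct_cat_Arr:
  "(F, G, \<alpha>) \<in> Arr (funct_cat D C) \<longleftrightarrow>
    F \<in> Obj (funct_cat D C) \<and> G \<in> Obj (funct_cat D C) \<and> nat_trans D C F G \<alpha> \<and> \<alpha> \<in> extensional (Obj D)"
  by (simp add: funct_cat_def Let_def)

lemma funct_cat_simps [simp]:
  "Dom (funct_cat D C) (F, G, \<alpha>) = F"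
  "Cod (funct_cat D C) (F, G, \<alpha>) = G"
  "Id (funct_cat D C) F = (F, F, \<lambda>A\<in>Obj D. Id C (FOb F A))"
  "Comp (funct_cat D C) (G, H, \<beta>) (F, G', \<alpha>) = (F, H, \<lambda>A\<in>Obj D. \<beta> A \<cdot>\<^bsub>C\<^esub> \<alpha> A)"
  by (simp_all add: funct_cat_def Let_def)

locale functor_category = category C + D: category D
  for D :: "('a, 'b) cat" and C :: "('o, 'm) cat" (structure)
begin

abbreviation FC where "FC \<equiv> funct_cat D C"

lemma functor_ob [simp]: "F \<in> Obj FC \<Longrightarrow> A \<in> Obj D \<Longrightarrow> FOb F A \<in> Obj C"
  unfolding funct_cat_Obj is_functor_def by blast

lemma functor_ar [simp]:
  assumes "F \<in> Obj FC" "\<theta> \<in> Arr D"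
  shows "FAr F \<theta> \<in> Arr C" "Dom C (FAr F \<theta>) = FOb F (Dom D \<theta>)" "Cod C (FAr F \<theta>) = FOb F (Cod D \<theta>)"
proof -
  have "\<theta> \<in> hom D (Dom D \<theta>) (Cod D \<theta>)" using assms by simp
  then have "FAr F \<theta> \<in> hom C (FOb F (Dom D \<theta>)) (FOb F (Cod D \<theta>))"
    using assms(1) unfolding funct_cat_Obj is_functor_def by blast
  then show "FAr F \<theta> \<in> Arr C" "Dom C (FAr F \<theta>) = FOb F (Dom D \<theta>)" "Cod C (FAr F \<theta>) = FOb F (Cod D \<theta>)"
    by simp_all
qed

lemma functor_id: "F \<in> Obj FC \<Longrightarrow> A \<in> Obj D \<Longrightarrow> FAr F (Id D A) = Id C (FOb F A)"
  unfolding funct_cat_Obj is_functor_def by blast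

lemma functor_comp:
  "F \<in> Obj FC \<Longrightarrow> \<theta> \<in> Arr D \<Longrightarrow> \<phi> \<in> Arr D \<Longrightarrow> Cod D \<theta> = Dom D \<phi> \<Longrightarrow>
    FAr F (\<phi> \<cdot>\<^bsub>D\<^esub> \<theta>) = FAr F \<phi> \<cdot> FAr F \<theta>"
  unfolding funct_cat_Obj is_functor_def by blast

lemma transD [simp]:
  assumes "(F, G, \<alpha>) \<in> Arr FC" "A \<in> Obj D"
  shows "\<alpha> A \<in> Arr C" "Dom C (\<alpha> A) = FOb F A" "Cod C (\<alpha> A) = FOb G A"
proof -
  have "\<alpha> A \<in> hom C (FOb F A) (FOb G A)"
    using assms unfolding funct_cat_Arr nat_trans_def by blast
  then show "\<alpha> A \<in> Arr C" "Dom C (\<alpha> A) = FOb F A" "Cod C (\<alpha> A) = FOb G A"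
    by simp_all
qed

lemma trans_Obj:
  assumes "(F, G, \<alpha>) \<in> Arr FC"
  shows "F \<in> Obj FC" "G \<in> Obj FC" "\<alpha> \<in> extensional (Obj D)"
  using assms by (simp_all add: funct_cat_Arr)

lemma trans_natural:
  assumes "(F, G, \<alpha>) \<in> Arr FC" "\<theta> \<in> Arr D"
  shows "\<alpha> (Cod D \<theta>) \<cdot> FAr F \<theta> = FAr G \<theta> \<cdot> \<alpha> (Dom D \<theta>)"
  using assms unfolding funct_cat_Arr nat_trans_def by blast

lemma transI:
  assumes "F \<in> Obj FC" "G \<in> Obj FC" "\<alpha> \<in> extensional (Obj D)"
    "\<And>A. A \<in> Obj D \<Longrightarrow> \<alpha> A \<in> hom C (FOb F A) (FOb G A)"
    "\<And>\<theta>. \<theta> \<in> Arr D \<Longrightarrow> \<alpha> (Cod D \<theta>) \<cdot> FAr F \<theta> = FAr G \<theta> \<cdot> \<alpha> (Dom D \<theta>)"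
  shows "(F, G, \<alpha>) \<in> Arr FC"
  using assms unfolding funct_cat_Arr nat_trans_def by blast

lemma trans_eqI:
  assumes "(F, G, \<alpha>) \<in> Arr FC" "(F', G', \<beta>) \<in> Arr FC" "F = F'" "G = G'"
    "\<And>A. A \<in> Obj D \<Longrightarrow> \<alpha> A = \<beta> A"
  shows "(F, G, \<alpha>) = (F', G', \<beta>)"
  using assms extensionalityI[OF trans_Obj(3)[OF assms(1)] trans_Obj(3)[OF assms(2)]] by simp

lemma arr_tuple:
  assumes "f \<in> Arr FC"
  obtains F G \<alpha> where "f = (F, G, \<alpha>)"
  by (metis prod_cases3)

lemma functorI:
  assumes "\<And>A. A \<in> Obj D \<Longrightarrow> obm A \<in> Obj C"
    and "\<And>\<theta>. \<theta> \<in> Arr D \<Longrightarrow> arm \<theta> \<in> hom C (obm (Dom D \<theta>)) (obm (Cod D \<theta>))"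
    and "\<And>A. A \<in> Obj D \<Longrightarrow> arm (Id D A) = Id C (obm A)"
    and "\<And>\<theta> \<phi>. \<lbrakk>\<theta> \<in> Arr D; \<phi> \<in> Arr D; Cod D \<theta> = Dom D \<phi>\<rbrakk> \<Longrightarrow> arm (\<phi> \<cdot>\<^bsub>D\<^esub> \<theta>) = arm \<phi> \<cdot> arm \<theta>"
  shows "\<lparr>FOb = restrict obm (Obj D), FAr = restrict arm (Arr D)\<rparr> \<in> Obj FC"
proof -
  have "arm f \<in> Arr C" "Dom C (arm f) = obm (Dom D f)" "Cod C (arm f) = obm (Cod D f)"
    if "f \<in> Arr D" for f
    using assms(2)[OF that] by simp_all
  then show ?thesis
    unfolding funct_cat_Obj is_functor_def using assms(1,3,4) by auto
qed

sublocale FC: category FC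
proof
  fix f assume f: "f \<in> Arr FC"
  then obtain F G \<alpha> where fe: "f = (F, G, \<alpha>)" by (rule arr_tuple)
  show "Dom FC f \<in> Obj FC" "Cod FC f \<in> Obj FC"
    using f trans_Obj unfolding fe by auto
next
  fix F assume F: "F \<in> Obj FC"
  have "(F, F, \<lambda>A\<in>Obj D. Id C (FOb F A)) \<in> Arr FC"
    by (rule transI) (use F in simp_all)
  then show "Id FC F \<in> hom FC F F" by (simp add: hom_def)
next
  fix f g F G H assume fg: "f \<in> hom FC F G" "g \<in> hom FC G H"
  obtain \<alpha> \<beta> where e: "f = (F, G, \<alpha>)" "g = (G, H, \<beta>)"
    using fg by (auto simp: hom_def) (metis arr_tuple funct_cat_simps(1,2))
  then have a: "(F, G, \<alpha>) \<in> Arr FC" "(G, H, \<beta>) \<in> Arr FC" using fg by (simp_all add: hom_def)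
  note ob = trans_Obj[OF a(1)] trans_Obj[OF a(2)]
  have "(F, H, \<lambda>A\<in>Obj D. \<beta> A \<cdot> \<alpha> A) \<in> Arr FC"
  proof (rule transI)
    fix \<theta> assume t: "\<theta> \<in> Arr D"
    have "(\<beta> (Cod D \<theta>) \<cdot> \<alpha> (Cod D \<theta>)) \<cdot> FAr F \<theta> = \<beta> (Cod D \<theta>) \<cdot> (FAr G \<theta> \<cdot> \<alpha> (Dom D \<theta>))"
      using a ob t trans_natural[OF a(1) t] by simp
    also have "\<dots> = FAr H \<theta> \<cdot> (\<beta> (Dom D \<theta>) \<cdot> \<alpha> (Dom D \<theta>))"
      by (rule comp_assoc_eq[OF trans_natural[OF a(2) t]]) (use a ob t in simp_all)
    finally show "(\<lambda>A\<in>Obj D. \<beta> A \<cdot> \<alpha> A) (Cod D \<theta>) \<cdot> FAr F \<theta> = FAr H \<theta> \<cdot> (\<lambda>A\<in>Obj D. \<beta> A \<cdot> \<alpha> A) (Dom D \<theta>)"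
      using t by simp
  qed (use a ob in simp_all)
  then show "g \<cdot>\<^bsub>FC\<^esub> f \<in> hom FC F H" by (simp add: hom_def e)
next
  fix f F G assume fg: "f \<in> hom FC F G"
  obtain \<alpha> where e: "f = (F, G, \<alpha>)"
    using fg by (auto simp: hom_def) (metis arr_tuple funct_cat_simps(1,2))
  then have a: "(F, G, \<alpha>) \<in> Arr FC" using fg by (simp add: hom_def)
  show "Id FC G \<cdot>\<^bsub>FC\<^esub> f = f" "f \<cdot>\<^bsub>FC\<^esub> Id FC F = f"
    using a trans_Obj[OF a] by (auto simp: e intro!: extensionalityI[of _ "Obj D"])
next
  fix f g h F G H I assume fgh: "f \<in> hom FC F G" "g \<in> hom FC G H" "h \<in> hom FC H I"
  obtain \<alpha> \<beta> \<gamma> where e: "f = (F, G, \<alpha>)" "g = (G, H, \<beta>)" "h = (H, I, \<gamma>)"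
    using fgh by (auto simp: hom_def) (metis arr_tuple funct_cat_simps(1,2))
  then have a: "(F, G, \<alpha>) \<in> Arr FC" "(G, H, \<beta>) \<in> Arr FC" "(H, I, \<gamma>) \<in> Arr FC"
    using fgh by (simp_all add: hom_def)
  show "(h \<cdot>\<^bsub>FC\<^esub> g) \<cdot>\<^bsub>FC\<^esub> f = h \<cdot>\<^bsub>FC\<^esub> (g \<cdot>\<^bsub>FC\<^esub> f)"
    using a by (auto simp: e intro!: extensionalityI[of _ "Obj D"])
qed

text \<open>Lifts through monic components are unique, so naturality of the family follows by
  cancelling \<open>\<iota>\<close>.\<close>

lemma trans_lift:
  assumes i: "(G, F, \<iota>) \<in> Arr FC" "\<And>A. A \<in> Obj D \<Longrightarrow> mono C (\<iota> A)"
    and b: "(H, F, \<beta>) \<in> Arr FC" "\<And>A. A \<in> Obj D \<Longrightarrow> factors (\<beta> A) (\<iota> A)"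
  obtains \<gamma> where "(H, G, \<gamma>) \<in> Arr FC" "\<And>A. A \<in> Obj D \<Longrightarrow> \<iota> A \<cdot> \<gamma> A = \<beta> A"
proof -
  have "\<exists>u. u \<in> hom C (FOb H A) (FOb G A) \<and> \<iota> A \<cdot> u = \<beta> A" if "A \<in> Obj D" for A
    by (rule factors_lift[OF b(2)[OF that]]) (use that i(1) b(1) in simp_all)
  then obtain c where c: "\<And>A. A \<in> Obj D \<Longrightarrow> c A \<in> hom C (FOb H A) (FOb G A)"
      "\<And>A. A \<in> Obj D \<Longrightarrow> \<iota> A \<cdot> c A = \<beta> A"
    by metis
  have c': "c A \<in> Arr C" "Dom C (c A) = FOb H A" "Cod C (c A) = FOb G A" if "A \<in> Obj D" for A
    using c(1)[OF that] by simp_all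
  note ob = trans_Obj[OF i(1)] trans_Obj[OF b(1)]
  have "(H, G, restrict c (Obj D)) \<in> Arr FC"
  proof (rule transI)
    fix \<theta> assume t: "\<theta> \<in> Arr D"
    have "\<iota> (Cod D \<theta>) \<cdot> (c (Cod D \<theta>) \<cdot> FAr H \<theta>) = \<beta> (Cod D \<theta>) \<cdot> FAr H \<theta>"
      by (rule comp_assoc_eq'[OF c(2)]) (use t c' i(1) ob in simp_all)
    also have "\<dots> = FAr F \<theta> \<cdot> \<beta> (Dom D \<theta>)" by (rule trans_natural[OF b(1) t])
    also have "\<dots> = FAr F \<theta> \<cdot> (\<iota> (Dom D \<theta>) \<cdot> c (Dom D \<theta>))" using t c(2) by simp
    also have "\<dots> = \<iota> (Cod D \<theta>) \<cdot> (FAr G \<theta> \<cdot> c (Dom D \<theta>))"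
      by (rule comp_assoc_eq[OF trans_natural[OF i(1) t, symmetric]]) (use t c' i(1) ob in simp_all)
    finally have "c (Cod D \<theta>) \<cdot> FAr H \<theta> = FAr G \<theta> \<cdot> c (Dom D \<theta>)"
      by (rule mono_cancel[OF i(2)[OF D.Cod_in[OF t]]]) (use t c' i(1) ob in simp_all)
    then show "restrict c (Obj D) (Cod D \<theta>) \<cdot> FAr H \<theta> = FAr G \<theta> \<cdot> restrict c (Obj D) (Dom D \<theta>)"
      using t by simp
  qed (use ob c' in simp_all)
  then show ?thesis using that c(2) by simp
qed

text \<open>The restricted operators are unique because the \<open>m A\<close> are monic, and
  uniqueness yields the functor laws.\<close>

lemma subfunctor:
  assumes F: "F \<in> Obj FC"
    and m: "\<And>A. A \<in> Obj D \<Longrightarrow> m A \<in> hom C (S A) (FOb F A)" "\<And>A. A \<in> Obj D \<Longrightarrow> mono C (m A)"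
    and stable: "\<And>\<theta>. \<theta> \<in> Arr D \<Longrightarrow> factors (FAr F \<theta> \<cdot> m (Dom D \<theta>)) (m (Cod D \<theta>))"
  obtains G \<iota> where "(G, F, \<iota>) \<in> Arr FC" "\<And>A. A \<in> Obj D \<Longrightarrow> FOb G A = S A" "\<And>A. A \<in> Obj D \<Longrightarrow> \<iota> A = m A"
proof -
  have mt: "m A \<in> Arr C" "Dom C (m A) = S A" "Cod C (m A) = FOb F A" "S A \<in> Obj C" if "A \<in> Obj D" for A
    using m(1)[OF that] Dom_in[of "m A"] by simp_all
  have "\<exists>u. u \<in> hom C (S (Dom D \<theta>)) (S (Cod D \<theta>)) \<and> m (Cod D \<theta>) \<cdot> u = FAr F \<theta> \<cdot> m (Dom D \<theta>)"
    if "\<theta> \<in> Arr D" for \<theta>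
    by (rule factors_lift[OF stable[OF that]]) (use that mt F in simp_all)
  then obtain c where c: "\<And>\<theta>. \<theta> \<in> Arr D \<Longrightarrow> c \<theta> \<in> hom C (S (Dom D \<theta>)) (S (Cod D \<theta>))"
      "\<And>\<theta>. \<theta> \<in> Arr D \<Longrightarrow> m (Cod D \<theta>) \<cdot> c \<theta> = FAr F \<theta> \<cdot> m (Dom D \<theta>)"
    by metis
  have c': "c \<theta> \<in> Arr C" "Dom C (c \<theta>) = S (Dom D \<theta>)" "Cod C (c \<theta>) = S (Cod D \<theta>)" if "\<theta> \<in> Arr D" for \<theta>
    using c(1)[OF that] by simp_all
  let ?G = "\<lparr>FOb = restrict S (Obj D), FAr = restrict c (Arr D)\<rparr>"
  have G: "?G \<in> Obj FC"
  proof (rule functorI[OF mt(4) c(1)])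
    fix A assume A: "A \<in> Obj D"
    show "c (Id D A) = Id C (S A)"
      by (rule mono_cancel[OF m(2)[OF A]])
        (use A mt[OF A] c(2)[of "Id D A"] c'[of "Id D A"] F in \<open>simp_all add: functor_id\<close>)
  next
    fix \<theta> \<phi> assume t: "\<theta> \<in> Arr D" "\<phi> \<in> Arr D" "Cod D \<theta> = Dom D \<phi>"
    have tp: "\<phi> \<cdot>\<^bsub>D\<^esub> \<theta> \<in> Arr D" "Dom D (\<phi> \<cdot>\<^bsub>D\<^esub> \<theta>) = Dom D \<theta>" "Cod D (\<phi> \<cdot>\<^bsub>D\<^esub> \<theta>) = Cod D \<phi>"
      using t by simp_all
    have "m (Cod D \<phi>) \<cdot> c (\<phi> \<cdot>\<^bsub>D\<^esub> \<theta>) = (FAr F \<phi> \<cdot> FAr F \<theta>) \<cdot> m (Dom D \<theta>)"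
      using c(2)[OF tp(1)] tp t F by (simp add: functor_comp)
    also have "\<dots> = FAr F \<phi> \<cdot> (m (Cod D \<theta>) \<cdot> c \<theta>)"
      using c(2)[OF t(1)] F t mt by simp
    also have "\<dots> = m (Cod D \<phi>) \<cdot> (c \<phi> \<cdot> c \<theta>)"
      unfolding t(3) by (rule comp_assoc_eq[OF c(2)[OF t(2), symmetric]]) (use t F mt c' in simp_all)
    finally show "c (\<phi> \<cdot>\<^bsub>D\<^esub> \<theta>) = c \<phi> \<cdot> c \<theta>"
      by (rule mono_cancel[OF m(2)[OF D.Cod_in[OF t(2)]]]) (use t tp c' mt in simp_all)
  qed
  have "(?G, F, restrict m (Obj D)) \<in> Arr FC"
    by (rule transI[OF G F]) (use c(2) mt in simp_all)
  then show ?thesis by (rule that) simp_all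
qed

end

section \<open>Zero objects and zero transformations in functor categories\<close>

locale pointed_functor_category = functor_category D C + pointed_category C
  for D :: "('a, 'b) cat" and C :: "('o, 'm) cat" (structure)
begin

definition zero_functor :: "('a, 'b, 'o, 'm) funct" where
  "zero_functor = \<lparr>FOb = restrict (\<lambda>_. some_zero C) (Obj D),
     FAr = restrict (\<lambda>_. Id C (some_zero C)) (Arr D)\<rparr>"

lemma zero_functor_Obj: "zero_functor \<in> Obj FC"
  unfolding zero_functor_def by (rule functorI) simp_all

lemma zero_functor_ob [simp]: "A \<in> Obj D \<Longrightarrow> FOb zero_functor A = some_zero C"
  by (simp add: zero_functor_def)

definition zero_trans where
  "zero_trans F G = (F, G, \<lambda>A\<in>Obj D. zr (FOb F A) (FOb G A))"

lemma zero_trans_arr: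
  assumes "F \<in> Obj FC" "G \<in> Obj FC"
  shows "zero_trans F G \<in> hom FC F G"
proof -
  have "zero_trans F G \<in> Arr FC"
    unfolding zero_trans_def by (rule transI) (use assms in simp_all)
  then show ?thesis by (simp add: zero_trans_def)
qed

lemma zero_functor: "zero_obj FC zero_functor"
  unfolding zero_obj_def
proof (intro conjI ballI zero_functor_Obj)
  fix F assume F: "F \<in> Obj FC"
  show "\<exists>!f. f \<in> hom FC F zero_functor"
  proof (rule ex1I[of _ "zero_trans F zero_functor"], rule zero_trans_arr[OF F zero_functor_Obj])
    fix f assume f: "f \<in> hom FC F zero_functor"
    then obtain \<alpha> where e: "f = (F, zero_functor, \<alpha>)"
      by (metis FC.hom_iff arr_tuple funct_cat_simps(1,2))
    then have a: "(F, zero_functor, \<alpha>) \<in> Arr FC" using f by simp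
    have "\<alpha> A = zr (FOb F A) (some_zero C)" if "A \<in> Obj D" for A
      by (rule to_zero_obj[OF some_zero]) (use a that in simp)
    then show "f = zero_trans F zero_functor"
      unfolding e zero_trans_def
      by (intro trans_eqI[OF a]) (use zero_trans_arr[OF F zero_functor_Obj] in \<open>simp_all add: zero_trans_def\<close>)
  qed
  show "\<exists>!f. f \<in> hom FC zero_functor F"
  proof (rule ex1I[of _ "zero_trans zero_functor F"], rule zero_trans_arr[OF zero_functor_Obj F])
    fix f assume f: "f \<in> hom FC zero_functor F"
    then obtain \<alpha> where e: "f = (zero_functor, F, \<alpha>)"
      by (metis FC.hom_iff arr_tuple funct_cat_simps(1,2))
    then have a: "(zero_functor, F, \<alpha>) \<in> Arr FC" using f by simp
    have "\<alpha> A = zr (some_zero C) (FOb F A)" if "A \<in> Obj D" for A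
      by (rule from_zero_obj[OF some_zero]) (use a that in simp)
    then show "f = zero_trans zero_functor F"
      unfolding e zero_trans_def
      by (intro trans_eqI[OF a]) (use zero_trans_arr[OF zero_functor_Obj F] in \<open>simp_all add: zero_trans_def\<close>)
  qed
qed

sublocale FC: pointed_category FC
  by unfold_locales (use zero_functor in \<open>auto simp: pointed_def\<close>)

lemma zero_between_functors:
  assumes "F \<in> Obj FC" "G \<in> Obj FC"
  shows "zero_between FC F G = zero_trans F G"
proof -
  have "zero_trans zero_functor G \<cdot>\<^bsub>FC\<^esub> zero_trans F zero_functor = zero_trans F G"
    using assms by (auto simp: zero_trans_def intro!: extensionalityI[of _ "Obj D"])
  then have "zero_arr FC (zero_trans F G)"
    using FC.zero_arrI[OF zero_functor zero_trans_arr[OF assms(1) zero_functor_Obj]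
        zero_trans_arr[OF zero_functor_Obj assms(2)]] by simp
  then show ?thesis
    using FC.zero_arr_eq_zr zero_trans_arr[OF assms] by (metis FC.hom_iff)
qed

lemma zero_trans_iff:
  assumes a: "(F, G, \<alpha>) \<in> Arr FC"
  shows "(F, G, \<alpha>) = zero_between FC F G \<longleftrightarrow> (\<forall>A\<in>Obj D. \<alpha> A = zr (FOb F A) (FOb G A))"
proof
  note ob = trans_Obj[OF a]
  assume "(F, G, \<alpha>) = zero_between FC F G"
  then have "\<alpha> = (\<lambda>A\<in>Obj D. zr (FOb F A) (FOb G A))"
    using zero_between_functors[OF ob(1,2)] by (simp add: zero_trans_def)
  then show "\<forall>A\<in>Obj D. \<alpha> A = zr (FOb F A) (FOb G A)" by simp
next
  note ob = trans_Obj[OF a]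
  assume "\<forall>A\<in>Obj D. \<alpha> A = zr (FOb F A) (FOb G A)"
  then show "(F, G, \<alpha>) = zero_between FC F G"
    unfolding zero_between_functors[OF ob(1,2)] zero_trans_def
    by (intro trans_eqI[OF a]) (use zero_trans_arr[OF ob(1,2)] in \<open>simp_all add: zero_trans_def\<close>)
qed

end

section \<open>Pointwise kernels and cokernels\<close>

locale semi_abelian_functor_category = functor_category D C + semi_abelian_category C
  for D :: "('a, 'b) cat" and C :: "('o, 'm) cat" (structure)

sublocale semi_abelian_functor_category \<subseteq> pointed_functor_category ..

context semi_abelian_functor_category
begin

text \<open>The given kernel is known to be universal only among functors. The pointwise kernels are
  therefore assembled into a subfunctor \<open>G\<close>, to which the universal property applies,
  and \<open>G\<close> and \<open>T\<close> are compared in both directions.\<close>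

lemma kernel_pointwise:
  assumes ker: "is_kernel FC (X, F, q) (T, X, k)" and A: "A \<in> Obj D"
  shows "is_kernel C (q A) (k A)"
proof -
  have ar: "(X, F, q) \<in> Arr FC" "(T, X, k) \<in> Arr FC" using FC.kernel_arr[OF ker] by simp_all
  note X = trans_Obj[OF ar(1)] and T = trans_Obj[OF ar(2)]
  have "\<exists>K m. m \<in> hom C K (FOb X B) \<and> is_kernel C (q B) m" if "B \<in> Obj D" for B
  proof -
    have "q B \<in> hom C (FOb X B) (FOb F B)" using ar(1) that by simp
    then show ?thesis using kernel_ex by metis
  qed
  then obtain K m where m: "\<And>B. B \<in> Obj D \<Longrightarrow> m B \<in> hom C (K B) (FOb X B)"
      "\<And>B. B \<in> Obj D \<Longrightarrow> is_kernel C (q B) (m B)" by metis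
  have m': "m B \<in> Arr C" "Dom C (m B) = K B" "Cod C (m B) = FOb X B" "K B \<in> Obj C" if "B \<in> Obj D" for B
    using m(1)[OF that] Dom_in[of "m B"] by simp_all
  have qm: "q B \<cdot> m B = zr (K B) (FOb F B)" if "B \<in> Obj D" for B
    using kernel_arr(4)[OF m(2)[OF that]] m'(2)[OF that] ar(1) that by simp
  have stable: "factors (FAr X \<theta> \<cdot> m (Dom D \<theta>)) (m (Cod D \<theta>))" if t: "\<theta> \<in> Arr D" for \<theta>
  proof -
    have 1: "FAr X \<theta> \<cdot> m (Dom D \<theta>) \<in> hom C (K (Dom D \<theta>)) (FOb X (Cod D \<theta>))"
      using t m' X by simp
    have "q (Cod D \<theta>) \<cdot> (FAr X \<theta> \<cdot> m (Dom D \<theta>)) = FAr F \<theta> \<cdot> (q (Dom D \<theta>) \<cdot> m (Dom D \<theta>))"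
      by (rule comp_assoc_eq[OF trans_natural[OF ar(1) t]]) (use t m' X ar in simp_all)
    also have "\<dots> = zr (K (Dom D \<theta>)) (FOb F (Cod D \<theta>))" using t X m' by (simp add: qm)
    finally have 2: "q (Cod D \<theta>) \<cdot> (FAr X \<theta> \<cdot> m (Dom D \<theta>)) = zr (K (Dom D \<theta>)) (FOb F (Cod D \<theta>))" .
    have "q (Cod D \<theta>) \<in> hom C (FOb X (Cod D \<theta>)) (FOb F (Cod D \<theta>))" using ar t by simp
    then show ?thesis
      using kernel_lift[OF m(2) _ m(1) 1 2] 1 m' t by (auto intro: factorsI)
  qed
  obtain G \<iota> where G: "(G, X, \<iota>) \<in> Arr FC" "\<And>B. B \<in> Obj D \<Longrightarrow> FOb G B = K B"
      "\<And>B. B \<in> Obj D \<Longrightarrow> \<iota> B = m B"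
    using subfunctor[OF X(1) m(1) kernel_mono[OF m(2)] stable] by metis
  have \<iota>m: "mono C (\<iota> B)" if "B \<in> Obj D" for B using G(3) kernel_mono[OF m(2)] that by simp
  have qi: "(G, F, \<lambda>B\<in>Obj D. q B \<cdot> \<iota> B) \<in> Arr FC"
    using FC.comp_arr(1)[OF G(1) ar(1)] by simp
  have "(X, F, q) \<cdot>\<^bsub>FC\<^esub> (G, X, \<iota>) = zero_between FC G F"
    using qi zero_trans_iff[OF qi] qm G(2,3) by simp
  then have "\<exists>u. u \<in> hom FC G T \<and> (T, X, k) \<cdot>\<^bsub>FC\<^esub> u = (G, X, \<iota>)"
    by (intro FC.kernel_lift[OF ker]) (use ar G(1) in simp_all)
  then obtain v where v: "(G, T, v) \<in> Arr FC" "(T, X, k) \<cdot>\<^bsub>FC\<^esub> (G, T, v) = (G, X, \<iota>)"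
    by (metis FC.hom_iff arr_tuple funct_cat_simps(1,2))
  have kv: "k B \<cdot> v B = \<iota> B" if "B \<in> Obj D" for B
    using v(2) that by (auto dest: fun_cong[of _ _ B])
  have qk: "q B \<cdot> k B = zr (FOb T B) (FOb F B)" if B: "B \<in> Obj D" for B
  proof -
    have 1: "(T, F, \<lambda>B\<in>Obj D. q B \<cdot> k B) \<in> Arr FC" using FC.comp_arr(1)[OF ar(2,1)] by simp
    have "(T, F, \<lambda>B\<in>Obj D. q B \<cdot> k B) = zero_between FC T F" using FC.kernel_arr(4)[OF ker] by simp
    then show ?thesis using zero_trans_iff[OF 1] B by simp
  qed
  have "factors (k B) (\<iota> B)" if B: "B \<in> Obj D" for B
  proof -
    have "q B \<in> hom C (FOb X B) (FOb F B)" "k B \<in> hom C (FOb T B) (FOb X B)" using ar B by simp_all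
    then show ?thesis
      using kernel_lift[OF m(2)[OF B] _ m(1)[OF B]] qk[OF B] G(3)[OF B] m'[OF B]
      by (metis factorsI hom_iff)
  qed
  then obtain w where w: "(T, G, w) \<in> Arr FC" "\<And>B. B \<in> Obj D \<Longrightarrow> \<iota> B \<cdot> w B = k B"
    using trans_lift[OF G(1) \<iota>m ar(2)] by metis
  have kvw: "k B \<cdot> (v B \<cdot> w B) = k B" if B: "B \<in> Obj D" for B
    using comp_assoc_eq'[OF kv[OF B], of "w B"] w B v(1) ar(2) by simp
  \<comment> \<open>This retraction transports the universal property from \<open>\<iota> A\<close>
    to \<open>k A\<close>: monicity comes through \<open>w A\<close> and lifts come through
    \<open>v A\<close>.\<close>
  have "(G, T, v) \<cdot>\<^bsub>FC\<^esub> (T, G, w) = Id FC T"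
  proof (rule FC.mono_cancel[OF FC.kernel_mono[OF ker]])
    show "(T, X, k) \<cdot>\<^bsub>FC\<^esub> ((G, T, v) \<cdot>\<^bsub>FC\<^esub> (T, G, w)) = (T, X, k) \<cdot>\<^bsub>FC\<^esub> Id FC T"
      using kvw ar(2) by (auto intro!: restrict_ext)
  qed (use v(1) w(1) T FC.comp_arr[OF w(1) v(1)] FC.id_arr[OF T(1)] in simp_all)
  then have "(\<lambda>B\<in>Obj D. v B \<cdot> w B) = (\<lambda>B\<in>Obj D. Id C (FOb T B))" by simp
  from fun_cong[OF this, of A] have vw: "v A \<cdot> w A = Id C (FOb T A)" using A by simp
  have t: "q A \<in> hom C (FOb X A) (FOb F A)" "k A \<in> hom C (FOb T A) (FOb X A)"
      "v A \<in> hom C (K A) (FOb T A)" "w A \<in> hom C (FOb T A) (K A)" "\<iota> A \<in> hom C (K A) (FOb X A)"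
    using ar v(1) w(1) A G m' by simp_all
  show ?thesis
  proof (rule kernelI[OF t(1,2) qk[OF A]])
    show "mono C (k A)"
    proof (rule monoI[OF t(2)])
      fix W x y assume xy: "x \<in> hom C W (FOb T A)" "y \<in> hom C W (FOb T A)" "k A \<cdot> x = k A \<cdot> y"
      have "\<iota> A \<cdot> (w A \<cdot> x) = k A \<cdot> x" "\<iota> A \<cdot> (w A \<cdot> y) = k A \<cdot> y"
        using comp_assoc_eq'[OF w(2)[OF A], of x] comp_assoc_eq'[OF w(2)[OF A], of y] t xy(1,2) by simp_all
      then have "\<iota> A \<cdot> (w A \<cdot> x) = \<iota> A \<cdot> (w A \<cdot> y)" using xy(3) by simp
      then have wxy: "w A \<cdot> x = w A \<cdot> y"
        by (rule mono_cancel[OF \<iota>m[OF A]]) (use t xy(1,2) in simp_all)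
      have "x = v A \<cdot> (w A \<cdot> x)" "y = v A \<cdot> (w A \<cdot> y)"
        using comp_assoc_eq'[OF vw, of x] comp_assoc_eq'[OF vw, of y] t xy(1,2) by simp_all
      then show "x = y" using wxy by simp
    qed
    fix W h assume h: "h \<in> hom C W (FOb X A)" "q A \<cdot> h = zr W (FOb F A)"
    obtain u where u: "u \<in> hom C W (K A)" "\<iota> A \<cdot> u = h"
      using kernel_lift[OF m(2)[OF A] t(1) m(1)[OF A] h] G(3)[OF A] by auto
    show "factors h (k A)"
      by (rule factorsI[of "v A \<cdot> u"])
        (use u t h(1) comp_assoc_eq'[OF kv[OF A], of u] in simp_all)
  qed
qed

text \<open>The pointwise image of \<open>q\<close> receives a map that kills \<open>k\<close>, so it splits off the codomain.\<close>

lemma cokernel_pointwise_regular_epi: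
  assumes co: "is_cokernel FC (T, X, k) (X, F, q)" and A: "A \<in> Obj D"
  shows "regular_epi C (q A)"
proof -
  have ar: "(X, F, q) \<in> Arr FC" "(T, X, k) \<in> Arr FC" using FC.cokernel_arr[OF co] by simp_all
  note X = trans_Obj[OF ar(1)] and T = trans_Obj[OF ar(2)]
  have "\<exists>I e m. e \<in> hom C (FOb X B) I \<and> m \<in> hom C I (FOb F B) \<and> regular_epi C e \<and> mono C m \<and> q B = m \<cdot> e"
    if "B \<in> Obj D" for B
  proof -
    have "q B \<in> hom C (FOb X B) (FOb F B)" using ar(1) that by simp
    then show ?thesis using image_factorization by metis
  qed
  then obtain I e m where em: "\<And>B. B \<in> Obj D \<Longrightarrow> e B \<in> hom C (FOb X B) (I B)"
      "\<And>B. B \<in> Obj D \<Longrightarrow> m B \<in> hom C (I B) (FOb F B)"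
      "\<And>B. B \<in> Obj D \<Longrightarrow> regular_epi C (e B)" "\<And>B. B \<in> Obj D \<Longrightarrow> mono C (m B)"
      "\<And>B. B \<in> Obj D \<Longrightarrow> q B = m B \<cdot> e B" by metis
  have m': "m B \<in> Arr C" "Dom C (m B) = I B" "Cod C (m B) = FOb F B"
    and e': "e B \<in> Arr C" "Dom C (e B) = FOb X B" "Cod C (e B) = I B" if "B \<in> Obj D" for B
    using em(1,2)[OF that] by simp_all
  \<comment> \<open>The images are stable under the operators by diagonal lifting between the
    regular epimorphism \<open>e\<close> and the monomorphism \<open>m\<close>.\<close>
  have stable: "factors (FAr F \<theta> \<cdot> m (Dom D \<theta>)) (m (Cod D \<theta>))" if t: "\<theta> \<in> Arr D" for \<theta>
  proof -
    let ?A = "Dom D \<theta>" and ?B = "Cod D \<theta>"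
    have ob: "?A \<in> Obj D" "?B \<in> Obj D" using t by simp_all
    have "m ?B \<cdot> (e ?B \<cdot> FAr X \<theta>) = q ?B \<cdot> FAr X \<theta>"
      by (rule comp_assoc_eq'[OF em(5)[symmetric]]) (use t ob m' e' X in simp_all)
    also have "\<dots> = FAr F \<theta> \<cdot> q ?A" by (rule trans_natural[OF ar(1) t])
    also have "\<dots> = (FAr F \<theta> \<cdot> m ?A) \<cdot> e ?A" unfolding em(5)[OF ob(1)] using t ob m' e' X by simp
    finally have eq: "m ?B \<cdot> (e ?B \<cdot> FAr X \<theta>) = (FAr F \<theta> \<cdot> m ?A) \<cdot> e ?A" .
    have "\<exists>d. d \<in> hom C (I ?A) (I ?B) \<and> d \<cdot> e ?A = e ?B \<cdot> FAr X \<theta> \<and> m ?B \<cdot> d = FAr F \<theta> \<cdot> m ?A"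
      by (rule regular_epi_lift[OF em(3)[OF ob(1)] em(1)[OF ob(1)] em(4)[OF ob(2)] em(2)[OF ob(2)] _ _ eq])
        (use t ob m' e' X in simp_all)
    then obtain d where "d \<in> hom C (I ?A) (I ?B)" "m ?B \<cdot> d = FAr F \<theta> \<cdot> m ?A" by blast
    then show ?thesis using t ob m' X by (intro factorsI[of d]) simp_all
  qed
  obtain G \<iota> where G: "(G, F, \<iota>) \<in> Arr FC" "\<And>B. B \<in> Obj D \<Longrightarrow> FOb G B = I B"
      "\<And>B. B \<in> Obj D \<Longrightarrow> \<iota> B = m B"
    using subfunctor[OF X(2) em(2,4) stable] by metis
  have \<iota>m: "mono C (\<iota> B)" if "B \<in> Obj D" for B using G(3) em(4) that by simp
  have "factors (q B) (\<iota> B)" if B: "B \<in> Obj D" for B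
    by (rule factorsI[of "e B"]) (use e'[OF B] m'[OF B] em(5)[OF B] G(3)[OF B] in simp_all)
  then obtain p where p: "(X, G, p) \<in> Arr FC" "\<And>B. B \<in> Obj D \<Longrightarrow> \<iota> B \<cdot> p B = q B"
    using trans_lift[OF G(1) \<iota>m ar(1)] by metis
  have qk: "q B \<cdot> k B = zr (FOb T B) (FOb F B)" if B: "B \<in> Obj D" for B
  proof -
    have 1: "(T, F, \<lambda>B\<in>Obj D. q B \<cdot> k B) \<in> Arr FC" using FC.comp_arr(1)[OF ar(2,1)] by simp
    have "(T, F, \<lambda>B\<in>Obj D. q B \<cdot> k B) = zero_between FC T F" using FC.cokernel_arr(4)[OF co] by simp
    then show ?thesis using zero_trans_iff[OF 1] B by simp
  qed
  have pk: "p B \<cdot> k B = zr (FOb T B) (FOb G B)" if B: "B \<in> Obj D" for B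
  proof (rule mono_cancel[OF \<iota>m[OF B]])
    show "\<iota> B \<cdot> (p B \<cdot> k B) = \<iota> B \<cdot> zr (FOb T B) (FOb G B)"
      using comp_assoc_eq'[OF p(2)[OF B], of "k B"] qk[OF B] p(1) ar(2) G(1) B T trans_Obj[OF G(1)] by simp
  qed (use p(1) ar(2) G(1) B T trans_Obj[OF G(1)] in simp_all)
  have 1: "(T, G, \<lambda>B\<in>Obj D. p B \<cdot> k B) \<in> Arr FC" using FC.comp_arr(1)[OF ar(2) p(1)] by simp
  have "(X, G, p) \<cdot>\<^bsub>FC\<^esub> (T, X, k) = zero_between FC T G"
    using 1 zero_trans_iff[OF 1] pk by simp
  then have "\<exists>u. u \<in> hom FC F G \<and> u \<cdot>\<^bsub>FC\<^esub> (X, F, q) = (X, G, p)"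
    by (intro FC.cokernel_descend[OF co]) (use ar p(1) in simp_all)
  then obtain u where u: "(F, G, u) \<in> Arr FC" "(F, G, u) \<cdot>\<^bsub>FC\<^esub> (X, F, q) = (X, G, p)"
    by (metis FC.hom_iff arr_tuple funct_cat_simps(1,2))
  have uq: "u B \<cdot> q B = p B" if "B \<in> Obj D" for B
    using u(2) that by (auto dest: fun_cong[of _ _ B])
  \<comment> \<open>Cancelling the cokernel makes \<open>u\<close> a section of
    \<open>\<iota>\<close>. Being monic with a section, each component of \<open>\<iota>\<close> is
    invertible, so \<open>q A\<close> is a regular epimorphism followed by an isomorphism.\<close>
  have "(G, F, \<iota>) \<cdot>\<^bsub>FC\<^esub> (F, G, u) = Id FC F"
  proof (rule FC.cokernel_cancel[OF co])
    have "(\<iota> B \<cdot> u B) \<cdot> q B = q B" if B: "B \<in> Obj D" for B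
      using uq[OF B] p(2)[OF B] G(1) u(1) ar(1) B by simp
    then show "((G, F, \<iota>) \<cdot>\<^bsub>FC\<^esub> (F, G, u)) \<cdot>\<^bsub>FC\<^esub> (X, F, q) = Id FC F \<cdot>\<^bsub>FC\<^esub> (X, F, q)"
      using ar(1) by (auto intro!: restrict_ext)
  qed (use u(1) G(1) X FC.comp_arr[OF u(1) G(1)] FC.id_arr[OF X(2)] in simp_all)
  then have "(\<lambda>B\<in>Obj D. \<iota> B \<cdot> u B) = (\<lambda>B\<in>Obj D. Id C (FOb F B))" by simp
  from fun_cong[OF this, of A] have "\<iota> A \<cdot> u A = Id C (FOb F A)" using A by simp
  then have "iso C (\<iota> A)"
    by (intro mono_split_epi_iso[OF \<iota>m[OF A], of "u A"]) (use G(1) u(1) A in simp_all)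
  then show ?thesis
    unfolding em(5)[OF A] using em(3)[OF A] G(3)[OF A] m'[OF A] e'[OF A]
    by (intro regular_epi_comp_iso) simp_all
qed

end

section \<open>Simplicial objects\<close>

lemma simplex_Arr: "(m, n, \<theta>) \<in> Arr simplex_cat \<longleftrightarrow> \<theta> \<in> {..m} \<rightarrow>\<^sub>E {..n} \<and> mono_on {..m} \<theta>"
  by (simp add: simplex_cat_def)

lemma simplex_simps [simp]:
  "Obj simplex_cat = UNIV"
  "Dom simplex_cat (m, n, \<theta>) = m"
  "Cod simplex_cat (m, n, \<theta>) = n"
  "Id simplex_cat n = (n, n, \<lambda>i\<in>{..n}. i)"
  "Comp simplex_cat (n, p, \<phi>) (m, n', \<theta>) = (m, p, \<lambda>i\<in>{..m}. \<phi> (\<theta> i))"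
  by (simp_all add: simplex_cat_def)

lemma simplex_comp_Arr:
  assumes "(m, n, \<theta>) \<in> Arr simplex_cat" "(n, p, \<phi>) \<in> Arr simplex_cat"
  shows "(m, p, \<lambda>i\<in>{..m}. \<phi> (\<theta> i)) \<in> Arr simplex_cat"
proof -
  have "\<theta> x \<le> n" if "x \<le> m" for x using assms(1) that by (auto simp: simplex_Arr)
  then show ?thesis using assms unfolding simplex_Arr by (auto simp: monotone_on_def)
qed

lemma category_simplex_cat: "category simplex_cat"
proof
  fix A show "Id simplex_cat A \<in> hom simplex_cat A A"
    by (simp add: hom_def simplex_Arr monotone_on_def)
next
  fix f g A B D assume "f \<in> hom simplex_cat A B" "g \<in> hom simplex_cat B D"
  then show "g \<cdot>\<^bsub>simplex_cat\<^esub> f \<in> hom simplex_cat A D"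
    using simplex_comp_Arr by (cases f; cases g) (auto simp: hom_def)
next
  fix f A B assume "f \<in> hom simplex_cat A B"
  then show "Id simplex_cat B \<cdot>\<^bsub>simplex_cat\<^esub> f = f" "f \<cdot>\<^bsub>simplex_cat\<^esub> Id simplex_cat A = f"
    by (cases f; auto simp: hom_def simplex_Arr PiE_iff extensional_def fun_eq_iff)+
next
  fix f g h A B D E
  assume "f \<in> hom simplex_cat A B" "g \<in> hom simplex_cat B D" "h \<in> hom simplex_cat D E"
  then show "(h \<cdot>\<^bsub>simplex_cat\<^esub> g) \<cdot>\<^bsub>simplex_cat\<^esub> f = h \<cdot>\<^bsub>simplex_cat\<^esub> (g \<cdot>\<^bsub>simplex_cat\<^esub> f)"
    by (cases f; cases g; cases h) (auto simp: hom_def simplex_Arr fun_eq_iff)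
qed simp_all

lemma coface_Arr:
  assumes "1 \<le> k" "i \<le> k"
  shows "coface k i \<in> Arr simplex_cat"
  using assms unfolding coface_def simplex_Arr by (auto simp: monotone_on_def)

text \<open>Values above the missed \<open>i\<close> are lowered by one, which closes the gap in
  [k].\<close>

lemma simplex_factor_coface:
  assumes t: "(l, k, \<theta>) \<in> Arr simplex_cat" and k: "1 \<le> k" "i \<le> k" and miss: "i \<notin> \<theta> ` {..l}"
  obtains \<phi> where "(l, k - 1, \<phi>) \<in> Arr simplex_cat" "coface k i \<cdot>\<^bsub>simplex_cat\<^esub> (l, k - 1, \<phi>) = (l, k, \<theta>)"
proof
  let ?\<phi> = "\<lambda>x\<in>{..l}. if \<theta> x < i then \<theta> x else \<theta> x - 1"
  have \<theta>: "\<theta> x \<le> k" "\<theta> x \<noteq> i" if "x \<le> l" for x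
    using t miss that by (auto simp: simplex_Arr)
  have mono: "\<theta> x \<le> \<theta> y" if "x \<le> y" "y \<le> l" for x y
    using t that by (auto simp: simplex_Arr monotone_on_def)
  \<comment> \<open>Arrows of the simplex category carry extensional functions, so the final
    equation is also checked off \<open>{..l}\<close>, where both sides are
    \<open>undefined\<close>.\<close>
  have undef: "\<theta> x = undefined" if "\<not> x \<le> l" for x
    using t that by (auto simp: simplex_Arr PiE_iff extensional_def)
  show "(l, k - 1, ?\<phi>) \<in> Arr simplex_cat"
    unfolding simplex_Arr
  proof
    show "?\<phi> \<in> {..l} \<rightarrow>\<^sub>E {..k - 1}"
    proof (rule restrict_PiE_iff[THEN iffD2], rule ballI)
      fix x assume "x \<in> {..l}"
      then show "(if \<theta> x < i then \<theta> x else \<theta> x - 1) \<in> {..k - 1}"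
        using \<theta>[of x] k by auto
    qed
    show "mono_on {..l} ?\<phi>"
    proof (rule monotone_onI)
      fix x y assume xy: "x \<in> {..l}" "y \<in> {..l}" "x \<le> y"
      then show "?\<phi> x \<le> ?\<phi> y" using \<theta>[of x] \<theta>[of y] mono[of x y] by auto
    qed
  qed
  have "(\<lambda>x\<in>{..l}. (\<lambda>j\<in>{..k - 1}. if j < i then j else Suc j) (?\<phi> x)) = \<theta>"
  proof
    fix x
    show "(\<lambda>x\<in>{..l}. (\<lambda>j\<in>{..k - 1}. if j < i then j else Suc j) (?\<phi> x)) x = \<theta> x"
    proof (cases "x \<le> l")
      case True
      then show ?thesis using \<theta>[OF True] k by auto
    qed (use undef in simp)
  qed
  then show "coface k i \<cdot>\<^bsub>simplex_cat\<^esub> (l, k - 1, ?\<phi>) = (l, k, \<theta>)"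
    unfolding coface_def by simp
qed

locale simplicial_objects = semi_abelian_functor_category "op_cat simplex_cat" C
  for C :: "('o, 'm) cat" (structure)

lemma (in semi_abelian_category) simplicial_objects: "simplicial_objects C"
  unfolding simplicial_objects_def semi_abelian_functor_category_def functor_category_def
  using category_op_cat[OF category_simplex_cat] category_axioms semi_abelian_category_axioms by blast

context simplicial_objects
begin

lemma Simp_FC: "Simp C = FC"
  by (simp add: Simp_def)

lemma simp_ob [simp]: "X \<in> Obj FC \<Longrightarrow> FOb X k \<in> Obj C"
  by simp

lemma simp_ar:
  assumes "X \<in> Obj FC" "(l, k, \<theta>) \<in> Arr simplex_cat"
  shows "FAr X (l, k, \<theta>) \<in> hom C (FOb X k) (FOb X l)"
  using functor_ar[OF assms(1), of "(l, k, \<theta>)"] assms(2) by simp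

lemma simp_comp:
  assumes "X \<in> Obj FC" "(l, m, \<theta>) \<in> Arr simplex_cat" "(m, k, \<phi>) \<in> Arr simplex_cat"
  shows "FAr X ((m, k, \<phi>) \<cdot>\<^bsub>simplex_cat\<^esub> (l, m, \<theta>)) = FAr X (l, m, \<theta>) \<cdot> FAr X (m, k, \<phi>)"
  using functor_comp[OF assms(1), of "(m, k, \<phi>)" "(l, m, \<theta>)"] assms(2,3) by simp

lemma face_hom [simp]:
  assumes "X \<in> Obj FC" "1 \<le> k" "i \<le> k"
  shows "face X k i \<in> Arr C" "Dom C (face X k i) = FOb X k" "Cod C (face X k i) = FOb X (k - 1)"
proof -
  have "face X k i \<in> hom C (FOb X k) (FOb X (k - 1))"
    unfolding face_def using coface_Arr[OF assms(2,3)] simp_ar[OF assms(1)] by (simp add: coface_def)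
  then show "face X k i \<in> Arr C" "Dom C (face X k i) = FOb X k" "Cod C (face X k i) = FOb X (k - 1)"
    by simp_all
qed

lemma FAr_factor_face:
  assumes X: "X \<in> Obj FC" and t: "(l, k, \<theta>) \<in> Arr simplex_cat" and k: "1 \<le> k" "i \<le> k"
    and miss: "i \<notin> \<theta> ` {..l}"
  obtains f where "f \<in> hom C (FOb X (k - 1)) (FOb X l)" "FAr X (l, k, \<theta>) = f \<cdot> face X k i"
proof -
  obtain \<phi> where \<phi>: "(l, k - 1, \<phi>) \<in> Arr simplex_cat"
      "coface k i \<cdot>\<^bsub>simplex_cat\<^esub> (l, k - 1, \<phi>) = (l, k, \<theta>)"
    by (rule simplex_factor_coface[OF t k miss])
  show ?thesis
  proof (rule that[OF simp_ar[OF X \<phi>(1)]])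
    have c: "(k - 1, k, \<lambda>j\<in>{..k - 1}. if j < i then j else Suc j) \<in> Arr simplex_cat"
      using coface_Arr[OF k] by (simp add: coface_def)
    show "FAr X (l, k, \<theta>) = FAr X (l, k - 1, \<phi>) \<cdot> face X k i"
      using simp_comp[OF X \<phi>(1) c] unfolding face_def \<phi>(2)[symmetric] coface_def .
  qed
qed

text \<open>The simplicial identity behind the Moore complex: it makes the last face restrict to
  Moore objects and makes consecutive differentials compose to zero.\<close>

lemma face_face:
  assumes X: "X \<in> Obj FC" and k: "2 \<le> k" "i < k"
  shows "face X (k - 1) i \<cdot> face X k k = face X (k - 1) (k - 1) \<cdot> face X k i"
proof -
  have arr: "coface k k \<in> Arr simplex_cat" "coface (k - 1) i \<in> Arr simplex_cat"
      "coface k i \<in> Arr simplex_cat" "coface (k - 1) (k - 1) \<in> Arr simplex_cat"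
    by (rule coface_Arr; use k in simp)+
  have "coface k k \<cdot>\<^bsub>simplex_cat\<^esub> coface (k - 1) i = coface k i \<cdot>\<^bsub>simplex_cat\<^esub> coface (k - 1) (k - 1)"
    using k unfolding coface_def by (auto simp: fun_eq_iff)
  then show ?thesis
    unfolding face_def using arr
      functor_comp[OF X, of "coface k k" "coface (k - 1) i"]
      functor_comp[OF X, of "coface k i" "coface (k - 1) (k - 1)"]
    by (simp add: coface_def)
qed

lemma last_face_regular_epi:
  assumes X: "X \<in> Obj FC" and k: "1 \<le> k"
  shows "regular_epi C (face X k k)"
proof -
  \<comment> \<open>The codegeneracy onto [k - 1] that takes the value k - 1 twice; contravariance
    turns it into a section of the last face.\<close>
  let ?s = "\<lambda>j\<in>{..k}. min j (k - 1)"
  have s: "(k, k - 1, ?s) \<in> Arr simplex_cat"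
    unfolding simplex_Arr by (auto simp: monotone_on_def)
  have c: "(k - 1, k, \<lambda>j\<in>{..k - 1}. if j < k then j else Suc j) \<in> Arr simplex_cat"
    using coface_Arr[OF k order_refl] by (simp add: coface_def)
  have "(k, k - 1, ?s) \<cdot>\<^bsub>simplex_cat\<^esub> coface k k = Id simplex_cat (k - 1)"
    using k unfolding coface_def by (auto simp: fun_eq_iff)
  then have "face X k k \<cdot> FAr X (k, k - 1, ?s) = Id C (FOb X (k - 1))"
    using simp_comp[OF X c s] functor_id[OF X, of "k - 1"] unfolding face_def coface_def by simp
  then show ?thesis
    by (intro split_epi_regular[of "face X k k" "FOb X k" "FOb X (k - 1)" "FAr X (k, k - 1, ?s)"])
      (use simp_ar[OF X s] X k in simp_all)
qed

lemma trans_face: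
  assumes a: "(X, Y, \<alpha>) \<in> Arr FC" and k: "1 \<le> k" "i \<le> k"
  shows "\<alpha> (k - 1) \<cdot> face X k i = face Y k i \<cdot> \<alpha> k"
  using trans_natural[OF a, of "coface k i"] coface_Arr[OF k]
  unfolding face_def by (simp add: coface_def)

end

section \<open>Chain complexes\<close>

lemma ch_Obj: "M \<in> Obj (ch C) \<longleftrightarrow> is_cpx C M"
  by (simp add: ch_def)

lemma ch_Arr: "(M, M', f) \<in> Arr (ch C) \<longleftrightarrow> is_cpx C M \<and> is_cpx C M' \<and>
    (\<forall>i. f i \<in> hom C (Term M i) (Term M' i)) \<and>
    (\<forall>i. Diff M' i \<cdot>\<^bsub>C\<^esub> f i = f (i - 1) \<cdot>\<^bsub>C\<^esub> Diff M i)"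
  by (simp add: ch_def)

lemma ch_simps [simp]:
  "Dom (ch C) (M, M', f) = M"
  "Cod (ch C) (M, M', f) = M'"
  "Id (ch C) M = (M, M, \<lambda>i. Id C (Term M i))"
  "Comp (ch C) (M', M'', g) (M, N, f) = (M, M'', \<lambda>i. g i \<cdot>\<^bsub>C\<^esub> f i)"
  by (simp_all add: ch_def)

context category
begin

lemma cpx_Term [simp]: "is_cpx C M \<Longrightarrow> Term M i \<in> Obj C"
  unfolding is_cpx_def by blast

lemma cpx_Diff [simp]:
  assumes "is_cpx C M"
  shows "Diff M i \<in> Arr C" "Dom C (Diff M i) = Term M i" "Cod C (Diff M i) = Term M (i - 1)"
proof -
  have "Diff M i \<in> hom C (Term M i) (Term M (i - 1))" using assms unfolding is_cpx_def by blast
  then show "Diff M i \<in> Arr C" "Dom C (Diff M i) = Term M i" "Cod C (Diff M i) = Term M (i - 1)"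
    by simp_all
qed

lemma chain_map [simp]:
  assumes "(M, M', f) \<in> Arr (ch C)"
  shows "f i \<in> Arr C" "Dom C (f i) = Term M i" "Cod C (f i) = Term M' i"
proof -
  have "f i \<in> hom C (Term M i) (Term M' i)" using assms unfolding ch_Arr by blast
  then show "f i \<in> Arr C" "Dom C (f i) = Term M i" "Cod C (f i) = Term M' i" by simp_all
qed

lemma chain_map_cpx:
  assumes "(M, M', f) \<in> Arr (ch C)"
  shows "is_cpx C M" "is_cpx C M'"
  using assms unfolding ch_Arr by blast+

lemma chain_map_Diff:
  assumes "(M, M', f) \<in> Arr (ch C)"
  shows "Diff M' i \<cdot> f i = f (i - 1) \<cdot> Diff M i"
  using assms unfolding ch_Arr by blast

lemma chain_mapI:
  assumes "is_cpx C M" "is_cpx C M'" "\<And>i. f i \<in> hom C (Term M i) (Term M' i)"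
    "\<And>i. Diff M' i \<cdot> f i = f (i - 1) \<cdot> Diff M i"
  shows "(M, M', f) \<in> Arr (ch C)"
  using assms unfolding ch_Arr by blast

lemma ch_homE:
  assumes "f \<in> hom (ch C) M N"
  obtains \<alpha> where "f = (M, N, \<alpha>)" "(M, N, \<alpha>) \<in> Arr (ch C)"
  using assms by (cases f) (auto simp: hom_def)

lemma category_ch: "category (ch C)"
proof
  fix f assume "f \<in> Arr (ch C)"
  then show "Dom (ch C) f \<in> Obj (ch C)" "Cod (ch C) f \<in> Obj (ch C)"
    by (cases f; use chain_map_cpx in \<open>auto simp: ch_Obj\<close>)+
next
  fix M assume M: "M \<in> Obj (ch C)"
  have "(M, M, \<lambda>i. Id C (Term M i)) \<in> Arr (ch C)"
    by (rule chain_mapI) (use M in \<open>simp_all add: ch_Obj\<close>)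
  then show "Id (ch C) M \<in> hom (ch C) M M" by (simp add: hom_def)
next
  fix f g M N P assume fg: "f \<in> hom (ch C) M N" "g \<in> hom (ch C) N P"
  obtain \<alpha> where a: "f = (M, N, \<alpha>)" "(M, N, \<alpha>) \<in> Arr (ch C)" by (rule ch_homE[OF fg(1)])
  obtain \<beta> where b: "g = (N, P, \<beta>)" "(N, P, \<beta>) \<in> Arr (ch C)" by (rule ch_homE[OF fg(2)])
  note c = chain_map_cpx[OF a(2)] chain_map_cpx[OF b(2)]
  have "(M, P, \<lambda>i. \<beta> i \<cdot> \<alpha> i) \<in> Arr (ch C)"
  proof (rule chain_mapI)
    fix i
    have "Diff P i \<cdot> (\<beta> i \<cdot> \<alpha> i) = \<beta> (i - 1) \<cdot> (Diff N i \<cdot> \<alpha> i)"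
      by (rule comp_assoc_eq[OF chain_map_Diff[OF b(2)]]) (use a(2) b(2) c in simp_all)
    also have "\<dots> = (\<beta> (i - 1) \<cdot> \<alpha> (i - 1)) \<cdot> Diff M i"
      unfolding chain_map_Diff[OF a(2)] using a(2) b(2) c by simp
    finally show "Diff P i \<cdot> (\<beta> i \<cdot> \<alpha> i) = (\<beta> (i - 1) \<cdot> \<alpha> (i - 1)) \<cdot> Diff M i" .
  qed (use a(2) b(2) c in simp_all)
  then show "g \<cdot>\<^bsub>ch C\<^esub> f \<in> hom (ch C) M P" by (simp add: hom_def a b)
next
  fix f M N assume f: "f \<in> hom (ch C) M N"
  obtain \<alpha> where a: "f = (M, N, \<alpha>)" "(M, N, \<alpha>) \<in> Arr (ch C)" by (rule ch_homE[OF f])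
  show "Id (ch C) N \<cdot>\<^bsub>ch C\<^esub> f = f" "f \<cdot>\<^bsub>ch C\<^esub> Id (ch C) M = f"
    using a(2) by (simp_all add: a(1))
next
  fix f g h M N P Q assume fgh: "f \<in> hom (ch C) M N" "g \<in> hom (ch C) N P" "h \<in> hom (ch C) P Q"
  obtain \<alpha> where a: "f = (M, N, \<alpha>)" "(M, N, \<alpha>) \<in> Arr (ch C)" by (rule ch_homE[OF fgh(1)])
  obtain \<beta> where b: "g = (N, P, \<beta>)" "(N, P, \<beta>) \<in> Arr (ch C)" by (rule ch_homE[OF fgh(2)])
  obtain \<gamma> where c: "h = (P, Q, \<gamma>)" "(P, Q, \<gamma>) \<in> Arr (ch C)" by (rule ch_homE[OF fgh(3)])
  show "(h \<cdot>\<^bsub>ch C\<^esub> g) \<cdot>\<^bsub>ch C\<^esub> f = h \<cdot>\<^bsub>ch C\<^esub> (g \<cdot>\<^bsub>ch C\<^esub> f)"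
    using a(2) b(2) c(2) by (simp add: a(1) b(1) c(1))
qed

end

section \<open>Zero arrows, kernels and cokernels of chain complexes\<close>

context pointed_category
begin

text \<open>The identity of a zero object is its zero endomorphism, so these differentials compose
  to zero.\<close>

definition zero_cpx :: "('a, 'b) cpx" where
  "zero_cpx = \<lparr>Term = \<lambda>_. some_zero C, Diff = \<lambda>_. Id C (some_zero C)\<rparr>"

lemma zero_cpx_Obj: "is_cpx C zero_cpx"
proof -
  have "zero_arr C (Id C (some_zero C))"
    using some_zero by (intro zero_arr_eq_zr[THEN iffD2]) (simp_all add: zero_obj_iff)
  then show ?thesis by (simp add: is_cpx_def zero_cpx_def)
qed

lemma zero_cpx_Term [simp]: "Term zero_cpx i = some_zero C"
  by (simp add: zero_cpx_def)

lemma zero_chain_map: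
  assumes "is_cpx C M" "is_cpx C N"
  shows "(M, N, \<lambda>i. zr (Term M i) (Term N i)) \<in> Arr (ch C)"
  by (rule chain_mapI) (use assms in simp_all)

lemma zero_cpx: "zero_obj (ch C) zero_cpx"
proof -
  interpret ch: category "ch C" by (rule category_ch)
  show ?thesis
    unfolding zero_obj_def
  proof (intro conjI ballI)
    show "zero_cpx \<in> Obj (ch C)" by (simp add: ch_Obj zero_cpx_Obj)
    fix M assume M: "M \<in> Obj (ch C)"
    then have M': "is_cpx C M" by (simp add: ch_Obj)
    show "\<exists>!f. f \<in> hom (ch C) M zero_cpx"
    proof (rule ex1I[of _ "(M, zero_cpx, \<lambda>i. zr (Term M i) (Term zero_cpx i))"])
      fix f assume f: "f \<in> hom (ch C) M zero_cpx"
      obtain \<alpha> where a: "f = (M, zero_cpx, \<alpha>)" "(M, zero_cpx, \<alpha>) \<in> Arr (ch C)" by (rule ch_homE[OF f])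
      have "\<alpha> i = zr (Term M i) (some_zero C)" for i
        by (rule to_zero_obj[OF some_zero]) (use a(2) in simp)
      then show "f = (M, zero_cpx, \<lambda>i. zr (Term M i) (Term zero_cpx i))"
        unfolding a(1) by (simp add: fun_eq_iff)
    qed (use zero_chain_map[OF M' zero_cpx_Obj] in simp)
    show "\<exists>!f. f \<in> hom (ch C) zero_cpx M"
    proof (rule ex1I[of _ "(zero_cpx, M, \<lambda>i. zr (Term zero_cpx i) (Term M i))"])
      fix f assume f: "f \<in> hom (ch C) zero_cpx M"
      obtain \<alpha> where a: "f = (zero_cpx, M, \<alpha>)" "(zero_cpx, M, \<alpha>) \<in> Arr (ch C)" by (rule ch_homE[OF f])
      have "\<alpha> i = zr (some_zero C) (Term M i)" for i
        by (rule from_zero_obj[OF some_zero]) (use a(2) in simp)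
      then show "f = (zero_cpx, M, \<lambda>i. zr (Term zero_cpx i) (Term M i))"
        unfolding a(1) by (simp add: fun_eq_iff)
    qed (use zero_chain_map[OF zero_cpx_Obj M'] in simp)
  qed
qed

lemma pointed_ch: "pointed_category (ch C)"
  using category_ch zero_cpx
  by (auto simp: pointed_category_def pointed_category_axioms_def pointed_def)

lemma zero_between_ch:
  assumes "is_cpx C M" "is_cpx C N"
  shows "zero_between (ch C) M N = (M, N, \<lambda>i. zr (Term M i) (Term N i))"
proof -
  interpret ch: pointed_category "ch C" by (rule pointed_ch)
  have "zero_arr (ch C) ((zero_cpx, N, \<lambda>i. zr (Term zero_cpx i) (Term N i)) \<cdot>\<^bsub>ch C\<^esub>
      (M, zero_cpx, \<lambda>i. zr (Term M i) (Term zero_cpx i)))"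
    by (rule ch.zero_arrI[OF zero_cpx])
      (use zero_chain_map[OF assms(1) zero_cpx_Obj] zero_chain_map[OF zero_cpx_Obj assms(2)] in simp_all)
  then have "zero_arr (ch C) (M, N, \<lambda>i. zr (Term M i) (Term N i))" using assms by simp
  then show ?thesis
    using ch.zero_arr_eq_zr[of "(M, N, \<lambda>i. zr (Term M i) (Term N i))" M N] zero_chain_map[OF assms] by simp
qed

text \<open>Degreewise lifts commute with the differentials because the components
  \<open>k i\<close> are monic. The cokernel version cancels \<open>q i\<close> instead.\<close>

lemma ch_kernelI:
  assumes q: "(M, F, q) \<in> Arr (ch C)" and k: "(T, M, k) \<in> Arr (ch C)"
    and ker: "\<And>i. is_kernel C (q i) (k i)"
  shows "is_kernel (ch C) (M, F, q) (T, M, k)"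
proof -
  interpret ch: pointed_category "ch C" by (rule pointed_ch)
  note cpx = chain_map_cpx[OF q] chain_map_cpx[OF k]
  have m: "mono C (k i)" for i by (rule kernel_mono[OF ker])
  have qk: "q i \<cdot> k i = zr (Term T i) (Term F i)" for i
    using kernel_arr(4)[OF ker, of i] q k by simp
  show ?thesis
  proof (rule ch.kernelI[of _ M F _ T])
    show "(M, F, q) \<cdot>\<^bsub>ch C\<^esub> (T, M, k) = zero_between (ch C) T F"
      using qk cpx by (simp add: zero_between_ch)
    show "mono (ch C) (T, M, k)"
    proof (rule ch.monoI[of _ T M])
      fix W a b assume ab: "a \<in> hom (ch C) W T" "b \<in> hom (ch C) W T"
        "(T, M, k) \<cdot>\<^bsub>ch C\<^esub> a = (T, M, k) \<cdot>\<^bsub>ch C\<^esub> b"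
      obtain \<alpha> where a: "a = (W, T, \<alpha>)" "(W, T, \<alpha>) \<in> Arr (ch C)" by (rule ch_homE[OF ab(1)])
      obtain \<beta> where b: "b = (W, T, \<beta>)" "(W, T, \<beta>) \<in> Arr (ch C)" by (rule ch_homE[OF ab(2)])
      have "\<alpha> i = \<beta> i" for i
      proof (rule mono_cancel[OF m])
        show "k i \<cdot> \<alpha> i = k i \<cdot> \<beta> i" using ab(3) unfolding a b by (simp add: fun_eq_iff)
      qed (use a b k in simp_all)
      then show "a = b" unfolding a b by (simp add: fun_eq_iff)
    qed (use k in simp)
    fix W h assume h: "h \<in> hom (ch C) W M" "(M, F, q) \<cdot>\<^bsub>ch C\<^esub> h = zero_between (ch C) W F"
    obtain \<gamma> where g: "h = (W, M, \<gamma>)" "(W, M, \<gamma>) \<in> Arr (ch C)" by (rule ch_homE[OF h(1)])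
    note W = chain_map_cpx[OF g(2)]
    have qg: "q i \<cdot> \<gamma> i = zr (Term W i) (Term F i)" for i
      using h(2) unfolding g(1) zero_between_ch[OF W(1) cpx(2)] by (simp add: fun_eq_iff)
    have "\<exists>u. u \<in> hom C (Term W i) (Term T i) \<and> k i \<cdot> u = \<gamma> i" for i
      by (rule kernel_lift[OF ker _ _ _ qg]) (use q k g in simp_all)
    then obtain u where u: "\<And>i. u i \<in> hom C (Term W i) (Term T i)" "\<And>i. k i \<cdot> u i = \<gamma> i" by metis
    have u': "u i \<in> Arr C" "Dom C (u i) = Term W i" "Cod C (u i) = Term T i" for i using u(1)[of i] by simp_all
    have "(W, T, u) \<in> Arr (ch C)"
    proof (rule chain_mapI[OF W(1) cpx(3) u(1)])
      fix i
      have "k (i - 1) \<cdot> (Diff T i \<cdot> u i) = Diff M i \<cdot> (k i \<cdot> u i)"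
        by (rule comp_assoc_eq[OF chain_map_Diff[OF k, symmetric]]) (use u' cpx k in simp_all)
      also have "\<dots> = \<gamma> (i - 1) \<cdot> Diff W i" unfolding u(2) by (rule chain_map_Diff[OF g(2)])
      also have "\<dots> = k (i - 1) \<cdot> (u (i - 1) \<cdot> Diff W i)"
        by (rule comp_assoc_eq'[OF u(2), symmetric]) (use u' W k in simp_all)
      finally show "Diff T i \<cdot> u i = u (i - 1) \<cdot> Diff W i"
        by (rule mono_cancel[OF m]) (use u' cpx k W in simp_all)
    qed
    then show "ch.factors h (T, M, k)"
      unfolding g(1) by (intro ch.factorsI[of "(W, T, u)"]) (use u(2) in simp_all)
  qed (use q k in simp_all)
qed

lemma ch_cokernelI:
  assumes q: "(M, F, q) \<in> Arr (ch C)" and k: "(T, M, k) \<in> Arr (ch C)"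
    and cok: "\<And>i. is_cokernel C (k i) (q i)"
  shows "is_cokernel (ch C) (T, M, k) (M, F, q)"
proof -
  interpret ch: pointed_category "ch C" by (rule pointed_ch)
  note cpx = chain_map_cpx[OF q] chain_map_cpx[OF k]
  have qk: "q i \<cdot> k i = zr (Term T i) (Term F i)" for i
    using cokernel_arr(4)[OF cok, of i] q k by simp
  show ?thesis
  proof (rule ch.cokernelI[of _ T M _ F])
    show "(M, F, q) \<cdot>\<^bsub>ch C\<^esub> (T, M, k) = zero_between (ch C) T F"
      using qk cpx by (simp add: zero_between_ch)
  next
    fix D h assume h: "h \<in> hom (ch C) M D" "h \<cdot>\<^bsub>ch C\<^esub> (T, M, k) = zero_between (ch C) T D"
    obtain \<gamma> where g: "h = (M, D, \<gamma>)" "(M, D, \<gamma>) \<in> Arr (ch C)" by (rule ch_homE[OF h(1)])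
    note D = chain_map_cpx[OF g(2)]
    have gk: "\<gamma> i \<cdot> k i = zr (Term T i) (Term D i)" for i
      using h(2) unfolding g(1) zero_between_ch[OF cpx(3) D(2)] by (simp add: fun_eq_iff)
    have "\<exists>u. u \<in> hom C (Term F i) (Term D i) \<and> u \<cdot> q i = \<gamma> i" for i
      by (rule cokernel_descend[OF cok _ _ _ gk]) (use q k g in simp_all)
    then obtain u where u: "\<And>i. u i \<in> hom C (Term F i) (Term D i)" "\<And>i. u i \<cdot> q i = \<gamma> i" by metis
    have u': "u i \<in> Arr C" "Dom C (u i) = Term F i" "Cod C (u i) = Term D i" for i using u(1)[of i] by simp_all
    have "(F, D, u) \<in> Arr (ch C)"
    proof (rule chain_mapI[OF cpx(2) D(2) u(1)])
      fix i
      have "(Diff D i \<cdot> u i) \<cdot> q i = Diff D i \<cdot> \<gamma> i" using u' u(2) D q by simp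
      also have "\<dots> = \<gamma> (i - 1) \<cdot> Diff M i" by (rule chain_map_Diff[OF g(2)])
      also have "\<dots> = u (i - 1) \<cdot> (q (i - 1) \<cdot> Diff M i)"
        by (rule comp_assoc_eq'[OF u(2), symmetric]) (use u' cpx q in simp_all)
      also have "\<dots> = (u (i - 1) \<cdot> Diff F i) \<cdot> q i"
        unfolding chain_map_Diff[OF q, symmetric] using u' cpx q by simp
      finally show "Diff D i \<cdot> u i = u (i - 1) \<cdot> Diff F i"
        by (rule cokernel_cancel[OF cok]) (use u' cpx q D in simp_all)
    qed
    then show "\<exists>v\<in>hom (ch C) F D. v \<cdot>\<^bsub>ch C\<^esub> (M, F, q) = h"
      unfolding g(1) by (intro bexI[of _ "(F, D, u)"]) (use u(2) in simp_all)
  next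
    fix D u v assume uv: "u \<in> hom (ch C) F D" "v \<in> hom (ch C) F D"
      "u \<cdot>\<^bsub>ch C\<^esub> (M, F, q) = v \<cdot>\<^bsub>ch C\<^esub> (M, F, q)"
    obtain \<alpha> where a: "u = (F, D, \<alpha>)" "(F, D, \<alpha>) \<in> Arr (ch C)" by (rule ch_homE[OF uv(1)])
    obtain \<beta> where b: "v = (F, D, \<beta>)" "(F, D, \<beta>) \<in> Arr (ch C)" by (rule ch_homE[OF uv(2)])
    have "\<alpha> i = \<beta> i" for i
    proof (rule cokernel_cancel[OF cok])
      show "\<alpha> i \<cdot> q i = \<beta> i \<cdot> q i" using uv(3) unfolding a b by (simp add: fun_eq_iff)
    qed (use a b q in simp_all)
    then show "u = v" unfolding a b by (simp add: fun_eq_iff)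
  qed (use q k in simp_all)
qed

end

section \<open>Normal monomorphisms and proper complexes\<close>

context semi_abelian_category
begin

text \<open>Handles the degrees where the target complex vanishes: the negative ones and, for a
  torsion-free quotient, those above n + 1.\<close>

lemma to_zero_regular_epi:
  assumes Z: "zero_obj C Z" and f: "f \<in> hom C A Z"
  shows "regular_epi C f"
proof -
  have ob: "A \<in> Obj C" "Z \<in> Obj C" using f by auto
  show ?thesis
    by (rule split_epi_regular[OF f, of "zr Z A"])
      (use f ob Z in \<open>simp_all add: zero_obj_iff\<close>)
qed

lemma id_normal_mono:
  assumes A: "A \<in> Obj C"
  shows "normal_mono C (Id C A)"
proof -
  have "is_kernel C (zr A A) (Id C A)"
  proof (rule kernelI[of _ A A _ A])
    show "mono C (Id C A)" by (rule monoI[of _ A A]) (use A in simp_all)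
    show "factors h (Id C A)" if "h \<in> hom C W A" for W h
      by (rule factorsI[of h]) (use that A in simp_all)
  qed (use A in simp_all)
  then show ?thesis unfolding normal_mono_def by blast
qed

lemma normal_mono_comp_iso:
  assumes m: "normal_mono C m" and e: "iso C e" "Cod C e = Dom C m"
  shows "normal_mono C (m \<cdot> e)"
proof -
  obtain f where f: "is_kernel C f m" using m unfolding normal_mono_def by blast
  note ar = kernel_arr[OF f]
  have ea: "e \<in> Arr C" using e by (simp add: iso_def)
  obtain g where g: "g \<in> hom C (Cod C e) (Dom C e)" "g \<cdot> e = Id C (Dom C e)" "e \<cdot> g = Id C (Cod C e)"
    using e(1) unfolding iso_def by blast
  have "is_kernel C f (m \<cdot> e)"
  proof (rule kernelI[of _ "Dom C f" "Cod C f" _ "Dom C e"])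
    show "f \<cdot> (m \<cdot> e) = zr (Dom C e) (Cod C f)"
      using comp_assoc_eq'[OF ar(4), of e] ar ea e(2) by simp
    show "mono C (m \<cdot> e)"
    proof (rule monoI[of _ "Dom C e" "Cod C m"])
      fix W x y assume xy: "x \<in> hom C W (Dom C e)" "y \<in> hom C W (Dom C e)" "(m \<cdot> e) \<cdot> x = (m \<cdot> e) \<cdot> y"
      have "m \<cdot> (e \<cdot> x) = m \<cdot> (e \<cdot> y)" using xy ar ea e(2) by simp
      then have ex: "e \<cdot> x = e \<cdot> y"
        by (rule mono_cancel[OF kernel_mono[OF f]]) (use xy(1,2) ea e(2) in simp_all)
      have "x = g \<cdot> (e \<cdot> x)" "y = g \<cdot> (e \<cdot> y)"
        using comp_assoc_eq'[OF g(2), of x] comp_assoc_eq'[OF g(2), of y] xy(1,2) ea g(1) by simp_all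
      then show "x = y" using ex by simp
    qed (use ar ea e(2) in simp)
    fix W h assume h: "h \<in> hom C W (Dom C f)" "f \<cdot> h = zr W (Cod C f)"
    have "\<exists>u. u \<in> hom C W (Dom C m) \<and> m \<cdot> u = h"
      by (rule kernel_lift[OF f _ _ h]) (use ar in simp_all)
    then obtain u where u: "u \<in> hom C W (Dom C m)" "m \<cdot> u = h" by blast
    show "factors h (m \<cdot> e)"
      by (rule factorsI[of "g \<cdot> u"])
        (use u h(1) g(1) ea e(2) ar comp_assoc_eq'[OF g(3), of u] in simp_all)
  qed (use ar ea e(2) in simp_all)
  then show ?thesis unfolding normal_mono_def by blast
qed

text \<open>The finite family is packed into a single arrow, and \<open>m\<close> itself is shown to
  be its kernel. This suits \<open>moore_incl\<close>, whose value is already chosen.\<close>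

lemma joint_kernel_normal_mono:
  assumes S: "finite S" "A \<in> Obj C" "\<And>s. s \<in> S \<Longrightarrow> s \<in> Arr C \<and> Dom C s = A"
    and m: "m \<in> hom C K A" "mono C m" "\<And>s. s \<in> S \<Longrightarrow> s \<cdot> m = zr K (Cod C s)"
    and fac: "\<And>W h. \<lbrakk>h \<in> hom C W A; \<And>s. s \<in> S \<Longrightarrow> s \<cdot> h = zr W (Cod C s)\<rbrakk> \<Longrightarrow> factors h m"
  shows "normal_mono C m"
proof -
  obtain f B where f: "f \<in> hom C A B"
    and ff: "\<And>W h. h \<in> hom C W A \<Longrightarrow> f \<cdot> h = zr W B \<longleftrightarrow> (\<forall>s\<in>S. s \<cdot> h = zr W (Cod C s))"
    using finite_joint_arrow[OF S] by blast
  have "is_kernel C f m"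
  proof (rule kernelI[OF f m(1) _ m(2)])
    show "f \<cdot> m = zr K B" using ff[OF m(1)] m(3) by blast
    show "factors h m" if "h \<in> hom C W A" "f \<cdot> h = zr W B" for W h
      using fac[OF that(1)] ff[OF that(1)] that(2) by blast
  qed
  then show ?thesis unfolding normal_mono_def by blast
qed

text \<open>In the factorization given by properness the epic part inherits monicity and becomes
  invertible, so the differential represents its own image.\<close>

lemma proper_mono_normal_mono:
  assumes M: "proper C M" and m: "mono C (Diff M i)"
  shows "normal_mono C (Diff M i)"
proof -
  obtain n e where ne: "normal_epi C e" "mono C n" "Cod C e = Dom C n" "Diff M i = n \<cdot> e" "normal_mono C n"
    using M unfolding proper_def by blast
  have re: "regular_epi C e" using ne(1) by (rule normal_epi_regular)
  have ar: "e \<in> Arr C" "n \<in> Arr C" using regular_epi_arr[OF re] mono_arr[OF ne(2)] by simp_all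
  have "mono C e"
  proof (rule monoI[of e "Dom C e" "Cod C e"])
    fix W a b assume ab: "a \<in> hom C W (Dom C e)" "b \<in> hom C W (Dom C e)" "e \<cdot> a = e \<cdot> b"
    have "(n \<cdot> e) \<cdot> a = (n \<cdot> e) \<cdot> b" using ab ar ne(3) by simp
    then show "a = b"
      by (rule mono_cancel[OF m[unfolded ne(4)]]) (use ab(1,2) ar ne(3) in simp_all)
  qed (use ar in simp)
  moreover have "factors e e" using ar by (intro factorsI[of "Id C (Dom C e)"]) simp_all
  ultimately have "iso C e" by (intro regular_epi_iso[OF re]) simp_all
  then show ?thesis unfolding ne(4) by (rule normal_mono_comp_iso[OF ne(5) _ ne(3)])
qed

end

section \<open>Moore normalization\<close>

context simplicial_objects
begin

abbreviation inc where "inc \<equiv> moore_incl C"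
abbreviation N where "N X k \<equiv> Dom C (inc X k)"

text \<open>In positive degrees \<open>moore_incl\<close> is picked by \<open>SOME\<close> from
  intersections of arbitrarily chosen kernels. Only membership matters, and membership means that
  the faces below \<open>k\<close> vanish; later arguments rest on these four properties. In degree
  0 there is no condition and the identity serves.\<close>

lemma moore_incl:
  assumes X: "X \<in> Obj FC"
  shows moore_incl_hom: "inc X k \<in> hom C (N X k) (FOb X k)"
    and moore_incl_mono: "mono C (inc X k)"
    and face_moore_incl: "i < k \<Longrightarrow> face X k i \<cdot> inc X k = zr (N X k) (FOb X (k - 1))"
    and moore_incl_factors: "\<lbrakk>h \<in> hom C W (FOb X k); \<And>i. i < k \<Longrightarrow> face X k i \<cdot> h = zr W (FOb X (k - 1))\<rbrakk>
      \<Longrightarrow> factors h (inc X k)"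
proof -
  have "inc X k \<in> hom C (N X k) (FOb X k) \<and> mono C (inc X k) \<and>
    (\<forall>i<k. face X k i \<cdot> inc X k = zr (N X k) (FOb X (k - 1))) \<and>
    (\<forall>W h. h \<in> hom C W (FOb X k) \<longrightarrow> (\<forall>i<k. face X k i \<cdot> h = zr W (FOb X (k - 1))) \<longrightarrow> factors h (inc X k))"
  proof (cases "k = 0")
    case True
    have "mono C (Id C (FOb X 0))" by (rule monoI[of _ "FOb X 0" "FOb X 0"]) (use X in simp_all)
    moreover have "factors h (Id C (FOb X 0))" if "h \<in> hom C W (FOb X 0)" for W h
      by (rule factorsI[of h]) (use that X in simp_all)
    ultimately show ?thesis using True X by (simp add: moore_incl_def)
  next
    case False
    have face: "face X k i \<in> hom C (FOb X k) (FOb X (k - 1))" if "i < k" for i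
      using X that by simp
    let ?P = "\<lambda>m \<kappa>. (\<forall>i<k. is_kernel C (face X k i) (\<kappa> i)) \<and> is_intersection C (FOb X k) (\<kappa> ` {..<k}) m"
    \<comment> \<open>Factoring through any kernel of a face means being killed by that face, so the
      chosen \<open>\<kappa>\<close> disappears from the description.\<close>
    have kerf: "(\<exists>u\<in>hom C (Dom C h) (Dom C c). h = c \<cdot> u) \<longleftrightarrow> face X k i \<cdot> h = zr (Dom C h) (FOb X (k - 1))"
      if c: "is_kernel C (face X k i) c" and i: "i < k" and h: "h \<in> Arr C" "Cod C h = FOb X k" for c i h
    proof
      have ar: "c \<in> hom C (Dom C c) (FOb X k)" "face X k i \<cdot> c = zr (Dom C c) (FOb X (k - 1))"
        using kernel_arr[OF c] face[OF i] by simp_all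
      assume "\<exists>u\<in>hom C (Dom C h) (Dom C c). h = c \<cdot> u"
      then obtain u where u: "u \<in> hom C (Dom C h) (Dom C c)" "c \<cdot> u = h" by blast
      have "face X k i \<cdot> (c \<cdot> u) = zr (Dom C h) (FOb X (k - 1))"
        using comp_assoc_eq'[OF ar(2), of u] ar(1) face[OF i] u(1) X by simp
      then show "face X k i \<cdot> h = zr (Dom C h) (FOb X (k - 1))" unfolding u(2) .
    next
      assume 0: "face X k i \<cdot> h = zr (Dom C h) (FOb X (k - 1))"
      have "\<exists>u. u \<in> hom C (Dom C h) (Dom C c) \<and> c \<cdot> u = h"
        by (rule kernel_lift[OF c face[OF i] _ _ 0]) (use kernel_arr[OF c] face[OF i] h in simp_all)
      then show "\<exists>u\<in>hom C (Dom C h) (Dom C c). h = c \<cdot> u" by blast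
    qed
    \<comment> \<open>The choice is meaningful only once a candidate exists: the joint kernel of the
      finitely many faces is an intersection of their kernels.\<close>
    have "\<exists>m \<kappa>. ?P m \<kappa>"
    proof -
      have "\<exists>\<kappa>. is_kernel C (face X k i) \<kappa>" if "i < k" for i
        by (rule kernel_ex[OF face[OF that]]) blast
      then obtain \<kappa> where \<kappa>: "\<And>i. i < k \<Longrightarrow> is_kernel C (face X k i) (\<kappa> i)" by metis
      have fin: "finite (face X k ` {..<k})" "FOb X k \<in> Obj C"
          "\<And>s. s \<in> face X k ` {..<k} \<Longrightarrow> s \<in> Arr C \<and> Dom C s = FOb X k"
        using X face by auto
      obtain K m where m: "m \<in> hom C K (FOb X k)" "normal_mono C m"
          and m0: "\<And>s. s \<in> face X k ` {..<k} \<Longrightarrow> s \<cdot> m = zr K (Cod C s)"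
          and mf: "\<And>W h. \<lbrakk>h \<in> hom C W (FOb X k); \<And>s. s \<in> face X k ` {..<k} \<Longrightarrow> s \<cdot> h = zr W (Cod C s)\<rbrakk> \<Longrightarrow> factors h m"
        using finite_joint_kernel[OF fin] by metis
      have mm: "mono C m" using m(2) kernel_mono unfolding normal_mono_def by blast
      have "is_intersection C (FOb X k) (\<kappa> ` {..<k}) m"
        unfolding is_intersection_def
      proof (intro conjI ballI impI)
        show "m \<in> Arr C" "Cod C m = FOb X k" using m(1) by simp_all
        fix s assume "s \<in> \<kappa> ` {..<k}"
        then obtain i where i: "i < k" "s = \<kappa> i" by blast
        have "face X k i \<cdot> m = zr (Dom C m) (FOb X (k - 1))" using m0[of "face X k i"] i face[OF i(1)] m(1) by auto
        then show "\<exists>u\<in>hom C (Dom C m) (Dom C s). m = s \<cdot> u"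
          using kerf[OF \<kappa>[OF i(1)] i(1), of m] m(1) i(2) by simp
      next
        fix h assume h: "h \<in> Arr C" "Cod C h = FOb X k \<and> (\<forall>s\<in>\<kappa> ` {..<k}. \<exists>u\<in>hom C (Dom C h) (Dom C s). h = s \<cdot> u)"
        have "face X k i \<cdot> h = zr (Dom C h) (FOb X (k - 1))" if "i < k" for i
          using kerf[OF \<kappa>[OF that] that h(1)] h(2) that by blast
        then have "factors h m"
          using h face by (intro mf[of h "Dom C h"]) auto
        then obtain v where v: "v \<in> hom C (Dom C h) (Dom C m)" "m \<cdot> v = h" by (rule factorsE)
        show "\<exists>!v. v \<in> hom C (Dom C h) (Dom C m) \<and> m \<cdot> v = h"
        proof (rule ex1I[of _ v])
          fix w assume w: "w \<in> hom C (Dom C h) (Dom C m) \<and> m \<cdot> w = h"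
          then have "m \<cdot> w = m \<cdot> v" using v(2) by simp
          then show "w = v" by (rule mono_cancel[OF mm]) (use w v(1) in simp_all)
        qed (use v in blast)
      qed
      then show ?thesis using \<kappa> by blast
    qed
    then have "\<exists>\<kappa>. ?P (inc X k) \<kappa>"
      using someI_ex[of "\<lambda>m. \<exists>\<kappa>. ?P m \<kappa>"] False unfolding moore_incl_def by simp
    then obtain \<kappa> where \<kappa>: "\<And>i. i < k \<Longrightarrow> is_kernel C (face X k i) (\<kappa> i)"
      and int: "is_intersection C (FOb X k) (\<kappa> ` {..<k}) (inc X k)" by blast
    have hom: "inc X k \<in> hom C (N X k) (FOb X k)" using int unfolding is_intersection_def by simp
    have fac: "\<exists>!v. v \<in> hom C W (N X k) \<and> inc X k \<cdot> v = h"
      if h: "h \<in> hom C W (FOb X k)" "\<And>i. i < k \<Longrightarrow> face X k i \<cdot> h = zr W (FOb X (k - 1))" for W h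
    proof -
      have "\<forall>s\<in>\<kappa> ` {..<k}. \<exists>u\<in>hom C (Dom C h) (Dom C s). h = s \<cdot> u"
        using kerf[OF \<kappa>, of _ h] h by auto
      moreover have "h \<in> Arr C" "Cod C h = FOb X k" "Dom C h = W" using h(1) by simp_all
      ultimately show ?thesis using int unfolding is_intersection_def by blast
    qed
    have f0: "face X k i \<cdot> inc X k = zr (N X k) (FOb X (k - 1))" if i: "i < k" for i
    proof -
      have "\<exists>u\<in>hom C (N X k) (Dom C (\<kappa> i)). inc X k = \<kappa> i \<cdot> u"
        using int i unfolding is_intersection_def by blast
      then show ?thesis using kerf[OF \<kappa>[OF i] i, of "inc X k"] hom by simp
    qed
    have "mono C (inc X k)"
    proof (rule monoI[OF hom])
      fix W a b assume ab: "a \<in> hom C W (N X k)" "b \<in> hom C W (N X k)" "inc X k \<cdot> a = inc X k \<cdot> b"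
      have "face X k i \<cdot> (inc X k \<cdot> b) = zr W (FOb X (k - 1))" if "i < k" for i
        using comp_assoc_eq'[OF f0[OF that], of b] ab(2) hom face[OF that] X by simp
      moreover have "inc X k \<cdot> b \<in> hom C W (FOb X k)" using ab(2) hom by simp
      ultimately have "\<exists>!v. v \<in> hom C W (N X k) \<and> inc X k \<cdot> v = inc X k \<cdot> b" by (intro fac)
      then show "a = b" using ab by blast
    qed
    moreover have "factors h (inc X k)"
      if "h \<in> hom C W (FOb X k)" "\<And>i. i < k \<Longrightarrow> face X k i \<cdot> h = zr W (FOb X (k - 1))" for W h
    proof -
      have "Dom C h = W" using that(1) by simp
      then show ?thesis using fac[OF that] unfolding factors_def by blast
    qed
    ultimately show ?thesis using hom f0 by blast
  qed
  then show "inc X k \<in> hom C (N X k) (FOb X k)" "mono C (inc X k)"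
    "i < k \<Longrightarrow> face X k i \<cdot> inc X k = zr (N X k) (FOb X (k - 1))"
    "\<lbrakk>h \<in> hom C W (FOb X k); \<And>i. i < k \<Longrightarrow> face X k i \<cdot> h = zr W (FOb X (k - 1))\<rbrakk>
      \<Longrightarrow> factors h (inc X k)"
    by blast+
qed

lemma moore_incl_arr [simp]:
  assumes "X \<in> Obj FC"
  shows "inc X k \<in> Arr C" "Cod C (inc X k) = FOb X k" "N X k \<in> Obj C"
  using moore_incl_hom[OF assms, of k] Dom_in[of "inc X k"] by simp_all

lemma moore_incl_cancel:
  assumes "X \<in> Obj FC" "inc X k \<cdot> a = inc X k \<cdot> b" "a \<in> hom C W (N X k)" "b \<in> hom C W (N X k)"
  shows "a = b"
  by (rule mono_cancel[OF moore_incl_mono[OF assms(1)] assms(2)]) (use assms(3,4) in simp_all)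

lemma moore_lift:
  assumes X: "X \<in> Obj FC" and h: "h \<in> hom C W (FOb X k)"
    "\<And>i. i < k \<Longrightarrow> face X k i \<cdot> h = zr W (FOb X (k - 1))"
  shows "\<exists>u. u \<in> hom C W (N X k) \<and> inc X k \<cdot> u = h"
  by (rule factors_lift[OF moore_incl_factors[OF X h] h(1) moore_incl_hom[OF X]])

lemma face_moore_incl_comp:
  assumes X: "X \<in> Obj FC" and "i < k" "u \<in> hom C W (N X k)"
  shows "face X k i \<cdot> (inc X k \<cdot> u) = zr W (FOb X (k - 1))"
  using comp_assoc_eq'[OF face_moore_incl[OF X assms(2)], of u] assms X by simp

lemma moore_incl_normal_mono:
  assumes X: "X \<in> Obj FC"
  shows "normal_mono C (inc X k)"
proof (rule joint_kernel_normal_mono[of "face X k ` {..<k}" "FOb X k" _ "N X k"])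
  fix W h
  assume h: "h \<in> hom C W (FOb X k)" "\<And>s. s \<in> face X k ` {..<k} \<Longrightarrow> s \<cdot> h = zr W (Cod C s)"
  have "face X k i \<cdot> h = zr W (FOb X (k - 1))" if "i < k" for i
    using h(2)[of "face X k i"] that X by simp
  then show "factors h (inc X k)" by (rule moore_incl_factors[OF X h(1)])
qed (use X moore_incl_mono[OF X] face_moore_incl[OF X] in auto)

lemma moore_diff:
  assumes X: "X \<in> Obj FC" and k: "1 \<le> k"
  shows moore_diff_hom: "moore_diff C X k \<in> hom C (N X k) (N X (k - 1))"
    and moore_incl_diff: "inc X (k - 1) \<cdot> moore_diff C X k = face X k k \<cdot> inc X k"
proof -
  \<comment> \<open>The simplicial identity moves the face of index i to the inside, where it kills
    \<open>inc X k\<close>. For k = 1 the range of i is empty.\<close>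
  have "face X (k - 1) i \<cdot> (face X k k \<cdot> inc X k) = zr (N X k) (FOb X (k - 1 - 1))" if i: "i < k - 1" for i
  proof -
    have "face X (k - 1) i \<cdot> (face X k k \<cdot> inc X k) = face X (k - 1) (k - 1) \<cdot> (face X k i \<cdot> inc X k)"
      by (rule comp_assoc_eq[OF face_face[OF X]]) (use X i in simp_all)
    also have "\<dots> = zr (N X k) (FOb X (k - 1 - 1))"
      using face_moore_incl[OF X, of i k] i X by simp
    finally show ?thesis .
  qed
  then have "\<exists>u. u \<in> hom C (N X k) (N X (k - 1)) \<and> inc X (k - 1) \<cdot> u = face X k k \<cdot> inc X k"
    by (intro moore_lift[OF X]) (use X k in simp_all)
  then have "\<exists>!u. u \<in> hom C (N X k) (N X (k - 1)) \<and> inc X (k - 1) \<cdot> u = face X k k \<cdot> inc X k"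
    using moore_incl_cancel[OF X] by metis
  from theI'[OF this] show "moore_diff C X k \<in> hom C (N X k) (N X (k - 1))"
    "inc X (k - 1) \<cdot> moore_diff C X k = face X k k \<cdot> inc X k"
    unfolding moore_diff_def by blast+
qed

lemma moore_diff_arr [simp]:
  assumes "X \<in> Obj FC" "1 \<le> k"
  shows "moore_diff C X k \<in> Arr C" "Dom C (moore_diff C X k) = N X k" "Cod C (moore_diff C X k) = N X (k - 1)"
  using moore_diff_hom[OF assms] by simp_all

lemma moore_Term_nat [simp]: "Term (moore_ob C X) (int k) = N X k"
  by (simp add: moore_ob_def moore_term_def)

lemma moore_Term_neg [simp]: "i < 0 \<Longrightarrow> Term (moore_ob C X) i = some_zero C"
  by (simp add: moore_ob_def moore_term_def)

lemma moore_Term_Obj [simp]: "X \<in> Obj FC \<Longrightarrow> Term (moore_ob C X) i \<in> Obj C"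
  by (cases i) simp_all

lemma moore_Diff_nat: "1 \<le> k \<Longrightarrow> Diff (moore_ob C X) (int k) = moore_diff C X k"
  by (simp add: moore_ob_def)

lemma moore_Diff_nonpos:
  "i \<le> 0 \<Longrightarrow> Diff (moore_ob C X) i = zr (Term (moore_ob C X) i) (Term (moore_ob C X) (i - 1))"
  by (simp add: moore_ob_def)

text \<open>Complexes are indexed by integers and simplicial degrees by naturals; the predecessor is
  rewritten along with \<open>i\<close> so that \<open>i - 1\<close> matches
  \<open>int (k - 1)\<close>.\<close>

lemma pos_int_nat:
  fixes i :: int
  assumes "\<not> i \<le> 0"
  obtains k where "i = int k" "1 \<le> k" "i - 1 = int (k - 1)"
  by (rule that[of "nat i"]) (use assms in auto)

lemma moore_Diff_hom:
  assumes X: "X \<in> Obj FC"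
  shows "Diff (moore_ob C X) i \<in> hom C (Term (moore_ob C X) i) (Term (moore_ob C X) (i - 1))"
proof (cases "i \<le> 0")
  case True
  then show ?thesis using X by (simp add: moore_Diff_nonpos del: moore_Term_neg)
next
  case False
  then obtain k where k: "i = int k" "1 \<le> k" "i - 1 = int (k - 1)" by (rule pos_int_nat)
  show ?thesis unfolding k(3) unfolding k(1) moore_Diff_nat[OF k(2)] moore_Term_nat
    by (rule moore_diff_hom[OF X k(2)])
qed

text \<open>The simplicial identity turns d_k d_(k+1) into d_k d_k, whose inner d_k is not the last
  face in degree k + 1 and so vanishes on the Moore object.\<close>

lemma moore_diff_diff:
  assumes X: "X \<in> Obj FC" and k: "1 \<le> k"
  shows "moore_diff C X k \<cdot> moore_diff C X (k + 1) = zr (N X (k + 1)) (N X (k - 1))"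
proof (rule moore_incl_cancel[OF X])
  have d: "moore_diff C X (k + 1) \<in> Arr C" "Dom C (moore_diff C X (k + 1)) = N X (k + 1)"
      "Cod C (moore_diff C X (k + 1)) = N X k"
    using moore_diff_hom[OF X, of "k + 1"] by simp_all
  have "inc X (k - 1) \<cdot> (moore_diff C X k \<cdot> moore_diff C X (k + 1)) = face X k k \<cdot> (inc X k \<cdot> moore_diff C X (k + 1))"
    by (rule comp_assoc_eq[OF moore_incl_diff[OF X k]]) (use X k d in simp_all)
  also have "\<dots> = face X k k \<cdot> (face X (k + 1) (k + 1) \<cdot> inc X (k + 1))"
    using moore_incl_diff[OF X, of "k + 1"] by simp
  also have "\<dots> = face X k k \<cdot> (face X (k + 1) k \<cdot> inc X (k + 1))"
    by (rule comp_assoc_eq) (use face_face[OF X, of "k + 1" k] X k in simp_all)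
  also have "\<dots> = zr (N X (k + 1)) (FOb X (k - 1))"
    using face_moore_incl[OF X, of k "k + 1"] X k by simp
  finally show "inc X (k - 1) \<cdot> (moore_diff C X k \<cdot> moore_diff C X (k + 1)) = inc X (k - 1) \<cdot> zr (N X (k + 1)) (N X (k - 1))"
    using X by simp
  show "moore_diff C X k \<cdot> moore_diff C X (k + 1) \<in> hom C (N X (k + 1)) (N X (k - 1))"
    using X k d by simp
qed (use X in simp)

lemma moore_ob_cpx:
  assumes X: "X \<in> Obj FC"
  shows "is_cpx C (moore_ob C X)"
proof -
  let ?M = "moore_ob C X"
  have D: "Diff ?M i \<in> Arr C" "Dom C (Diff ?M i) = Term ?M i" "Cod C (Diff ?M i) = Term ?M (i - 1)" for i
    using moore_Diff_hom[OF X, of i] by simp_all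
  have "zero_arr C (Diff ?M i \<cdot> Diff ?M (i + 1))" for i
  proof -
    have "Diff ?M i \<cdot> Diff ?M (i + 1) = zr (Term ?M (i + 1)) (Term ?M (i - 1))"
    proof (cases "i \<le> 0")
      case True
      then show ?thesis using D[of "i + 1"] X by (simp add: moore_Diff_nonpos del: moore_Term_neg)
    next
      case False
      then obtain k where k: "i = int k" "1 \<le> k" "i - 1 = int (k - 1)" by (rule pos_int_nat)
      have k1: "i + 1 = int (k + 1)" using k by simp
      show ?thesis
        unfolding k1 k(3) unfolding k(1) moore_Term_nat moore_Diff_nat[OF k(2)]
        using moore_diff_diff[OF X k(2)] moore_Diff_nat[of "k + 1" X] by simp
    qed
    then show ?thesis using zr_zero_arr(2) X by simp
  qed
  then show ?thesis using moore_Diff_hom[OF X] moore_Term_Obj[OF X] unfolding is_cpx_def by blast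
qed

text \<open>The differential is the restriction of the split epimorphism \<open>d\<^sub>k\<close> to the normal subobject
  \<open>N(X)\<^sub>k\<close>, so its image is normal already in \<open>X\<^sub>k\<^sub>-\<^sub>1\<close>.\<close>

lemma moore_ob_proper:
  assumes X: "X \<in> Obj FC"
  shows "proper C (moore_ob C X)"
  unfolding proper_def
proof (intro conjI allI moore_ob_cpx[OF X])
  fix i
  show "\<exists>m e. normal_epi C e \<and> mono C m \<and> Cod C e = Dom C m \<and> Diff (moore_ob C X) i = m \<cdot> e \<and> normal_mono C m"
  proof (cases "i \<le> 0")
    case True
    \<comment> \<open>At and below degree 0 the target is the chosen zero object, so the
      differential itself is the epic part and the identity is the image.\<close>
    let ?Z = "some_zero C" and ?e = "Diff (moore_ob C X) i"
    have e: "?e \<in> hom C (Term (moore_ob C X) i) ?Z" using moore_Diff_hom[OF X, of i] True by simp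
    then have "normal_epi C ?e" by (intro regular_epi_normal to_zero_regular_epi[OF some_zero])
    moreover have "normal_mono C (Id C ?Z)" by (rule id_normal_mono) simp
    moreover have "mono C (Id C ?Z)" by (rule monoI[of _ ?Z ?Z]) simp_all
    ultimately show ?thesis using e by (intro exI[of _ "Id C ?Z"] exI[of _ ?e]) simp
  next
    case False
    then obtain k where k: "i = int k" "1 \<le> k" by (rule pos_int_nat)
    let ?d = "moore_diff C X k"
    obtain q where q: "is_kernel C q (inc X k)"
      using moore_incl_normal_mono[OF X] unfolding normal_mono_def by blast
    have face: "face X k k \<in> hom C (FOb X k) (FOb X (k - 1))" using X k by simp
    obtain L e m where em: "e \<in> hom C (N X k) L" "m \<in> hom C L (FOb X (k - 1))" "regular_epi C e"
        "normal_mono C m" "face X k k \<cdot> inc X k = m \<cdot> e"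
      by (rule normal_mono_direct_image[OF q moore_incl_hom[OF X] face last_face_regular_epi[OF X k(2)]])
    obtain p where p: "is_kernel C p m" using em(4) unfolding normal_mono_def by blast
    have pa: "p \<in> hom C (FOb X (k - 1)) (Cod C p)" "p \<cdot> m = zr L (Cod C p)"
      using kernel_arr[OF p] em(2) by simp_all
    have "inc X (k - 1) \<cdot> ?d = m \<cdot> e" using moore_incl_diff[OF X k(2)] em(5) by simp
    \<comment> \<open>The image was formed in X_(k-1), where the last face is a regular epimorphism;
      diagonal lifting moves it into N(X)_(k-1).\<close>
    then obtain d where d: "d \<in> hom C L (N X (k - 1))" "d \<cdot> e = ?d" "inc X (k - 1) \<cdot> d = m"
      using regular_epi_lift[OF em(3,1) moore_incl_mono[OF X] moore_incl_hom[OF X]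
          moore_diff_hom[OF X k(2)] em(2)] by blast
    have md: "mono C d"
    proof (rule monoI[OF d(1)])
      fix W a b assume ab: "a \<in> hom C W L" "b \<in> hom C W L" "d \<cdot> a = d \<cdot> b"
      have "m \<cdot> a = inc X (k - 1) \<cdot> (d \<cdot> a)" "m \<cdot> b = inc X (k - 1) \<cdot> (d \<cdot> b)"
        using comp_assoc_eq'[OF d(3), of a] comp_assoc_eq'[OF d(3), of b] d(1) ab(1,2) X by simp_all
      then have "m \<cdot> a = m \<cdot> b" using ab(3) by simp
      then show "a = b" by (rule mono_cancel[OF kernel_mono[OF p]]) (use ab(1,2) em(2) in simp_all)
    qed
    \<comment> \<open>Inside the Moore object the image is the restriction of the normal subobject
      \<open>m\<close>, hence the kernel of the restriction of \<open>p\<close>.\<close>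
    have "is_kernel C (p \<cdot> inc X (k - 1)) d"
    proof (rule kernelI[OF _ d(1) _ md])
      show "p \<cdot> inc X (k - 1) \<in> hom C (N X (k - 1)) (Cod C p)" using pa X by simp
      show "(p \<cdot> inc X (k - 1)) \<cdot> d = zr L (Cod C p)" using pa d X by simp
      fix W h assume h: "h \<in> hom C W (N X (k - 1))" "(p \<cdot> inc X (k - 1)) \<cdot> h = zr W (Cod C p)"
      have "inc X (k - 1) \<cdot> h \<in> hom C W (FOb X (k - 1))" "p \<cdot> (inc X (k - 1) \<cdot> h) = zr W (Cod C p)"
        using h pa(1) X by simp_all
      then obtain u where u: "u \<in> hom C W L" "m \<cdot> u = inc X (k - 1) \<cdot> h"
        using kernel_lift[OF p pa(1) em(2)] by blast
      have "inc X (k - 1) \<cdot> (d \<cdot> u) = inc X (k - 1) \<cdot> h"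
        using comp_assoc_eq'[OF d(3), of u] u d(1) X by simp
      then have "d \<cdot> u = h" by (rule moore_incl_cancel[OF X, of _ _ _ W]) (use u(1) d(1) h(1) in simp_all)
      then show "factors h d" by (intro factorsI[of u]) (use u(1) d(1) h(1) in simp_all)
    qed
    then have "normal_mono C d" unfolding normal_mono_def by blast
    moreover have "normal_epi C e" by (rule regular_epi_normal[OF em(3)])
    ultimately show ?thesis
      unfolding k(1) moore_Diff_nat[OF k(2)]
      using d em(1) md by (intro exI[of _ d] exI[of _ e]) simp
  qed
qed

lemma moore_pch: "X \<in> Obj FC \<Longrightarrow> moore_ob C X \<in> Obj (pch C)"
  by (simp add: pch_def full_subcat_def ch_Obj moore_ob_cpx moore_ob_proper)

section \<open>Moore normalization of simplicial morphisms\<close>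

lemma moore_arr_component:
  assumes a: "(X, Y, \<alpha>) \<in> Arr FC"
  shows "\<exists>!g. g \<in> hom C (N X k) (N Y k) \<and> inc Y k \<cdot> g = \<alpha> k \<cdot> inc X k"
proof -
  note ob = trans_Obj(1,2)[OF a]
  have ak: "\<alpha> j \<in> Arr C" "Dom C (\<alpha> j) = FOb X j" "Cod C (\<alpha> j) = FOb Y j" for j
    using transD[OF a, of j] by simp_all
  have "face Y k i \<cdot> (\<alpha> k \<cdot> inc X k) = zr (N X k) (FOb Y (k - 1))" if i: "i < k" for i
  proof -
    have "face Y k i \<cdot> (\<alpha> k \<cdot> inc X k) = \<alpha> (k - 1) \<cdot> (face X k i \<cdot> inc X k)"
      by (rule comp_assoc_eq[OF trans_face[OF a, symmetric]]) (use i ob ak in simp_all)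
    also have "\<dots> = zr (N X k) (FOb Y (k - 1))" using face_moore_incl[OF ob(1) i] ob ak by simp
    finally show ?thesis .
  qed
  then have "\<exists>g. g \<in> hom C (N X k) (N Y k) \<and> inc Y k \<cdot> g = \<alpha> k \<cdot> inc X k"
    by (intro moore_lift[OF ob(2)]) (use ob ak in simp_all)
  then show ?thesis using moore_incl_cancel[OF ob(2)] by metis
qed

text \<open>Trades the \<open>THE\<close> in \<open>moore_arr\<close> for components characterized
  by the inclusions. Compatibility with positive differentials is checked after composing with a
  monic inclusion; at and below degree 0 the differentials are zero.\<close>

lemma moore_arr_chain_map:
  assumes a: "(X, Y, \<alpha>) \<in> Arr FC"
  obtains g where "moore_arr C (X, Y, \<alpha>) = (moore_ob C X, moore_ob C Y, g)"
    "(moore_ob C X, moore_ob C Y, g) \<in> Arr (ch C)"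
    "\<And>k. inc Y k \<cdot> g (int k) = \<alpha> k \<cdot> inc X k"
proof -
  note ob = trans_Obj(1,2)[OF a]
  have ak: "\<alpha> j \<in> Arr C" "Dom C (\<alpha> j) = FOb X j" "Cod C (\<alpha> j) = FOb Y j" for j
    using transD[OF a, of j] by simp_all
  define g where "g = (\<lambda>i. if i < 0 then zr (some_zero C) (some_zero C)
         else (THE g. g \<in> hom C (moore_term C X i) (moore_term C Y i) \<and>
                 inc Y (nat i) \<cdot> g = \<alpha> (nat i) \<cdot> inc X (nat i)))"
  have 1: "moore_arr C (X, Y, \<alpha>) = (moore_ob C X, moore_ob C Y, g)"
    by (simp add: moore_arr_def g_def)
  have "g (int k) = (THE g. g \<in> hom C (N X k) (N Y k) \<and> inc Y k \<cdot> g = \<alpha> k \<cdot> inc X k)" for k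
    by (simp add: g_def moore_term_def)
  then have gk: "g (int k) \<in> hom C (N X k) (N Y k)" "inc Y k \<cdot> g (int k) = \<alpha> k \<cdot> inc X k" for k
    using theI'[OF moore_arr_component[OF a, of k]] by auto
  have gi: "g i \<in> hom C (Term (moore_ob C X) i) (Term (moore_ob C Y) i)" for i
  proof (cases "i < 0")
    case False
    then obtain k where "i = int k" by (metis nonneg_int_cases not_less)
    then show ?thesis using gk(1)[of k] by simp
  qed (simp add: g_def)
  have gr: "g i \<in> Arr C" "Dom C (g i) = Term (moore_ob C X) i" "Cod C (g i) = Term (moore_ob C Y) i" for i
    using gi[of i] by simp_all
  note DX = cpx_Diff[OF moore_ob_cpx[OF ob(1)]] and DY = cpx_Diff[OF moore_ob_cpx[OF ob(2)]]
  have "(moore_ob C X, moore_ob C Y, g) \<in> Arr (ch C)"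
  proof (rule chain_mapI[OF moore_ob_cpx[OF ob(1)] moore_ob_cpx[OF ob(2)] gi])
    fix i
    show "Diff (moore_ob C Y) i \<cdot> g i = g (i - 1) \<cdot> Diff (moore_ob C X) i"
    proof (cases "i \<le> 0")
      case True
      then show ?thesis
        using gr[of i] gr[of "i - 1"] ob by (simp add: moore_Diff_nonpos del: moore_Term_neg)
    next
      case False
      then obtain k where k: "i = int k" "1 \<le> k" "i - 1 = int (k - 1)" by (rule pos_int_nat)
      have g1: "g (int k) \<in> Arr C" "Dom C (g (int k)) = N X k" "Cod C (g (int k)) = N Y k"
        and g2: "g (int (k - 1)) \<in> Arr C" "Dom C (g (int (k - 1))) = N X (k - 1)" "Cod C (g (int (k - 1))) = N Y (k - 1)"
        using gk(1)[of k] gk(1)[of "k - 1"] by (simp_all del: of_nat_diff)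
      have "inc Y (k - 1) \<cdot> (moore_diff C Y k \<cdot> g (int k)) = face Y k k \<cdot> (inc Y k \<cdot> g (int k))"
        by (rule comp_assoc_eq[OF moore_incl_diff[OF ob(2) k(2)]]) (use k(2) ob g1 in simp_all)
      also have "\<dots> = face Y k k \<cdot> (\<alpha> k \<cdot> inc X k)" by (simp add: gk(2))
      also have "\<dots> = \<alpha> (k - 1) \<cdot> (face X k k \<cdot> inc X k)"
        by (rule comp_assoc_eq[OF trans_face[OF a k(2) order_refl, symmetric]]) (use k(2) ob ak in simp_all)
      also have "\<dots> = \<alpha> (k - 1) \<cdot> (inc X (k - 1) \<cdot> moore_diff C X k)"
        using moore_incl_diff[OF ob(1) k(2)] by simp
      also have "\<dots> = inc Y (k - 1) \<cdot> (g (int (k - 1)) \<cdot> moore_diff C X k)"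
        by (rule comp_assoc_eq[OF gk(2)[symmetric]]) (use k(2) ob ak g2 in \<open>simp_all del: of_nat_diff\<close>)
      finally have "moore_diff C Y k \<cdot> g (int k) = g (int (k - 1)) \<cdot> moore_diff C X k"
        by (rule moore_incl_cancel[OF ob(2), of _ _ _ "N X k"]) (use k(2) ob g1 g2 in \<open>simp_all del: of_nat_diff\<close>)
      then show ?thesis unfolding k(3) unfolding k(1) moore_Diff_nat[OF k(2)] .
    qed
  qed
  then show ?thesis using that 1 gk(2) by blast
qed

end

section \<open>The torsion theories\<close>

context simplicial_objects
begin

text \<open>A map \<open>[l] \<rightarrow> [j]\<close> with \<open>l \<le> n\<close> misses one of any \<open>n + 2\<close> elements, so it factors through a coface.\<close>

lemma FAr_vanish:
  assumes X: "X \<in> Obj FC" and h: "h \<in> hom C W (FOb X j)"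
    and I: "I \<subseteq> {..j}" "card I > n + 1" "\<And>i. i \<in> I \<Longrightarrow> face X j i \<cdot> h = zr W (FOb X (j - 1))"
    and t: "(l, j, \<theta>) \<in> Arr simplex_cat" "l \<le> n"
  shows "FAr X (l, j, \<theta>) \<cdot> h = zr W (FOb X l)"
proof -
  have W: "W \<in> Obj C" using h by auto
  have "card I \<le> j + 1" using card_mono[OF _ I(1)] by simp
  then have j: "1 \<le> j" using I(2) by simp
  have "card (\<theta> ` {..l}) \<le> l + 1" using card_image_le[of "{..l}" \<theta>] by simp
  then have "\<not> I \<subseteq> \<theta> ` {..l}" using card_mono[of "\<theta> ` {..l}" I] I(2) t(2) by auto
  then obtain i where i: "i \<in> I" "i \<notin> \<theta> ` {..l}" by blast
  have ij: "i \<le> j" using i I(1) by auto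
  obtain f where f: "f \<in> hom C (FOb X (j - 1)) (FOb X l)" "FAr X (l, j, \<theta>) = f \<cdot> face X j i"
    by (rule FAr_factor_face[OF X t(1) j ij i(2)])
  show ?thesis
    unfolding f(2) using I(3)[OF i(1)] f(1) h X j ij W by simp
qed

text \<open>The common kernels of all \<open>X(\<theta>)\<close> with \<open>\<theta> : [l] \<rightarrow> [j]\<close>, \<open>l \<le> n\<close>, form a simplicial subobject
  whose inclusion has the same \<open>n\<close>-truncation as the zero map.\<close>

lemma F_tr_separated:
  assumes adj: "adjunction (Simp C) (Simp_upto n C) (tr n) cosk \<eta> \<epsilon>" and F: "F \<in> F_tr C \<eta>"
    and h: "h \<in> hom C W (FOb F j)"
    and van: "\<And>l \<theta>. \<lbrakk>(l, j, \<theta>) \<in> Arr simplex_cat; l \<le> n\<rbrakk> \<Longrightarrow> FAr F (l, j, \<theta>) \<cdot> h = zr W (FOb F l)"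
  shows "h = zr W (FOb F j)"
proof -
  have FF: "F \<in> Obj FC" and mono: "mono FC (\<eta> F)" using F by (simp_all add: F_tr_def Simp_FC)
  \<comment> \<open>All operators out of degree k into degrees up to n. There are finitely many, so
    their joint kernel exists.\<close>
  define S where "S k = (\<lambda>(l, \<theta>). FAr F (l, k, \<theta>)) ` {(l, \<theta>). l \<le> n \<and> (l, k, \<theta>) \<in> Arr simplex_cat}" for k
  have S: "s \<in> S k \<longleftrightarrow> (\<exists>l \<theta>. s = FAr F (l, k, \<theta>) \<and> l \<le> n \<and> (l, k, \<theta>) \<in> Arr simplex_cat)" for s k
    by (auto simp: S_def)
  have fin: "finite (S k)" for k
  proof -
    have "{(l, \<theta>). l \<le> n \<and> (l, k, \<theta>) \<in> Arr simplex_cat} \<subseteq> (SIGMA l:{..n}. {..l} \<rightarrow>\<^sub>E {..k})"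
      by (auto simp: simplex_Arr)
    moreover have "finite (SIGMA l:{..n}. {..l} \<rightarrow>\<^sub>E {..k})"
      by (intro finite_SigmaI finite_PiE) simp_all
    ultimately show ?thesis unfolding S_def by (intro finite_imageI) (rule finite_subset)
  qed
  have Sa: "s \<in> Arr C \<and> Dom C s = FOb F k" if "s \<in> S k" for s k
    using that simp_ar[OF FF] unfolding S by fastforce
  have "\<exists>K m. m \<in> hom C K (FOb F k) \<and> normal_mono C m \<and> (\<forall>s\<in>S k. s \<cdot> m = zr K (Cod C s)) \<and>
      (\<forall>W h. h \<in> hom C W (FOb F k) \<longrightarrow> (\<forall>s\<in>S k. s \<cdot> h = zr W (Cod C s)) \<longrightarrow> factors h m)" for k
    by (rule finite_joint_kernel[OF fin[of k] simp_ob[OF FF, of k] Sa], assumption) blast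
  then obtain K m where m: "\<And>k. m k \<in> hom C (K k) (FOb F k)" "\<And>k. normal_mono C (m k)"
    and m0: "\<And>k s. s \<in> S k \<Longrightarrow> s \<cdot> m k = zr (K k) (Cod C s)"
    and mf: "\<And>k W h. \<lbrakk>h \<in> hom C W (FOb F k); \<forall>s\<in>S k. s \<cdot> h = zr W (Cod C s)\<rbrakk> \<Longrightarrow> factors h (m k)"
    by metis
  have mm: "mono C (m k)" for k using m(2)[of k] kernel_mono unfolding normal_mono_def by blast
  have m0': "FAr F (l, k, \<theta>) \<cdot> m k = zr (K k) (FOb F l)" if t: "l \<le> n" "(l, k, \<theta>) \<in> Arr simplex_cat" for l k \<theta>
  proof -
    have "FAr F (l, k, \<theta>) \<in> S k" using t unfolding S by blast
    then show ?thesis using m0[of _ k] simp_ar[OF FF t(2)] by simp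
  qed
  have stable: "factors (FAr F \<theta> \<cdot> m (Dom (op_cat simplex_cat) \<theta>)) (m (Cod (op_cat simplex_cat) \<theta>))"
    if "\<theta> \<in> Arr (op_cat simplex_cat)" for \<theta>
  proof -
    obtain a b t where t: "\<theta> = (a, b, t)" by (cases \<theta>)
    then have tA: "(a, b, t) \<in> Arr simplex_cat" using that by simp
    have Ft: "FAr F (a, b, t) \<in> hom C (FOb F b) (FOb F a)" by (rule simp_ar[OF FF tA])
    have "factors (FAr F (a, b, t) \<cdot> m b) (m a)"
    proof (rule mf[of _ "K b"])
      show "FAr F (a, b, t) \<cdot> m b \<in> hom C (K b) (FOb F a)" using Ft m(1)[of b] by simp
      show "\<forall>s\<in>S a. s \<cdot> (FAr F (a, b, t) \<cdot> m b) = zr (K b) (Cod C s)"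
      proof
        fix s assume "s \<in> S a"
        then obtain l u where u: "s = FAr F (l, a, u)" "l \<le> n" "(l, a, u) \<in> Arr simplex_cat"
          unfolding S by blast
        have Fu: "FAr F (l, a, u) \<in> hom C (FOb F a) (FOb F l)" by (rule simp_ar[OF FF u(3)])
        \<comment> \<open>Stability of the joint kernels: an operator followed by one into a degree
          at most n is again an operator into a degree at most n.\<close>
        have "FAr F (l, a, u) \<cdot> FAr F (a, b, t) = FAr F (l, b, \<lambda>i\<in>{..l}. t (u i))"
          using simp_comp[OF FF u(3) tA] by simp
        then have "s \<cdot> (FAr F (a, b, t) \<cdot> m b) = FAr F (l, b, \<lambda>i\<in>{..l}. t (u i)) \<cdot> m b"
          unfolding u(1) by (rule comp_assoc_eq') (use Ft Fu m(1)[of b] in simp_all)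
        also have "\<dots> = zr (K b) (FOb F l)" by (rule m0'[OF u(2) simplex_comp_Arr[OF u(3) tA]])
        finally show "s \<cdot> (FAr F (a, b, t) \<cdot> m b) = zr (K b) (Cod C s)" using u(1) Fu by simp
      qed
    qed
    then show ?thesis by (simp add: t)
  qed
  obtain G \<iota> where G: "(G, F, \<iota>) \<in> Arr FC" "\<And>k. FOb G k = K k" "\<And>k. \<iota> k = m k"
    using subfunctor[OF FF m(1) mm stable] by auto
  note GO = trans_Obj(1)[OF G(1)]
  have low: "\<iota> k = zr (FOb G k) (FOb F k)" if k: "k \<le> n" for k
  proof -
    \<comment> \<open>In degrees up to n the identity belongs to the family, so the joint kernel is
      zero there.\<close>
    have "(k, k, \<lambda>i\<in>{..k}. i) \<in> Arr simplex_cat" by (simp add: simplex_Arr monotone_on_def)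
    from m0'[OF k this] have "Id C (FOb F k) \<cdot> m k = zr (K k) (FOb F k)"
      using functor_id[OF FF, of k] by simp
    then show ?thesis using m(1)[of k] G(2,3) by simp
  qed
  let ?z = "(G, F, \<lambda>k\<in>Obj (op_cat simplex_cat). zr (FOb G k) (FOb F k))"
  have z: "?z \<in> Arr FC" using zero_trans_arr[OF GO FF] by (simp add: zero_trans_def)
  have "restrict \<iota> {..n} = restrict (\<lambda>k\<in>Obj (op_cat simplex_cat). zr (FOb G k) (FOb F k)) {..n}"
    using low by (intro restrict_ext) simp
  then have tr: "FAr (tr n) (G, F, \<iota>) = FAr (tr n) ?z" by (simp add: tr_def)
  have nat: "\<eta> A \<in> hom FC A (FOb (comp_funct cosk (tr n)) A)" if "A \<in> Obj FC" for A
    using adj that unfolding adjunction_def nat_trans_def by (simp add: Simp_FC id_funct_def)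
  have sq: "\<eta> (Cod FC f) \<cdot>\<^bsub>FC\<^esub> f = FAr cosk (FAr (tr n) f) \<cdot>\<^bsub>FC\<^esub> \<eta> (Dom FC f)" if "f \<in> Arr FC" for f
    using adj that unfolding adjunction_def nat_trans_def by (simp add: Simp_FC id_funct_def comp_funct_def)
  \<comment> \<open>Naturality of the unit rewrites each composite as \<open>cosk\<close> of a
    truncation after the unit at \<open>G\<close>, and the two truncations agree.\<close>
  have "\<eta> F \<cdot>\<^bsub>FC\<^esub> (G, F, \<iota>) = \<eta> F \<cdot>\<^bsub>FC\<^esub> ?z"
    using sq[OF G(1)] sq[OF z] tr by simp
  then have "(G, F, \<iota>) = ?z"
    by (rule FC.mono_cancel[OF mono]) (use G(1) z nat[OF FF] in simp_all)
  then have "\<iota> j = zr (FOb G j) (FOb F j)" by simp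
  then have mz: "m j = zr (K j) (FOb F j)" using G(2,3) by simp
  \<comment> \<open>By \<open>van\<close> the element \<open>h\<close> lies in the subobject that
    has just been shown to be zero.\<close>
  have "factors h (m j)"
  proof (rule mf[OF h], rule ballI)
    fix s assume "s \<in> S j"
    then obtain l u where u: "s = FAr F (l, j, u)" "l \<le> n" "(l, j, u) \<in> Arr simplex_cat"
      unfolding S by blast
    show "s \<cdot> h = zr W (Cod C s)" unfolding u(1) using van[OF u(3,2)] simp_ar[OF FF u(3)] by simp
  qed
  then obtain u where u: "u \<in> hom C W (K j)" "m j \<cdot> u = h"
    using factors_lift[OF _ h m(1)] by blast
  have "zr (K j) (FOb F j) \<cdot> u = zr W (FOb F j)" using u(1) FF by simp
  then show ?thesis using u(2) mz by simp
qed

text \<open>Subobjects of zero objects are zero, and the negative degrees of a Moore complex vanish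
  by construction.\<close>

lemma moore_T_tr:
  assumes T: "T \<in> T_tr C n"
  shows "moore_ob C T \<in> pch_geq C (int n + 1)"
proof -
  have TO: "T \<in> Obj FC" and T0: "\<And>i. i \<le> n \<Longrightarrow> zero_obj C (FOb T i)"
    using T by (simp_all add: T_tr_def Simp_FC)
  have "zero_obj C (Term (moore_ob C T) i)" if i: "i < int n + 1" for i
  proof (cases "i < 0")
    case True
    then show ?thesis using some_zero by simp
  next
    case False
    then obtain k where k: "i = int k" by (metis nonneg_int_cases not_less)
    have "inc T k = zr (N T k) (FOb T k)"
      by (rule to_zero_obj[OF T0 moore_incl_hom[OF TO]]) (use i k in simp)
    then show ?thesis
      unfolding k moore_Term_nat by (rule zero_mono_zero_obj[OF moore_incl_mono[OF TO] moore_incl_hom[OF TO]])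
  qed
  then show ?thesis using moore_pch[OF TO] by (simp add: pch_geq_def)
qed

text \<open>An element is killed once n + 2 of its faces vanish. Above degree n + 1 the faces before
  the last already number at least n + 2 and vanish on the Moore object. In degree n + 1 there are n
  + 1 of them, and the kernel of the differential adds the last face; so the differential is monic,
  and properness makes it normal.\<close>

lemma moore_F_tr:
  assumes adj: "adjunction (Simp C) (Simp_upto n C) (tr n) cosk \<eta> \<epsilon>" and F: "F \<in> F_tr C \<eta>"
  shows "moore_ob C F \<in> MN C (int n + 1)"
proof -
  have FO: "F \<in> Obj FC" using F by (simp add: F_tr_def Simp_FC)
  have high: "zero_obj C (Term (moore_ob C F) i)" if i: "i > int n + 1" for i
  proof -
    obtain k where k: "i = int k" "k > n + 1"
      using i by (cases i) auto
    have "inc F k = zr (N F k) (FOb F k)"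
    proof (rule F_tr_separated[OF adj F moore_incl_hom[OF FO]])
      fix l \<theta> assume t: "(l, k, \<theta>) \<in> Arr simplex_cat" "l \<le> n"
      show "FAr F (l, k, \<theta>) \<cdot> inc F k = zr (N F k) (FOb F l)"
        by (rule FAr_vanish[OF FO moore_incl_hom[OF FO] _ _ _ t, of "{..<k}"])
          (use k face_moore_incl[OF FO] in auto)
    qed
    then show ?thesis
      unfolding k moore_Term_nat by (rule zero_mono_zero_obj[OF moore_incl_mono[OF FO] moore_incl_hom[OF FO]])
  qed
  let ?d = "moore_diff C F (n + 1)"
  have d: "?d \<in> hom C (N F (n + 1)) (N F n)" "inc F n \<cdot> ?d = face F (n + 1) (n + 1) \<cdot> inc F (n + 1)"
    using moore_diff_hom[OF FO, of "n + 1"] moore_incl_diff[OF FO, of "n + 1"] by simp_all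
  have "mono C ?d"
  proof (rule trivial_kernel_mono[OF d(1)])
    fix W w assume w: "w \<in> hom C W (N F (n + 1))" "?d \<cdot> w = zr W (N F n)"
    then have W: "W \<in> Obj C" by auto
    have iw: "inc F (n + 1) \<cdot> w \<in> hom C W (FOb F (n + 1))" using w(1) FO by simp
    have top: "face F (n + 1) (n + 1) \<cdot> (inc F (n + 1) \<cdot> w) = zr W (FOb F n)"
    proof -
      have "face F (n + 1) (n + 1) \<cdot> (inc F (n + 1) \<cdot> w) = inc F n \<cdot> (?d \<cdot> w)"
        by (rule comp_assoc_eq[OF d(2)[symmetric]]) (use d(1) w(1) FO in simp_all)
      then show ?thesis using w(2) FO W by simp
    qed
    have "inc F (n + 1) \<cdot> w = zr W (FOb F (n + 1))"
    proof (rule F_tr_separated[OF adj F iw])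
      fix l \<theta> assume t: "(l, n + 1, \<theta>) \<in> Arr simplex_cat" "l \<le> n"
      have "face F (n + 1) i \<cdot> (inc F (n + 1) \<cdot> w) = zr W (FOb F (n + 1 - 1))" if "i \<le> n + 1" for i
      proof (cases "i = n + 1")
        case False
        then show ?thesis using that by (intro face_moore_incl_comp[OF FO _ w(1)]) simp
      qed (use top in simp)
      then show "FAr F (l, n + 1, \<theta>) \<cdot> (inc F (n + 1) \<cdot> w) = zr W (FOb F l)"
        by (intro FAr_vanish[OF FO iw _ _ _ t, of "{..n + 1}"]) simp_all
    qed
    then have "inc F (n + 1) \<cdot> w = inc F (n + 1) \<cdot> zr W (N F (n + 1))" using FO W by simp
    then show "w = zr W (N F (n + 1))"
      by (rule moore_incl_cancel[OF FO]) (use w(1) FO W in simp_all)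
  qed
  then have "mono C (Diff (moore_ob C F) (int n + 1))"
    using moore_Diff_nat[of "n + 1" F] by (simp add: add.commute)
  then have "normal_mono C (Diff (moore_ob C F) (int n + 1))"
    by (rule proper_mono_normal_mono[OF moore_ob_proper[OF FO]])
  then show ?thesis using high moore_pch[OF FO] by (simp add: MN_def)
qed

text \<open>An element of N(X)_j killed by \<open>f\<close> lifts to T_j. The faces of the lift
  vanish because they do so after the component of \<open>k\<close> in degree j - 1, which is
  monic.\<close>

lemma moore_kernel:
  assumes q: "(X, F, q) \<in> Arr FC" and k: "(T, X, k) \<in> Arr FC"
    and ker: "\<And>j. is_kernel C (q j) (k j)"
    and f: "f \<in> hom C (N X j) (N F j)" "inc F j \<cdot> f = q j \<cdot> inc X j"
    and g: "g \<in> hom C (N T j) (N X j)" "inc X j \<cdot> g = k j \<cdot> inc T j"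
  shows "is_kernel C f g"
proof -
  note ob = trans_Obj(1,2)[OF q] trans_Obj(1)[OF k]
  have qt: "q i \<in> Arr C" "Dom C (q i) = FOb X i" "Cod C (q i) = FOb F i" for i using transD[OF q, of i] by simp_all
  have kt: "k i \<in> Arr C" "Dom C (k i) = FOb T i" "Cod C (k i) = FOb X i" for i using transD[OF k, of i] by simp_all
  have qk: "q j \<cdot> k j = zr (FOb T j) (FOb F j)" using kernel_arr(4)[OF ker, of j] qt kt by simp
  have km: "mono C (k i)" for i by (rule kernel_mono[OF ker])
  show ?thesis
  proof (rule kernelI[OF f(1) g(1)])
    show "f \<cdot> g = zr (N T j) (N F j)"
    proof (rule moore_incl_cancel[OF ob(2)])
      have "inc F j \<cdot> (f \<cdot> g) = q j \<cdot> (inc X j \<cdot> g)"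
        by (rule comp_assoc_eq[OF f(2)]) (use f(1) g(1) ob qt in simp_all)
      also have "\<dots> = zr (N T j) (FOb F j)"
        unfolding g(2) using comp_assoc_eq'[OF qk, of "inc T j"] qt kt ob by simp
      finally show "inc F j \<cdot> (f \<cdot> g) = inc F j \<cdot> zr (N T j) (N F j)" using ob by simp
    qed (use f(1) g(1) ob in simp_all)
    show "mono C g"
    proof (rule monoI[OF g(1)])
      fix W a b assume ab: "a \<in> hom C W (N T j)" "b \<in> hom C W (N T j)" "g \<cdot> a = g \<cdot> b"
      have "k j \<cdot> (inc T j \<cdot> a) = inc X j \<cdot> (g \<cdot> a)" "k j \<cdot> (inc T j \<cdot> b) = inc X j \<cdot> (g \<cdot> b)"
        by (rule comp_assoc_eq[OF g(2)[symmetric]]; use ab(1,2) g(1) ob kt in simp)+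
      then have "k j \<cdot> (inc T j \<cdot> a) = k j \<cdot> (inc T j \<cdot> b)" using ab(3) by simp
      then have "inc T j \<cdot> a = inc T j \<cdot> b"
        by (rule mono_cancel[OF km]) (use ab(1,2) ob kt in simp_all)
      then show "a = b" by (rule moore_incl_cancel[OF ob(3) _ ab(1,2)])
    qed
    fix W h assume h: "h \<in> hom C W (N X j)" "f \<cdot> h = zr W (N F j)"
    then have W: "W \<in> Obj C" by auto
    have "q j \<cdot> (inc X j \<cdot> h) = inc F j \<cdot> (f \<cdot> h)"
      by (rule comp_assoc_eq[OF f(2)[symmetric]]) (use h f(1) ob qt in simp_all)
    then have "q j \<cdot> (inc X j \<cdot> h) = zr W (FOb F j)" using h(2) W ob by simp
    moreover have "inc X j \<cdot> h \<in> hom C W (FOb X j)" "q j \<in> hom C (FOb X j) (FOb F j)"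
      "k j \<in> hom C (FOb T j) (FOb X j)" using h(1) ob qt kt by simp_all
    ultimately obtain u where u: "u \<in> hom C W (FOb T j)" "k j \<cdot> u = inc X j \<cdot> h"
      using kernel_lift[OF ker] by blast
    have "face T j i \<cdot> u = zr W (FOb T (j - 1))" if i: "i < j" for i
    proof (rule mono_cancel[OF km])
      have "k (j - 1) \<cdot> (face T j i \<cdot> u) = face X j i \<cdot> (k j \<cdot> u)"
        by (rule comp_assoc_eq[OF trans_face[OF k]]) (use i u(1) ob kt in simp_all)
      also have "\<dots> = zr W (FOb X (j - 1))" unfolding u(2) by (rule face_moore_incl_comp[OF ob(1) i h(1)])
      finally show "k (j - 1) \<cdot> (face T j i \<cdot> u) = k (j - 1) \<cdot> zr W (FOb T (j - 1))"
        using kt ob W by simp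
    qed (use i u(1) ob kt W in simp_all)
    then obtain v where v: "v \<in> hom C W (N T j)" "inc T j \<cdot> v = u"
      using moore_lift[OF ob(3) u(1)] by blast
    have "inc X j \<cdot> (g \<cdot> v) = k j \<cdot> (inc T j \<cdot> v)"
      by (rule comp_assoc_eq[OF g(2)]) (use v(1) g(1) ob kt in simp_all)
    then have "inc X j \<cdot> (g \<cdot> v) = inc X j \<cdot> h" using v(2) u(2) by simp
    then have "g \<cdot> v = h" by (rule moore_incl_cancel[OF ob(1)]) (use v(1) g(1) h(1) in simp_all)
    then show "factors h g" by (intro factorsI[of v]) (use v(1) g(1) h(1) in simp_all)
  qed
qed

text \<open>If \<open>q\<close> is monic in degree \<open>j - 1\<close>, then \<open>N(X)\<^sub>j\<close> is the inverse image of \<open>N(F)\<^sub>j\<close> under \<open>q\<^sub>j\<close>.\<close>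

lemma moore_regular_epi:
  assumes q: "(X, F, q) \<in> Arr FC" and re: "regular_epi C (q j)" and m: "1 \<le> j \<Longrightarrow> mono C (q (j - 1))"
    and f: "f \<in> hom C (N X j) (N F j)" "inc F j \<cdot> f = q j \<cdot> inc X j"
  shows "regular_epi C f"
proof -
  note ob = trans_Obj(1,2)[OF q]
  have qt: "q i \<in> Arr C" "Dom C (q i) = FOb X i" "Cod C (q i) = FOb F i" for i using transD[OF q, of i] by simp_all
  have "is_pullback C (inc F j) (q j) f (inc X j)"
  proof (rule pullbackI[OF moore_incl_hom[OF ob(2)] _ f(1) moore_incl_hom[OF ob(1)] f(2)])
    show "q j \<in> hom C (FOb X j) (FOb F j)" using qt by simp
    fix W a b assume ab: "a \<in> hom C W (N F j)" "b \<in> hom C W (FOb X j)" "inc F j \<cdot> a = q j \<cdot> b"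
    then have W: "W \<in> Obj C" by auto
    \<comment> \<open>The faces of \<open>b\<close> are sent to zero by \<open>q (j - 1)\<close>,
      hence are zero by monicity. For j = 0 there are no faces, which is why \<open>m\<close> is
      conditional on \<open>1 \<le> j\<close>.\<close>
    have "face X j i \<cdot> b = zr W (FOb X (j - 1))" if i: "i < j" for i
    proof (rule mono_cancel[OF m])
      have "q (j - 1) \<cdot> (face X j i \<cdot> b) = face F j i \<cdot> (q j \<cdot> b)"
        by (rule comp_assoc_eq[OF trans_face[OF q]]) (use i ab(2) ob qt in simp_all)
      also have "\<dots> = zr W (FOb F (j - 1))"
        unfolding ab(3)[symmetric] by (rule face_moore_incl_comp[OF ob(2) i ab(1)])
      finally show "q (j - 1) \<cdot> (face X j i \<cdot> b) = q (j - 1) \<cdot> zr W (FOb X (j - 1))"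
        using qt ob W by simp
    qed (use i ab(2) ob qt W in simp_all)
    then obtain u where u: "u \<in> hom C W (N X j)" "inc X j \<cdot> u = b"
      using moore_lift[OF ob(1) ab(2)] by blast
    have "inc F j \<cdot> (f \<cdot> u) = q j \<cdot> (inc X j \<cdot> u)"
      by (rule comp_assoc_eq[OF f(2)]) (use u(1) f(1) ob qt in simp_all)
    then have "inc F j \<cdot> (f \<cdot> u) = inc F j \<cdot> a" using u(2) ab(3) by simp
    then have "f \<cdot> u = a" by (rule moore_incl_cancel[OF ob(2)]) (use u(1) f(1) ab(1) in simp_all)
    then show "\<exists>u\<in>hom C W (N X j). f \<cdot> u = a \<and> inc X j \<cdot> u = b" using u by blast
  next
    fix W u v assume "u \<in> hom C W (N X j)" "v \<in> hom C W (N X j)" "inc X j \<cdot> u = inc X j \<cdot> v"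
    then show "u = v" using moore_incl_cancel[OF ob(1)] by blast
  qed
  then show ?thesis using re by (rule regular_epi_pullback)
qed

lemma moore_short_exact:
  assumes ses: "short_exact FC (T, X, k) (X, F, q)"
    and T: "T \<in> T_tr C n" and F: "moore_ob C F \<in> MN C (int n + 1)"
  shows "short_exact (ch C) (moore_arr C (T, X, k)) (moore_arr C (X, F, q))"
proof -
  have kerq: "is_kernel FC (X, F, q) (T, X, k)" and cokk: "is_cokernel FC (T, X, k) (X, F, q)"
    using ses by (simp_all add: short_exact_def)
  have k: "(T, X, k) \<in> Arr FC" and q: "(X, F, q) \<in> Arr FC" using FC.kernel_arr[OF kerq] by simp_all
  have ker: "is_kernel C (q j) (k j)" and re: "regular_epi C (q j)" for j
    using kernel_pointwise[OF kerq, of j] cokernel_pointwise_regular_epi[OF cokk, of j] by simp_all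
  have qt: "q i \<in> hom C (FOb X i) (FOb F i)" for i using transD[OF q, of i] by simp
  have kt: "k i \<in> hom C (FOb T i) (FOb X i)" for i using transD[OF k, of i] by simp
  \<comment> \<open>The kernel of \<open>q j\<close> is T_j, which is zero for j up to n.\<close>
  have qm: "mono C (q j)" if "j \<le> n" for j
  proof (rule trivial_kernel_mono[OF qt])
    fix W w assume w: "w \<in> hom C W (FOb X j)" "q j \<cdot> w = zr W (FOb F j)"
    obtain u where u: "u \<in> hom C W (FOb T j)" "k j \<cdot> u = w"
      using kernel_lift[OF ker qt kt w] by blast
    have "zero_obj C (FOb T j)" using T that by (simp add: T_tr_def)
    then have "u = zr W (FOb T j)" using u(1) by (rule to_zero_obj)
    then show "w = zr W (FOb X j)" using u kt[of j] Dom_in[of u] by auto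
  qed
  obtain f where f: "moore_arr C (X, F, q) = (moore_ob C X, moore_ob C F, f)"
      "(moore_ob C X, moore_ob C F, f) \<in> Arr (ch C)" "\<And>j. inc F j \<cdot> f (int j) = q j \<cdot> inc X j"
    using moore_arr_chain_map[OF q] by metis
  obtain g where g: "moore_arr C (T, X, k) = (moore_ob C T, moore_ob C X, g)"
      "(moore_ob C T, moore_ob C X, g) \<in> Arr (ch C)" "\<And>j. inc X j \<cdot> g (int j) = k j \<cdot> inc T j"
    using moore_arr_chain_map[OF k] by metis
  have fj: "f (int j) \<in> hom C (N X j) (N F j)" and gj: "g (int j) \<in> hom C (N T j) (N X j)" for j
    using chain_map[OF f(2), of "int j"] chain_map[OF g(2), of "int j"] by simp_all
  have exact: "is_kernel C (f i) (g i) \<and> regular_epi C (f i)" for i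
  proof (cases "i < 0")
    case True
    let ?Z = "some_zero C"
    have fi: "f i \<in> hom C ?Z ?Z" and gi: "g i \<in> hom C ?Z ?Z"
      using chain_map[OF f(2), of i] chain_map[OF g(2), of i] True by simp_all
    have "is_kernel C (f i) (g i)"
    proof (rule kernelI[OF fi gi])
      show "f i \<cdot> g i = zr ?Z ?Z" by (rule to_zero_obj[OF some_zero]) (use fi gi in simp)
      show "mono C (g i)"
      proof (rule monoI[OF gi])
        fix W a b assume "a \<in> hom C W ?Z" "b \<in> hom C W ?Z"
        then show "a = b" using to_zero_obj[OF some_zero] by metis
      qed
      fix W h assume h: "h \<in> hom C W ?Z"
      have "g i \<cdot> h = h"
        using to_zero_obj[OF some_zero, of "g i \<cdot> h" W] to_zero_obj[OF some_zero h] h gi by simp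
      then show "factors h (g i)" by (intro factorsI[of h]) (use h gi in simp_all)
    qed
    then show ?thesis using to_zero_regular_epi[OF some_zero fi] by blast
  next
    case False
    then obtain j where j: "i = int j" by (metis nonneg_int_cases not_less)
    \<comment> \<open>The pullback argument asks for monicity one degree lower, so it still reaches
      j = n + 1; beyond that the target is zero.\<close>
    have "regular_epi C (f (int j))"
    proof (cases "j \<le> n + 1")
      case True
      then show ?thesis
        by (intro moore_regular_epi[OF q re _ fj f(3)] qm) simp
    next
      case False
      then have "zero_obj C (N F j)" using F unfolding MN_def by (auto dest!: spec[of _ "int j"])
      then show ?thesis using fj by (rule to_zero_regular_epi)
    qed
    moreover have "is_kernel C (f (int j)) (g (int j))"
      by (rule moore_kernel[OF q k ker fj f(3) gj g(3)])
    ultimately show ?thesis unfolding j by blast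
  qed
  then have "is_kernel (ch C) (moore_ob C X, moore_ob C F, f) (moore_ob C T, moore_ob C X, g)"
    by (intro ch_kernelI[OF f(2) g(2)]) blast
  \<comment> \<open>Degree by degree, a regular epimorphism is the cokernel of its kernel.\<close>
  moreover have "is_cokernel (ch C) (moore_ob C T, moore_ob C X, g) (moore_ob C X, moore_ob C F, f)"
    by (intro ch_cokernelI[OF f(2) g(2)] regular_epi_cokernel) (use exact in blast)+
  ultimately show ?thesis by (simp add: short_exact_def f(1) g(1))
qed

text \<open>The sequence is an arbitrary representative, so its ends are known only through
  membership in the two classes. All three Moore complexes are proper, which places the image
  sequence in \<open>pch\<close>.\<close>

lemma moore_ses:
  assumes adj: "adjunction (Simp C) (Simp_upto n C) (tr n) cosk \<eta> \<epsilon>"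
    and ses: "ses_given_by (Simp C) (short_exact (Simp C)) (mu_geq_Suc C n \<eta>) X k q"
  shows "ses_given_by (pch C) (pch_short_exact C) (KER C (int n + 1)) (FOb (Moore C) X)
    (FAr (Moore C) k) (FAr (Moore C) q)"
proof -
  have s: "short_exact FC k q" "Dom FC k \<in> T_tr C n" "Cod FC k = X" "Cod FC q \<in> F_tr C \<eta>"
    using ses by (simp_all add: ses_given_by_def mu_geq_Suc_def Simp_FC)
  obtain T \<kappa> where k: "k = (T, X, \<kappa>)" using s(3) by (metis funct_cat_simps(2) prod_cases3)
  have "Dom FC q = X" using s(1) unfolding short_exact_def is_kernel_def k by simp
  then obtain F \<pi> where q: "q = (X, F, \<pi>)" by (metis funct_cat_simps(1) prod_cases3)
  have T: "T \<in> T_tr C n" and F: "F \<in> F_tr C \<eta>" using s(2,4) by (simp_all add: k q)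
  have ar: "(T, X, \<kappa>) \<in> Arr FC" "(X, F, \<pi>) \<in> Arr FC"
    using s(1) unfolding short_exact_def is_kernel_def k q by simp_all
  have NT: "moore_ob C T \<in> pch_geq C (int n + 1)" and NF: "moore_ob C F \<in> MN C (int n + 1)"
    by (rule moore_T_tr[OF T], rule moore_F_tr[OF adj F])
  have se: "short_exact (ch C) (moore_arr C k) (moore_arr C q)"
    using moore_short_exact[OF _ T NF] s(1) unfolding k q by blast
  have P: "proper C (moore_ob C T)" "proper C (moore_ob C X)" "proper C (moore_ob C F)"
    using moore_ob_proper trans_Obj(1,2)[OF ar(1)] trans_Obj(2)[OF ar(2)] by blast+
  obtain g where g: "moore_arr C k = (moore_ob C T, moore_ob C X, g)"
      "(moore_ob C T, moore_ob C X, g) \<in> Arr (ch C)"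
    unfolding k using moore_arr_chain_map[OF ar(1)] by metis
  obtain f where f: "moore_arr C q = (moore_ob C X, moore_ob C F, f)"
      "(moore_ob C X, moore_ob C F, f) \<in> Arr (ch C)"
    unfolding q using moore_arr_chain_map[OF ar(2)] by metis
  show ?thesis
    using se NT NF P f g
    by (simp add: ses_given_by_def KER_def Moore_def pch_short_exact_def pch_def full_subcat_def)
qed

end

theorem theorem5p8:
  fixes \<X> :: "('o, 'm) cat" and n :: nat and X :: "('o, 'm) simp"
    and cosk :: "(('o, 'm) simp, ('o, 'm) simp_arr, ('o, 'm) simp, ('o, 'm) simp_arr) funct"
    and \<eta> \<epsilon> :: "('o, 'm) simp \<Rightarrow> ('o, 'm) simp_arr"
  assumes "semi_abelian \<X>"
    and "adjunction (Simp \<X>) (Simp_upto n \<X>) (tr n) cosk \<eta> \<epsilon>"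
    and "X \<in> Obj (Simp \<X>)"
  shows "(\<forall>k q. ses_given_by (Simp \<X>) (short_exact (Simp \<X>)) (mu_geq_Suc \<X> n \<eta>) X k q
            \<longrightarrow> ses_given_by (pch \<X>) (pch_short_exact \<X>) (KER \<X> (int n + 1)) (FOb (Moore \<X>) X)
                  (FAr (Moore \<X>) k) (FAr (Moore \<X>) q))
       \<and> (\<forall>T \<in> T_tr \<X> n. FOb (Moore \<X>) T \<in> pch_geq \<X> (int n + 1))
       \<and> (\<forall>F \<in> F_tr \<X> \<eta>. FOb (Moore \<X>) F \<in> MN \<X> (int n + 1))"
proof -
  interpret simplicial_objects \<X>
    by (rule semi_abelian_category.simplicial_objects) (rule semi_abelian_category.intro[OF assms(1)])
  show ?thesis
    using moore_ses[OF assms(2)] moore_T_tr moore_F_tr[OF assms(2)] by (simp add: Moore_def)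
qed

end
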